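(* Let $\alpha\in[-1/2,\infty)^d$ and $\varepsilon\in\{0,1\}^d$. (a) For $\eta$ a bounded measurable function on $(0,\infty)$, the kernel $K^{\alpha,\varepsilon}(x,y)=-\int_0^\infty\partial_tG^{\alpha,\varepsilon}_t(x,y)\eta(t)\,dt$ satisfies, for all $x,y\in\mathbb{R}^d_+$ with $x\ne y$, $|K^{\alpha,\varepsilon}(x,y)|\lesssim \dfrac{1}{w^+_\alpha(B(x,|y-x|))}$ and $|\nabla_{x,y}K^{\alpha,\varepsilon}(x,y)|\lesssim\dfrac{1}{|x-y|}\dfrac{1}{w^+_\alpha(B(x,|y-x|))}$. (b) For $\mu$ a signed or complex Borel measure on $(0,\infty)$ with $\int_0^\infty e^{-t\lambda_0^\alpha}d|\mu|(t)<\infty$, the kernel $\mathcal{K}^{\alpha,\varepsilon}(x,y)=\int_0^\infty G^{\alpha,\varepsilon}_t(x,y)\,d\mu(t)$ satisfies the same two estimates: for $x,y\in\mathbb{R}^d_+$, $x\ne y$, $|\mathcal K^{\alpha,\varepsilon}(x,y)|\lesssim 1/w^+_\alpha(B(x,|y-x|))$ and $|\nabla_{x,y}\mathcal K^{\alpha,\varepsilon}(x,y)|\lesssim |x-y|^{-1}/w^+_\alpha(B(x,|y-x|))$. The implicit constants are independent of $x,y$.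
   Context: Notation: $|\alpha|=\sum\alpha_i$; $dw_\alpha(x)=\prod_j|x_j|^{2\alpha_j+1}dx$; $\mathbb{R}^d_+=(0,\infty)^d$, $w^+_\alpha$ the restriction of $w_\alpha$ to $\mathbb{R}^d_+$; $B(x,r)=\{y\in\mathbb{R}^d_+:|y-x|<r\}$; $\lambda^\alpha_0=2|\alpha|+2d$. Heat kernel components: for $x,y\in\mathbb{R}^d_+$, $t>0$, $\varepsilon\in\{0,1\}^d$, $G^{\alpha,\varepsilon}_t(x,y)=(2\sinh 2t)^{-d}\exp\!\big(-\tfrac12\coth(2t)(|x|^2+|y|^2)\big)\prod_{i=1}^d(x_iy_i)^{\varepsilon_i}\frac{I_{\alpha_i+\varepsilon_i}(x_iy_i/\sinh 2t)}{(x_iy_i)^{\alpha_i+\varepsilon_i}}$, where $I_\nu$ is the modified Bessel function of the first kind. (This is the part, over multi-indices $k$ with $k_i\equiv\varepsilon_i\pmod 2$, of the heat kernel of the Dunkl harmonic oscillator associated with the reflection group $\mathbb{Z}_2^d$.) *)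

theory Defs
  imports "HOL-Analysis.Analysis"
begin

text \<open>Modified Bessel function of the first kind (used for positive arguments).\<close>
definition besselI :: "real \<Rightarrow> real \<Rightarrow> real" where
  "besselI \<nu> z = (\<Sum>k. (z / 2) powr (2 * real k + \<nu>) / (fact k * Gamma (real k + \<nu> + 1)))"

definition Rplus :: "(real ^ 'd) set" where
  "Rplus = {x. \<forall>i. 0 < x $ i}"

definition w_alpha :: "real ^ 'd \<Rightarrow> (real ^ 'd) measure" where
  "w_alpha \<alpha> = density lborel (\<lambda>x. ennreal (\<Prod>j\<in>UNIV. \<bar>x $ j\<bar> powr (2 * \<alpha> $ j + 1)))"

text \<open>B(x,r) = ball inside the positive orthant; w_alpha^+(B) = w_alpha(B) since B is in the orthant.\<close>
definition ballplus :: "real ^ 'd \<Rightarrow> real \<Rightarrow> (real ^ 'd) set" where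
  "ballplus x r = {y \<in> Rplus. dist y x < r}"

definition lambda0 :: "real ^ 'd \<Rightarrow> real" where
  "lambda0 \<alpha> = 2 * (\<Sum>i\<in>UNIV. \<alpha> $ i) + 2 * real CARD('d)"

definition heatG :: "real ^ 'd \<Rightarrow> ('d \<Rightarrow> nat) \<Rightarrow> real \<Rightarrow> real ^ 'd \<Rightarrow> real ^ 'd \<Rightarrow> real" where
  "heatG \<alpha> \<epsilon> t x y =
     (2 * sinh (2 * t)) powr (- real CARD('d))
     * exp (- (1/2) * (cosh (2 * t) / sinh (2 * t)) * ((norm x)\<^sup>2 + (norm y)\<^sup>2))
     * (\<Prod>i\<in>UNIV. (x $ i * y $ i) ^ (\<epsilon> i)
          * besselI (\<alpha> $ i + real (\<epsilon> i)) (x $ i * y $ i / sinh (2 * t))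
          / (x $ i * y $ i) powr (\<alpha> $ i + real (\<epsilon> i)))"

definition kernelA :: "real ^ 'd \<Rightarrow> ('d \<Rightarrow> nat) \<Rightarrow> (real \<Rightarrow> complex) \<Rightarrow> real ^ 'd \<Rightarrow> real ^ 'd \<Rightarrow> complex" where
  "kernelA \<alpha> \<epsilon> \<eta> x y =
     - set_lebesgue_integral lborel {0<..}
         (\<lambda>t. complex_of_real (deriv (\<lambda>s. heatG \<alpha> \<epsilon> s x y) t) * \<eta> t)"

text \<open>Kernel (b): the complex measure mu is represented as mu = h * nu with nu a positive
  Borel measure M and h a measurable complex density, so |mu| = |h| nu.\<close>
definition kernelB :: "real ^ 'd \<Rightarrow> ('d \<Rightarrow> nat) \<Rightarrow> real measure \<Rightarrow> (real \<Rightarrow> complex) \<Rightarrow> real ^ 'd \<Rightarrow> real ^ 'd \<Rightarrow> complex" where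
  "kernelB \<alpha> \<epsilon> M h x y =
     set_lebesgue_integral M {0<..} (\<lambda>t. complex_of_real (heatG \<alpha> \<epsilon> t x y) * h t)"

text \<open>The two standard (Calderon-Zygmund type) estimates, with a constant independent of x, y;
  the gradient is the full derivative in (x,y) in R^d x R^d, bounded in operator norm.\<close>
definition CZ_estimates :: "real ^ 'd \<Rightarrow> (real ^ 'd \<Rightarrow> real ^ 'd \<Rightarrow> complex) \<Rightarrow> bool" where
  "CZ_estimates \<alpha> K \<longleftrightarrow>
     (\<exists>C. \<forall>x\<in>Rplus. \<forall>y\<in>Rplus. x \<noteq> y \<longrightarrow>
        norm (K x y) \<le> C / measure (w_alpha \<alpha>) (ballplus x (dist y x))
      \<and> (\<exists>D. ((\<lambda>p. K (fst p) (snd p)) has_derivative D) (at (x, y))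
            \<and> (\<forall>v. norm (D v) \<le> C / (dist x y * measure (w_alpha \<alpha>) (ballplus x (dist y x))) * norm v)))"

end

theory Submission
  imports Defs
begin

text \<open>
  The kernel factors over the coordinates. With \<open>T = tanh t\<close> and \<open>s = sinh 2t\<close>, Meda's change of
  variable turns each factor into \<open>s\<close> to the power \<open>-1-\<alpha>\<close> times \<open>exp (-Q) * H (xy/s)\<close>, where
  \<open>Q = (x-y)^2/(4T) + T(x+y)^2/4\<close> and \<open>H\<close> is the exponentially rescaled Bessel function. A first
  order differential inequality for contiguous Bessel functions shows that \<open>H\<close> and its first two
  derivatives decay like a symbol of order \<open>-\<alpha>-1/2\<close>. Hence every space derivative costs a factor
  \<open>T\<close> to the power \<open>-1/2\<close> and a time derivative a factor \<open>1/T\<close>, all polynomial losses in \<open>Q\<close> being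
  absorbed by \<open>exp (-Q/2)\<close>. Since \<open>Q\<close> dominates \<open>|x-y|^2/(4T)\<close>, powers of \<open>1/T\<close> can be traded for
  powers of \<open>1/|x-y|\<close>. In case (b) this bounds \<open>exp (t \<lambda>)\<close> times the kernel uniformly in \<open>t\<close>; in
  case (a) three half powers of \<open>1/T\<close> are kept, which leaves an integrable function of \<open>t\<close>.
\<close>

text \<open>What shapes the argument is the weighted volume on the right-hand side. In coordinate i
  the Bessel symbol only offers the size s + x_i y_i, while a ball of radius r = |x - y| calls for
  (x_i + r)^2, with the full distance r even where |x_i - y_i| is much smaller. The comparison
  therefore runs with Q summed over all coordinates, for which r^2 \<le> 4 T Q, and it costs powers
  of 1 + Q. It must also release the full factor exp (2t), because the exponents have to add up to
  \<open>lambda0\<close>. Both parities are treated at once: for e = 1 the extra factor z lifts the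
  symbol of order -(\<alpha> + 1) - 1/2 back to -\<alpha> - 1/2. In case (a), maximizing over t
  before integrating would leave a spurious factor r^(-2); the retained profile r (r^2 + t)^(-3/2)
  has time integral 2 for every r. Divided by r this profile decreases in r, which also yields the
  local domination needed to differentiate under the integral.\<close>

section \<open>The modified Bessel function\<close>

text \<open>With \<open>u = z^2/4\<close>, the Bessel function is \<open>(z/2)\<close> to the power \<open>\<nu>\<close> times this series.\<close>
definition bessel_series :: "real \<Rightarrow> real \<Rightarrow> real" where
  "bessel_series \<nu> u = (\<Sum>k. (1 / (fact k * Gamma (real k + \<nu> + 1))) * u ^ k)"

lemma Gamma_shift:
  fixes \<nu> :: real
  assumes "\<nu> > -1"
  shows "Gamma (real k + \<nu> + 1 + 1) = (real k + \<nu> + 1) * Gamma (real k + \<nu> + 1)"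
  using assms by (intro Gamma_plus1) (auto simp: nonpos_Ints_def)

lemma summable_bessel_series:
  fixes \<nu> u :: real
  assumes "\<nu> \<ge> -1/2"
  shows "summable (\<lambda>k. (1 / (fact k * Gamma (real k + \<nu> + 1))) * u ^ k)"
\<comment> \<open>The ratio of consecutive terms is |u| / ((n+1)(n+\<nu>+1)). Since n + \<nu> + 1
  \<ge> 1/2, the threshold n \<ge> 4|u| makes the denominator at least 2|u|.\<close>
proof (rule summable_ratio_test[where c = "1/2" and N = "nat \<lceil>4 * \<bar>u\<bar>\<rceil>"])
  fix n assume "n \<ge> nat \<lceil>4 * \<bar>u\<bar>\<rceil>"
  hence n: "real n \<ge> 4 * \<bar>u\<bar>" by linarith
  have G: "Gamma (real n + \<nu> + 1) > 0" using assms by (intro Gamma_real_pos) linarith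
  have m: "(real n + 1) * (real n + \<nu> + 1) \<ge> 2 * \<bar>u\<bar>"
  proof -
    have "(4 * \<bar>u\<bar>) * (1/2) \<le> (real n + 1) * (real n + \<nu> + 1)"
      using n assms by (intro mult_mono) auto
    thus ?thesis by simp
  qed
  have p: "(real n + 1) * (real n + \<nu> + 1) > 0" using assms by (intro mult_pos_pos) auto
  have "norm (1 / (fact (Suc n) * Gamma (real (Suc n) + \<nu> + 1)) * u ^ Suc n)
     = (\<bar>u\<bar> / ((real n + 1) * (real n + \<nu> + 1))) * norm (1 / (fact n * Gamma (real n + \<nu> + 1)) * u ^ n)"
    using Gamma_shift[of \<nu> n] G assms p
    by (simp add: abs_mult power_abs divide_simps)
  also have "\<dots> \<le> 1/2 * norm (1 / (fact n * Gamma (real n + \<nu> + 1)) * u ^ n)"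
    using m p by (intro mult_right_mono) (auto simp: divide_simps)
  finally show "norm (1 / (fact (Suc n) * Gamma (real (Suc n) + \<nu> + 1)) * u ^ Suc n)
     \<le> 1/2 * norm (1 / (fact n * Gamma (real n + \<nu> + 1)) * u ^ n)" .
qed auto

lemma bessel_series_pos:
  assumes "\<nu> \<ge> -1/2" "u \<ge> 0"
  shows "bessel_series \<nu> u > 0"
proof -
  have G: "Gamma (real k + \<nu> + 1) > 0" for k using assms by (intro Gamma_real_pos) linarith
  have "(\<Sum>k. (1 / (fact k * Gamma (real k + \<nu> + 1))) * u ^ k) > 0"
    using summable_bessel_series[OF assms(1)] assms G
    by (intro suminf_pos2[where i = 0]) (auto intro!: mult_nonneg_nonneg less_imp_le)
  thus ?thesis by (simp add: bessel_series_def)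
qed

text \<open>The factor n+1 produced by differentiation cancels against the factorial, and the index
  shift that remains is absorbed by the argument of Gamma.\<close>

lemma bessel_series_deriv:
  assumes "\<nu> \<ge> -1/2"
  shows "(bessel_series \<nu> has_field_derivative bessel_series (\<nu> + 1) u) (at u)"
proof -
  define c where "c = (\<lambda>k. 1 / (fact k * Gamma (real k + \<nu> + 1)))"
  have "((\<lambda>x. \<Sum>n. c n * x ^ n) has_field_derivative (\<Sum>n. diffs c n * u ^ n)) (at u)"
    unfolding c_def using summable_bessel_series[OF assms] by (rule termdiffs_strong_converges_everywhere)
  moreover have "diffs c n = 1 / (fact n * Gamma (real n + (\<nu> + 1) + 1))" for n
  proof -
    have e: "real (Suc n) + \<nu> + 1 = real n + (\<nu> + 1) + 1" by simp
    show ?thesis unfolding diffs_def c_def e by (simp add: divide_simps)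
  qed
  ultimately show ?thesis by (simp add: bessel_series_def[abs_def] c_def)
qed

text \<open>This is the three-term recurrence I_\<nu>(z) = I_(\<nu>+2)(z) + (2(\<nu>+1)/z)
  I_(\<nu>+1)(z) with the powers of z removed. Coefficientwise it says k + \<nu> + 2 = (k+1) +
  (\<nu>+1).\<close>

lemma bessel_series_rec:
  assumes "\<nu> \<ge> -1/2"
  shows "bessel_series \<nu> u = u * bessel_series (\<nu> + 2) u + (\<nu> + 1) * bessel_series (\<nu> + 1) u"
proof -
  define c where "c = (\<lambda>\<nu> k. 1 / (fact k * Gamma (real k + \<nu> + 1)))"
  have S: "summable (\<lambda>k. c \<nu>' k * u ^ k)" if "\<nu>' \<ge> -1/2" for \<nu>'
    using summable_bessel_series[OF that] by (simp add: c_def)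
  have G: "Gamma (real k + \<nu> + 1) > 0" for k using assms by (intro Gamma_real_pos) linarith
  have rec0: "c \<nu> 0 = (\<nu> + 1) * c (\<nu> + 1) 0"
    using Gamma_shift[of \<nu> 0] assms G[of 0] by (simp add: c_def add_ac)
  have rec: "c \<nu> (Suc k) = c (\<nu> + 2) k + (\<nu> + 1) * c (\<nu> + 1) (Suc k)" for k
  proof -
    have e: "real k + (\<nu> + 2) + 1 = real (Suc k) + \<nu> + 1 + 1"
      "real (Suc k) + (\<nu> + 1) + 1 = real (Suc k) + \<nu> + 1 + 1" by auto
    define g where "g = Gamma (real (Suc k) + \<nu> + 1)"
    have "g > 0" using G[of "Suc k"] by (simp add: g_def)
    moreover have "real k + \<nu> + 2 > 0" using assms by linarith
    ultimately show ?thesis unfolding c_def e using Gamma_shift[of \<nu> "Suc k"] assms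
      unfolding g_def[symmetric] by (simp add: divide_simps del: of_nat_Suc)
  qed
  have "bessel_series \<nu> u = (\<Sum>k. c \<nu> (k+1) * u ^ (k+1)) + c \<nu> 0"
    using suminf_split_initial_segment[OF S[OF assms], of 1] by (simp add: bessel_series_def c_def)
  also have "(\<Sum>k. c \<nu> (k+1) * u ^ (k+1))
     = (\<Sum>k. u * (c (\<nu>+2) k * u ^ k) + (\<nu>+1) * (c (\<nu>+1) (k+1) * u ^ (k+1)))"
    by (intro suminf_cong) (simp add: rec algebra_simps)
  also have "\<dots> = u * (\<Sum>k. c (\<nu>+2) k * u ^ k) + (\<nu>+1) * (\<Sum>k. c (\<nu>+1) (k+1) * u ^ (k+1))"
    using assms S[of "\<nu>+2"] summable_ignore_initial_segment[OF S[of "\<nu>+1"], of 1]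
    by (subst suminf_add[symmetric]) (auto simp: suminf_mult summable_mult)
  also have "(\<Sum>k. c (\<nu>+1) (k+1) * u ^ (k+1)) = bessel_series (\<nu>+1) u - c (\<nu>+1) 0"
    using suminf_split_initial_segment[OF S[of "\<nu>+1"], of 1] assms by (simp add: bessel_series_def c_def)
  finally show ?thesis using rec0 by (simp add: bessel_series_def c_def algebra_simps)
qed

text \<open>The known object is z^(-\<nu>) I_\<nu>(z). Unlike I_\<nu> itself it is smooth and even
  across z = 0, so the inequalities below hold up to z = 0 and derivatives there are
  two-sided.\<close>

definition bessel_entire :: "real \<Rightarrow> real \<Rightarrow> real" where
  "bessel_entire \<nu> z = 2 powr (-\<nu>) * bessel_series \<nu> (z\<^sup>2 / 4)"

lemma besselI_eq:
  assumes "\<nu> \<ge> -1/2" "z > 0"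
  shows "besselI \<nu> z = z powr \<nu> * bessel_entire \<nu> z"
proof -
  have "besselI \<nu> z = (\<Sum>k. (z / 2) powr \<nu> * (1 / (fact k * Gamma (real k + \<nu> + 1)) * (z\<^sup>2 / 4) ^ k))"
    unfolding besselI_def
  proof (intro suminf_cong)
    fix k
    have "(z / 2) powr (2 * real k + \<nu>) = (z/2) powr real (2 * k) * (z / 2) powr \<nu>"
      by (simp add: powr_add)
    also have "(z/2) powr real (2 * k) = (z\<^sup>2 / 4) ^ k"
      using assms by (subst powr_realpow) (auto simp: power_mult power_divide)
    finally show "(z / 2) powr (2 * real k + \<nu>) / (fact k * Gamma (real k + \<nu> + 1)) = 
       (z / 2) powr \<nu> * (1 / (fact k * Gamma (real k + \<nu> + 1)) * (z\<^sup>2 / 4) ^ k)" by simp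
  qed
  also have "\<dots> = (z/2) powr \<nu> * bessel_series \<nu> (z\<^sup>2/4)"
    unfolding bessel_series_def by (rule suminf_mult[OF summable_bessel_series[OF assms(1)]])
  also have "(z/2) powr \<nu> = z powr \<nu> * 2 powr (-\<nu>)"
    using assms by (simp add: powr_divide powr_minus divide_simps)
  finally show ?thesis by (simp add: bessel_entire_def)
qed

lemma bessel_entire_pos: "\<nu> \<ge> -1/2 \<Longrightarrow> bessel_entire \<nu> z > 0"
  by (simp add: bessel_entire_def bessel_series_pos)

lemma bessel_entire_deriv:
  assumes "\<nu> \<ge> -1/2"
  shows "(bessel_entire \<nu> has_real_derivative z * bessel_entire (\<nu> + 1) z) (at z)"
proof -
  have "((\<lambda>z. 2 powr (-\<nu>) * bessel_series \<nu> (z\<^sup>2 / 4)) has_real_derivative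
     2 powr (-\<nu>) * (bessel_series (\<nu> + 1) (z\<^sup>2 / 4) * (2 * z / 4))) (at z)"
    by (rule derivative_eq_intros DERIV_chain2[OF bessel_series_deriv[OF assms]] refl | simp)+
  moreover have "2 powr (-(\<nu>+1)) = 2 powr (-\<nu>) / (2::real)"
    by (simp add: powr_diff)
  ultimately show ?thesis
    by (simp only: bessel_entire_def[abs_def]) (simp add: mult_ac)
qed

lemma bessel_entire_rec:
  assumes "\<nu> \<ge> -1/2"
  shows "bessel_entire \<nu> z = z\<^sup>2 * bessel_entire (\<nu> + 2) z + 2 * (\<nu> + 1) * bessel_entire (\<nu> + 1) z"
proof -
  have "2 powr (-(\<nu>+1)) = 2 powr (-\<nu>) / (2::real)" "2 powr (-(\<nu>+2)) = 2 powr (-\<nu>) / (4::real)"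
    by (simp_all add: powr_diff)
  thus ?thesis using bessel_series_rec[OF assms, of "z\<^sup>2/4"]
    by (simp only: bessel_entire_def) (simp add: algebra_simps)
qed

section \<open>Inequalities between contiguous Bessel functions\<close>

text \<open>The difference of the two sides solves a first order linear equation whose source term
  is non-negative. The constant is sharp: for large z the quotient of the two functions is z + \<nu>
  + 1/2 + o(1). This sharpness is what later makes a second derivative gain two powers of 1 +
  z.\<close>

lemma bessel_entire_ge:
  assumes "\<nu> \<ge> -1/2" "z \<ge> 0"
  shows "(z + \<nu> + 1/2) * bessel_entire (\<nu> + 1) z \<le> bessel_entire \<nu> z"
proof -
  define a where "a = \<nu> + 1/2"
  have a: "a \<ge> 0" using assms by (simp add: a_def)
  define F0 where "F0 = bessel_entire \<nu>"
  define F1 where "F1 = bessel_entire (\<nu> + 1)"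
  define F2 where "F2 = bessel_entire (\<nu> + 2)"
  have F1p: "F1 w > 0" for w unfolding F1_def using assms by (intro bessel_entire_pos) auto
  have rec: "F0 w = w\<^sup>2 * F2 w + (2*a+1) * F1 w" for w
    using bessel_entire_rec[OF assms(1), of w] by (simp add: F0_def F1_def F2_def a_def algebra_simps)
  have d0: "(F0 has_real_derivative w * F1 w) (at w)" for w
    using bessel_entire_deriv[OF assms(1)] by (simp add: F0_def F1_def)
  have d1: "(F1 has_real_derivative w * F2 w) (at w)" for w
    using bessel_entire_deriv[of "\<nu>+1" w] assms by (simp add: F1_def F2_def add.assoc)
  define D where "D = (\<lambda>w. F0 w - (w + a) * F1 w)"
  have dD: "(D has_real_derivative (w * F1 w - (F1 w + (w + a) * (w * F2 w)))) (at w)" for w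
    unfolding D_def by (rule derivative_eq_intros d0 d1 refl | simp)+
  have contD: "isCont D w" for w using dD DERIV_isCont by blast
  have D0: "D 0 > 0" using rec[of 0] F1p[of 0] a unfolding D_def by (simp add: algebra_simps add_pos_nonneg)
  \<comment> \<open>\<open>z D' = -(z+a) D + a(a+1) F1\<close>, so \<open>z powr a * exp z * D z\<close> is nondecreasing; it starts positive.\<close>
  have "D z \<ge> 0"
  proof (cases "z = 0")
    case False
    hence z: "z > 0" using assms by simp
    have "\<forall>\<^sub>F w in at 0. D w > 0"
      using contD[of 0] D0 by (intro order_tendstoD) (auto simp: isCont_def)
    hence "\<forall>\<^sub>F w in at_right 0. D w > 0" by (simp add: eventually_at_split)
    moreover have "\<forall>\<^sub>F w in at_right 0. w < z" using z by (simp add: eventually_at_right_less eventually_at_right_field) blast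
    moreover have "\<forall>\<^sub>F w in at_right (0::real). w > 0" by (simp add: eventually_at_right_less)
    ultimately have "\<forall>\<^sub>F w in at_right 0. D w > 0 \<and> w < z \<and> w > 0" by eventually_elim auto
    \<comment> \<open>The derivative of \<open>w powr a\<close> is only available for w > 0, so the
      comparison starts at a small positive w, where continuity keeps D positive; D 0 equals (a+1)
      F1 0.\<close>
    then obtain w where w: "D w > 0" "w < z" "w > 0"
      using eventually_happens' trivial_limit_at_right_real by blast
    have "w powr a * exp w * D w \<le> z powr a * exp z * D z"
    proof (rule DERIV_nonneg_imp_nondecreasing[of w z "\<lambda>w. w powr a * exp w * D w"])
      fix v assume v: "w \<le> v" "v \<le> z"
      hence v0: "v > 0" using w by simp
      have key: "v * (v * F1 v - (F1 v + (v + a) * (v * F2 v))) = - (v + a) * D v + a * (a+1) * F1 v"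
      proof -
        have "v * (v * F2 v) = F0 v - (2*a+1) * F1 v" using rec[of v] by (simp add: power2_eq_square)
        hence "v * ((v + a) * (v * F2 v)) = (v+a) * (F0 v - (2*a+1) * F1 v)" by (metis mult.left_commute)
        thus ?thesis unfolding D_def by (simp add: algebra_simps)
      qed
      have "((\<lambda>w. w powr a * exp w * D w) has_real_derivative
         (v powr a * exp v * (v * F1 v - (F1 v + (v + a) * (v * F2 v)))
         + (v powr a * exp v + a * v powr (a - 1) * exp v) * D v)) (at v)"
        by (rule derivative_eq_intros dD refl | use v0 in \<open>simp add: algebra_simps\<close>)+
      moreover have "(v powr a * exp v * (v * F1 v - (F1 v + (v + a) * (v * F2 v)))
         + (v powr a * exp v + a * v powr (a - 1) * exp v) * D v)
         = v powr (a - 1) * exp v * (v * (v * F1 v - (F1 v + (v + a) * (v * F2 v))) + (v + a) * D v)"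
      proof -
        have "v powr a = v powr (a-1) * v" using v0 by (simp add: powr_diff)
        thus ?thesis by (simp only:) (simp add: algebra_simps)
      qed
      moreover have "\<dots> = v powr (a - 1) * exp v * (a * (a+1) * F1 v)" unfolding key by (simp add: algebra_simps)
      moreover have "\<dots> \<ge> 0" using a F1p[of v] by simp
      ultimately show "\<exists>y. ((\<lambda>w. w powr a * exp w * D w) has_real_derivative y) (at v) \<and> 0 \<le> y" by metis
    qed (use w in auto)
    moreover have "w powr a * exp w * D w > 0" using w by simp
    ultimately show ?thesis using z by (smt (verit) exp_gt_zero mult_nonneg_nonpos2 mult_pos_pos powr_gt_zero zero_less_mult_iff)
  qed (use D0 in auto)
  thus ?thesis by (simp add: D_def F0_def F1_def a_def algebra_simps)
qed

text \<open>The lower bound taken one order higher and weakened to z F2 \<le> F1 goes into the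
  recurrence. The constant 2\<nu> + 2 is cruder than in the lower bound, but a bounded excess over z
  is enough for first derivatives.\<close>

lemma bessel_entire_le:
  assumes "\<nu> \<ge> -1/2" "z \<ge> 0"
  shows "bessel_entire \<nu> z \<le> (z + 2 * \<nu> + 2) * bessel_entire (\<nu> + 1) z"
proof -
  have "(z + (\<nu>+1) + 1/2) * bessel_entire (\<nu> + 2) z \<le> bessel_entire (\<nu> + 1) z"
    using bessel_entire_ge[of "\<nu>+1" z] assms by (simp add: add.assoc)
  moreover have "z * bessel_entire (\<nu> + 2) z \<le> (z + (\<nu>+1) + 1/2) * bessel_entire (\<nu> + 2) z"
    using assms bessel_entire_pos[of "\<nu>+2" z] by (intro mult_right_mono) auto
  ultimately have "z * bessel_entire (\<nu> + 2) z \<le> bessel_entire (\<nu> + 1) z" by linarith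
  hence "z * (z * bessel_entire (\<nu> + 2) z) \<le> z * bessel_entire (\<nu> + 1) z"
    using assms by (intro mult_left_mono)
  thus ?thesis using bessel_entire_rec[OF assms(1), of z] by (simp add: algebra_simps power2_eq_square)
qed

text \<open>Every derivative must gain a full power of 1 + z, although its terms F0 and z F1 are
  separately as large as F0. The gain comes from cancellation: F0 - z F1 \<le> (2a+1) F1, and F0 -
  (z+a) F1 is of the size of F2, while each increase of the order lowers the function by a factor of
  about 1 + z.\<close>

lemma scaled_bessel_bounds:
  assumes nu: "\<nu> \<ge> -1/2"
  obtains C and E E1 E2 :: "real \<Rightarrow> real" where "C \<ge> 0"
    "\<And>z. (E has_real_derivative E1 z) (at z)" "\<And>z. (E1 has_real_derivative E2 z) (at z)"
    "\<And>z. bessel_entire \<nu> z = exp z * E z"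
    "\<And>z. z \<ge> 0 \<Longrightarrow> \<bar>E z\<bar> \<le> C * (1 + z) powr (-(\<nu> + 1/2))"
    "\<And>z. z \<ge> 0 \<Longrightarrow> \<bar>E1 z\<bar> \<le> C * (1 + z) powr (-(\<nu> + 1/2) - 1)"
    "\<And>z. z \<ge> 0 \<Longrightarrow> \<bar>E2 z\<bar> \<le> C * (1 + z) powr (-(\<nu> + 1/2) - 2)"
proof -
  define a where "a = \<nu> + 1/2"
  have a: "a \<ge> 0" using nu by (simp add: a_def)
  define F0 where "F0 = bessel_entire \<nu>"
  define F1 where "F1 = bessel_entire (\<nu> + 1)"
  define F2 where "F2 = bessel_entire (\<nu> + 2)"
  have F0p: "F0 w > 0" and F1p: "F1 w > 0" and F2p: "F2 w > 0" for w
    using nu by (auto simp: F0_def F1_def F2_def intro!: bessel_entire_pos)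
  have rec: "F0 w = w\<^sup>2 * F2 w + (2*a+1) * F1 w" for w
    using bessel_entire_rec[OF nu, of w] by (simp add: F0_def F1_def F2_def a_def algebra_simps)
  have d0: "(F0 has_real_derivative w * F1 w) (at w)" for w
    using bessel_entire_deriv[OF nu] by (simp add: F0_def F1_def)
  have d1: "(F1 has_real_derivative w * F2 w) (at w)" for w
    using bessel_entire_deriv[of "\<nu>+1" w] nu by (simp add: F1_def F2_def add.assoc)
  have ge0: "(z + a) * F1 z \<le> F0 z" if "z \<ge> 0" for z
    using bessel_entire_ge[OF nu that] by (simp add: F0_def F1_def a_def add.assoc)
  have ge1: "(z + a + 1) * F2 z \<le> F1 z" if "z \<ge> 0" for z
    using bessel_entire_ge[of "\<nu>+1" z] that nu by (simp add: F1_def F2_def a_def add_ac)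
  have le0: "F0 z \<le> (z + 2 * a + 1) * F1 z" if "z \<ge> 0" for z
    using bessel_entire_le[OF nu that] by (simp add: F0_def F1_def a_def algebra_simps)
  have half: "(1 + z) * F1 z \<le> 2 * F0 z" if "z \<ge> 0" for z
  proof -
    have "F0 z \<ge> F1 z" using rec[of z] mult_nonneg_nonneg[of a "F1 z"] a F1p[of z] F2p[of z] 
      by (smt (verit) mult_cancel_right1 mult_nonneg_nonneg ring_class.ring_distribs(2) zero_le_power2)
    moreover have "z * F1 z \<le> (z + a) * F1 z" using a F1p[of z] by (intro mult_right_mono) auto
    ultimately show ?thesis using ge0[OF that] by (simp add: algebra_simps)
  qed
  have half1: "(1 + z) * F2 z \<le> 2 * F1 z" if "z \<ge> 0" for z
  proof -
    have "(1 + z) * F2 z \<le> (z + a + 1) * F2 z" using a F2p[of z] by (intro mult_right_mono) auto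
    thus ?thesis using ge1[OF that] F1p[of z] by linarith
  qed
  define E where "E = (\<lambda>z. exp (-z) * F0 z)"
  define E1 where "E1 = (\<lambda>z. - exp (-z) * (F0 z - z * F1 z))"
  \<comment> \<open>The recurrence eliminates z^2 F2 from the second derivative, and what remains is
    twice the difference whose sign \<open>bessel_entire_ge\<close> controls.\<close>
  define E2 where "E2 = (\<lambda>z. 2 * exp (-z) * (F0 z - (z + a) * F1 z))"
  have dE: "(E has_real_derivative E1 z) (at z)" for z
    unfolding E_def E1_def by (rule derivative_eq_intros d0 refl | simp add: algebra_simps)+
  have dE1: "(E1 has_real_derivative E2 z) (at z)" for z
  proof -
    have "(E1 has_real_derivative exp (-z) * (F0 z - z * F1 z) - exp (-z) * (z * F1 z - (F1 z + z * (z * F2 z)))) (at z)"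
      unfolding E1_def by (rule derivative_eq_intros d0 d1 refl | simp add: algebra_simps)+
    moreover have "z * (z * F2 z) = F0 z - (2*a+1) * F1 z" using rec[of z] by (simp add: power2_eq_square)
    ultimately show ?thesis by (simp only:) (simp add: E2_def algebra_simps)
  qed
  define K where "K = (a + 1) powr a * E 0"
  have Epos: "E z > 0" for z using F0p by (simp add: E_def)
  have K: "K > 0" using a Epos[of 0] by (simp add: K_def)
  \<comment> \<open>\<open>(a+1+z) powr a * E z\<close> is nonincreasing; the shift by \<open>1\<close> also covers \<open>a = 0\<close>.\<close>
  have bE: "E z \<le> K * (1 + z) powr (-a)" if z: "z \<ge> 0" for z
  proof -
    have "(a + 1 + z) powr a * E z \<le> (a + 1 + 0) powr a * E 0"
    proof (rule DERIV_nonpos_imp_nonincreasing[of 0 z "\<lambda>z. (a + 1 + z) powr a * E z"])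
      fix v assume v: "0 \<le> v" "v \<le> z"
      have p: "a + 1 + v > 0" using a v by simp
      have der: "((\<lambda>z. (a + 1 + z) powr a * E z) has_real_derivative
         (a * (a + 1 + v) powr (a - 1) * E v + (a + 1 + v) powr a * E1 v)) (at v)"
        by (rule derivative_eq_intros dE refl | use p in \<open>simp add: algebra_simps\<close>)+
      have eq: "a * (a + 1 + v) powr (a - 1) * E v + (a + 1 + v) powr a * E1 v
         = - ((a + 1 + v) powr (a - 1) * exp (-v) * ((a + 1 + v) * (F0 v - v * F1 v) - a * F0 v))"
      proof -
        have "(a + 1 + v) powr a = (a + 1 + v) powr (a-1) * (a + 1 + v)" using p by (simp add: powr_diff)
        thus ?thesis by (simp only: E_def E1_def) (simp add: algebra_simps)
      qed
      have "(a + 1 + v) * (F0 v - v * F1 v) - a * F0 v \<ge> 0"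
      proof -
        have 1: "v * ((v + a) * F1 v) \<le> v * F0 v" using ge0[OF v(1)] v by (intro mult_left_mono)
        have 2: "v * F1 v \<le> (v + a) * F1 v" using a F1p[of v] by (intro mult_right_mono) auto
        hence "0 \<le> F0 v - v * F1 v" using ge0[OF v(1)] by simp
        thus ?thesis using 1 by (simp add: algebra_simps)
      qed
      hence "0 \<le> (a + 1 + v) powr (a - 1) * exp (-v) * ((a + 1 + v) * (F0 v - v * F1 v) - a * F0 v)"
        by (intro mult_nonneg_nonneg) auto
      with der show "\<exists>y. ((\<lambda>z. (a + 1 + z) powr a * E z) has_real_derivative y) (at v) \<and> y \<le> 0"
        unfolding eq by (intro exI conjI) auto
    qed (use z in auto)
    moreover have "(1 + z) powr a * E z \<le> (a + 1 + z) powr a * E z"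
      using a z Epos[of z] by (intro mult_right_mono powr_mono2) auto
    ultimately have "(1 + z) powr a * E z \<le> K" by (simp add: K_def)
    thus ?thesis using z by (simp add: powr_minus field_simps)
  qed
  have bE1: "\<bar>E1 z\<bar> \<le> 2 * (2 * a + 1) * E z / (1 + z)" if z: "z \<ge> 0" for z
  proof -
    have 1: "z * F1 z \<le> (z + a) * F1 z" using a F1p[of z] by (intro mult_right_mono) auto
    have "(1 + z) * (F0 z - z * F1 z) \<le> (1 + z) * ((2 * a + 1) * F1 z)"
      using le0[OF z] z by (intro mult_left_mono) (auto simp: algebra_simps)
    also have "\<dots> = (2 * a + 1) * ((1 + z) * F1 z)" by simp
    also have "\<dots> \<le> (2 * a + 1) * (2 * F0 z)" using half[OF z] a by (intro mult_left_mono) auto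
    finally have "F0 z - z * F1 z \<le> 2 * (2 * a + 1) * F0 z / (1 + z)"
      using z by (simp add: field_simps)
    hence "exp (-z) * (F0 z - z * F1 z) \<le> exp (-z) * (2 * (2 * a + 1) * F0 z / (1 + z))"
      by (intro mult_left_mono) auto
    moreover have "F0 z - z * F1 z \<ge> 0" using ge0[OF z] 1 by linarith
    ultimately show ?thesis by (simp add: E1_def E_def abs_mult mult_ac)
  qed
  have bE2: "\<bar>E2 z\<bar> \<le> 8 * (a + 2)^2 * E z / (1 + z)^2" if z: "z \<ge> 0" for z
  proof -
    define D where "D = F0 z - (z + a) * F1 z"
    have "D * (1 + z)^2 \<le> 4 * (a + 2)^2 * F0 z"
    \<comment> \<open>By the recurrence, D = z^2 F2 - (z-a-1) F1. For z \<ge> a+1 the multiplier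
      z-a-1 is non-negative, so the bound for F1 one order up leaves only (a+1)^2 F2. Below that
      threshold 1 + z \<le> a + 2, and the trivial bound D \<le> F0 suffices.\<close>
    proof (cases "z \<ge> a + 1")
      case True
      have "(z - a - 1) * ((z + a + 1) * F2 z) \<le> (z - a - 1) * F1 z"
        using ge1[OF z] True by (intro mult_left_mono) auto
      hence "D \<le> (a + 1)^2 * F2 z" using rec[of z] unfolding D_def by (simp add: algebra_simps power2_eq_square)
      hence "D * (1 + z)^2 \<le> (a + 1)^2 * F2 z * (1+z)^2" by (intro mult_right_mono) auto
      also have "\<dots> = (a + 1)^2 * (1 + z) * ((1 + z) * F2 z)" by (simp add: power2_eq_square)
      also have "\<dots> \<le> (a + 1)^2 * (1 + z) * (2 * F1 z)" using half1[OF z] z a by (intro mult_left_mono) auto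
      also have "\<dots> = 2 * (a + 1)^2 * ((1 + z) * F1 z)" by simp
      also have "\<dots> \<le> 2 * (a + 1)^2 * (2 * F0 z)" using half[OF z] z a by (intro mult_left_mono) auto
      also have "\<dots> \<le> 4 * (a + 2)^2 * F0 z" using a F0p[of z]
        by (simp add: power2_eq_square mult_mono)
      finally show ?thesis .
    next
      case False
      have "D \<le> F0 z" unfolding D_def using z a F1p[of z] by simp
      hence "D * (1 + z)^2 \<le> F0 z * (a + 2)^2" using False z F0p[of z] 
        by (intro mult_mono power_mono) auto
      also have "\<dots> \<le> 4 * (a + 2)^2 * F0 z" using F0p[of z] by simp
      finally show ?thesis .
    qed
    hence "D \<le> 4 * (a + 2)^2 * F0 z / (1 + z)^2" using z by (simp add: field_simps)
    hence "2 * exp (-z) * D \<le> 2 * exp (-z) * (4 * (a + 2)^2 * F0 z / (1 + z)^2)"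
      by (intro mult_left_mono) auto
    moreover have "D \<ge> 0" using ge0[OF z] by (simp add: D_def)
    moreover have "E2 z = 2 * exp (-z) * D" by (simp add: E2_def D_def)
    ultimately show ?thesis by (simp add: E_def abs_mult mult_ac)
  qed
  define C where "C = K * (8 * (a + 2)^2)"
  have c1: "1 \<le> 8 * (a + 2)^2" "2 * (2 * a + 1) \<le> 8 * (a + 2)^2" using a
    by (auto simp: power2_eq_square algebra_simps intro: add_increasing)
  show thesis
  proof (rule that[of C E E1 E2])
    show "C \<ge> 0" using K by (simp add: C_def)
    fix z :: real
    show "bessel_entire \<nu> z = exp z * E z" by (simp add: E_def F0_def exp_minus)
    assume z: "z \<ge> 0"
    have "E z \<le> C * (1 + z) powr -a"
    proof -
      have "K * 1 \<le> C" unfolding C_def using K c1 by (intro mult_left_mono) auto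
      thus ?thesis using bE[OF z] by (smt (verit) mult_right_mono powr_ge_zero)
    qed
    thus "\<bar>E z\<bar> \<le> C * (1 + z) powr (-(\<nu> + 1/2))" using Epos[of z] by (simp add: a_def)
    have "2 * (2 * a + 1) * E z / (1 + z) \<le> 8 * (a + 2)^2 * (K * (1 + z) powr (-a)) / (1 + z)"
      using bE[OF z] c1 z a less_imp_le[OF Epos[of z]] by (intro divide_right_mono mult_mono[OF c1(2)]) auto
    also have "\<dots> = C * (1 + z) powr (-a - 1)" using z by (simp add: C_def powr_diff)
    finally show "\<bar>E1 z\<bar> \<le> C * (1 + z) powr (-(\<nu> + 1/2) - 1)" using bE1[OF z] by (simp add: a_def)
    have "8 * (a + 2)^2 * E z / (1 + z)^2 \<le> 8 * (a + 2)^2 * (K * (1 + z) powr (-a)) / (1 + z)^2"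
      using bE[OF z] c1 z a Epos[of z] by (intro divide_right_mono mult_left_mono) auto
    also have "\<dots> = C * (1 + z) powr (-a - 2)" using z by (simp add: C_def powr_diff)
    finally show "\<bar>E2 z\<bar> \<le> C * (1 + z) powr (-(\<nu> + 1/2) - 2)" using bE2[OF z] by (simp add: a_def)
  qed (rule dE dE1)+
qed

text \<open>For e = 1 the scaled function of order \<alpha>+1 decays one power faster, and the
  factor z^e spends exactly this power. Hence H obeys bounds that do not mention e, and the rest of
  the argument no longer distinguishes the parities.\<close>

lemma bessel_symbol:
  fixes \<alpha> :: real and e :: nat
  assumes al: "\<alpha> \<ge> -1/2" and e: "e \<in> {0, 1}"
  obtains C and H H1 H2 :: "real \<Rightarrow> real" where "C \<ge> 0"
    "\<And>z. (H has_real_derivative H1 z) (at z)" "\<And>z. (H1 has_real_derivative H2 z) (at z)"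
    "\<And>z. z > 0 \<Longrightarrow> z ^ e * besselI (\<alpha> + real e) z = exp z * H z * z powr (\<alpha> + real e)"
    "\<And>z. z \<ge> 0 \<Longrightarrow> \<bar>H z\<bar> \<le> C * (1 + z) powr (-(\<alpha> + 1/2))"
    "\<And>z. z \<ge> 0 \<Longrightarrow> \<bar>H1 z\<bar> \<le> C * (1 + z) powr (-(\<alpha> + 1/2) - 1)"
    "\<And>z. z \<ge> 0 \<Longrightarrow> \<bar>H2 z\<bar> \<le> C * (1 + z) powr (-(\<alpha> + 1/2) - 2)"
proof -
  have nu: "\<alpha> + real e \<ge> -1/2" using al by simp
  obtain E E1 E2 C where C: "C \<ge> 0"
    and d: "\<And>z. (E has_real_derivative E1 z) (at z)" "\<And>z. (E1 has_real_derivative E2 z) (at z)"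
    and F: "\<And>z. bessel_entire (\<alpha> + real e) z = exp z * E z"
    and b: "\<And>z. z \<ge> 0 \<Longrightarrow> \<bar>E z\<bar> \<le> C * (1 + z) powr (-(\<alpha> + real e + 1/2))"
    "\<And>z. z \<ge> 0 \<Longrightarrow> \<bar>E1 z\<bar> \<le> C * (1 + z) powr (-(\<alpha> + real e + 1/2) - 1)"
    "\<And>z. z \<ge> 0 \<Longrightarrow> \<bar>E2 z\<bar> \<le> C * (1 + z) powr (-(\<alpha> + real e + 1/2) - 2)"
    by (rule scaled_bessel_bounds[OF nu]) (rule that)
  show thesis
  proof (cases "e = 0")
    case True
    show ?thesis
    proof (rule that[of C E E1 E2])
      fix z :: real assume "z > 0"
      thus "z ^ e * besselI (\<alpha> + real e) z = exp z * E z * z powr (\<alpha> + real e)"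
        using True besselI_eq[OF nu, of z] F[of z] by simp
    qed (rule C d b[unfolded True of_nat_0 add_0_right], assumption?)+
  next
    case False
    hence [simp]: "e = 1" using e by auto
    show ?thesis
    \<comment> \<open>The factor 3 is 2 + 1, from (z E)'' = 2 E1 + z E2.\<close>
    proof (rule that[of "3 * C" "\<lambda>z. z * E z" "\<lambda>z. E z + z * E1 z" "\<lambda>z. 2 * E1 z + z * E2 z"])
      fix z :: real
      show "((\<lambda>z. z * E z) has_real_derivative E z + z * E1 z) (at z)"
        by (rule derivative_eq_intros d refl | simp)+
      show "((\<lambda>z. E z + z * E1 z) has_real_derivative 2 * E1 z + z * E2 z) (at z)"
        by (rule derivative_eq_intros d refl | simp)+
      show "z > 0 \<Longrightarrow> z ^ e * besselI (\<alpha> + real e) z = exp z * (z * E z) * z powr (\<alpha> + real e)"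
        using besselI_eq[OF nu, of z] F by simp
      assume z: "z \<ge> 0"
      have z1: "z * (C * (1 + z) powr (p - 1)) \<le> C * (1 + z) powr p" for p
      proof -
        have "z * (C * (1 + z) powr (p - 1)) \<le> (1 + z) * (C * (1 + z) powr (p - 1))"
          using C z by (intro mult_right_mono) auto
        also have "\<dots> = C * (1 + z) powr p" using z by (simp add: powr_diff)
        finally show ?thesis .
      qed
      define p where "p = -(\<alpha> + 1/2)"
      have b0: "\<bar>E z\<bar> \<le> C * (1 + z) powr (p - 1)" and b1: "\<bar>E1 z\<bar> \<le> C * (1 + z) powr (p - 1 - 1)"
        and b2: "\<bar>E2 z\<bar> \<le> C * (1 + z) powr (p - 1 - 1 - 1)"
        using b[OF z] by (simp_all add: p_def algebra_simps)
      have m: "z * \<bar>E z\<bar> \<le> C * (1 + z) powr p" "z * \<bar>E1 z\<bar> \<le> C * (1 + z) powr (p - 1)"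
        "z * \<bar>E2 z\<bar> \<le> C * (1 + z) powr (p - 1 - 1)"
        using order_trans[OF mult_left_mono[OF b0 z] z1] order_trans[OF mult_left_mono[OF b1 z] z1]
          order_trans[OF mult_left_mono[OF b2 z] z1] by auto
      have e2: "p - 1 - 1 = p - 2" by simp
      have c0: "0 \<le> C * (1 + z) powr q" for q using C by simp
      have "\<bar>z * E z\<bar> \<le> 3 * C * (1 + z) powr p"
        using m(1) z c0[of p] by (simp add: abs_mult)
      thus "\<bar>z * E z\<bar> \<le> 3 * C * (1 + z) powr (-(\<alpha> + 1/2))" by (simp add: p_def)
      have "\<bar>E z + z * E1 z\<bar> \<le> \<bar>E z\<bar> + z * \<bar>E1 z\<bar>" using z abs_triangle_ineq[of "E z" "z * E1 z"] by (simp add: abs_mult)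
      also have "\<dots> \<le> 3 * C * (1 + z) powr (p - 1)" using b0 m(2) c0[of "p-1"] by linarith
      finally show "\<bar>E z + z * E1 z\<bar> \<le> 3 * C * (1 + z) powr (-(\<alpha> + 1/2) - 1)" by (simp add: p_def)
      have "\<bar>2 * E1 z + z * E2 z\<bar> \<le> 2 * \<bar>E1 z\<bar> + z * \<bar>E2 z\<bar>"
        using z abs_triangle_ineq[of "2 * E1 z" "z * E2 z"] by (simp add: abs_mult)
      also have "\<dots> \<le> 3 * C * (1 + z) powr (p - 2)" using b1[unfolded e2] m(3)[unfolded e2] by linarith
      finally show "\<bar>2 * E1 z + z * E2 z\<bar> \<le> 3 * C * (1 + z) powr (-(\<alpha> + 1/2) - 2)" by (simp add: p_def)
    qed (use C in auto)
  qed
qed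

section \<open>One-dimensional kernels\<close>

text \<open>The argument \<open>T\<close> stands for \<open>tanh t\<close>; see \<open>mehler_identity\<close> below.\<close>
definition mehler_exponent :: "real \<Rightarrow> real \<Rightarrow> real \<Rightarrow> real" where
  "mehler_exponent T x y = (x - y)\<^sup>2 / (4 * T) + T * (x + y)\<^sup>2 / 4"

lemma mehler_exponent_nonneg: "T > 0 \<Longrightarrow> mehler_exponent T x y \<ge> 0"
  by (simp add: mehler_exponent_def)

lemma le_one_plus_of_square_le:
  fixes u q :: real
  assumes "u\<^sup>2 \<le> q"
  shows "u \<le> 1 + q"
proof -
  have "0 \<le> (u - 1/2)\<^sup>2" by simp
  thus ?thesis using assms by (simp add: power2_eq_square algebra_simps)
qed

text \<open>The left side controls the gradient of \<open>mehler_exponent\<close>. Up to a factor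
  1/sqrt T, or sqrt T for the second term, each of its terms is the square root of one of the two
  summands of the exponent; T < 1 lets the weaker factor 1/sqrt T serve for both.\<close>

lemma mehler_gradient_bound:
  assumes T: "0 < T" "T < 1" and x: "x > 0" and y: "y > 0"
  shows "\<bar>x - y\<bar> / (2 * T) + T * (x + y) / 2 \<le> 2 * (1 + mehler_exponent T x y) / sqrt T"
proof -
  define R where "R = sqrt T"
  have R: "R > 0" "R\<^sup>2 = T" "R \<le> 1" using T by (auto simp: R_def)
  have "(\<bar>x - y\<bar> / (2 * R))\<^sup>2 \<le> mehler_exponent T x y"
    using R T by (simp add: mehler_exponent_def power_divide power_mult_distrib)
  hence 1: "\<bar>x - y\<bar> / (2 * R) \<le> 1 + mehler_exponent T x y" by (rule le_one_plus_of_square_le)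
  have "(R * (x + y) / 2)\<^sup>2 \<le> mehler_exponent T x y"
    using R T by (simp add: mehler_exponent_def power_divide power_mult_distrib)
  hence 2: "R * (x + y) / 2 \<le> 1 + mehler_exponent T x y" by (rule le_one_plus_of_square_le)
  have "\<bar>x - y\<bar> / (2 * T) = \<bar>x - y\<bar> / (2 * R) / R" using R by (simp add: power2_eq_square)
  also have "\<dots> \<le> (1 + mehler_exponent T x y) / R" using 1 R by (intro divide_right_mono) auto
  finally have A: "\<bar>x - y\<bar> / (2 * T) \<le> (1 + mehler_exponent T x y) / R" .
  have "T * (x + y) / 2 = T * (R * (x + y) / 2) / R" using R by simp
  also have "\<dots> \<le> 1 * (1 + mehler_exponent T x y) / R"
    using 2 R T x y by (intro divide_right_mono mult_mono) auto
  finally show ?thesis using A unfolding R_def[symmetric] by (simp add: add_divide_distrib)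
qed

text \<open>Controls the gradient of \<open>z = xy/s\<close> relative to \<open>1 + z\<close>.\<close>
lemma mehler_ratio_bound:
  assumes T: "0 < T" and s: "2 * T \<le> s" and x: "x > 0" and y: "y > 0"
  shows "(x + y) / (s + x * y) \<le> 2 * (1 + mehler_exponent T x y) / sqrt T"
proof -
  define q where "q = mehler_exponent T x y"
  have q: "q \<ge> 0" using T by (simp add: q_def mehler_exponent_nonneg)
  have xy: "x * y > 0" using x y by simp
  have "(x - y)\<^sup>2 \<le> 4 * T * q" using T
    by (simp add: q_def mehler_exponent_def field_simps)
  hence "(x + y)\<^sup>2 \<le> 4 * (T * q + x * y)" by (simp add: power2_eq_square algebra_simps)
  also have "\<dots> \<le> 4 * ((1 + q) * (s + x * y))"
  proof -
    have "T * q \<le> s * q" using q T s by (intro mult_right_mono) auto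
    moreover have "0 \<le> q * (x * y)" "0 \<le> s" using q xy T s by auto
    ultimately show ?thesis by (simp add: algebra_simps)
  qed
  \<comment> \<open>Since T \<le> s + xy, the factor T can be exchanged for a second copy of s + xy.
    Both sides then lie below perfect squares and roots can be taken.\<close>
  finally have "(x + y)\<^sup>2 * T \<le> 4 * ((1 + q) * (s + x * y)) * T" using T by (intro mult_right_mono) auto
  also have "\<dots> \<le> 4 * (((1 + q) * (1 + q)) * (s + x * y)) * (s + x * y)"
    using T s xy q by (intro mult_mono mult_left_mono) (auto intro: mult_right_mono)
  finally have "((x + y) * sqrt T)\<^sup>2 \<le> (2 * (1 + q) * (s + x * y))\<^sup>2" using T
    by (simp add: power2_eq_square algebra_simps)
  hence "(x + y) * sqrt T \<le> 2 * (1 + q) * (s + x * y)"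
    by (rule power2_le_imp_le) (use q T s xy in auto)
  thus ?thesis using T s xy unfolding q_def[symmetric] by (simp add: divide_simps mult_ac)
qed

text \<open>The second power is what occurs: one factor 1 + q from a prefactor and one more from a
  gradient. The constant is 4^2, from 1 + q \<le> 4 exp (q/4).\<close>

lemma square_le_exp_half: 
  fixes q :: real assumes "q \<ge> 0" shows "(1 + q)\<^sup>2 * exp (-q) \<le> 16 * exp (-q/2)"
proof -
  have "1 + q \<le> 4 * exp (q/4)" using exp_ge_add_one_self[of "q/4"] assms by linarith
  hence "(1 + q)\<^sup>2 \<le> (4 * exp (q/4))\<^sup>2" using assms by (intro power_mono) auto
  also have "\<dots> = 16 * exp (q/2)" by (simp add: power_mult_distrib exp_double[symmetric])
  finally have "(1 + q)\<^sup>2 * exp (-q) \<le> 16 * exp (q/2) * exp (-q)" by (intro mult_right_mono) auto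
  also have "\<dots> = 16 * exp (-q/2)" by (simp add: exp_add[symmetric])
  finally show ?thesis .
qed

text \<open>Formulated for a general symbol S and a general prefactor q of size M (1 + Q), because
  the heat factor and its time derivative consist of three such products: S = H with q = 1, S a
  combination of H and its derivative with q = 1, and S = H with q the time derivative of the
  exponent, where M = 4/T.\<close>

lemma mehler_product_bound:
  assumes T: "0 < T" "T < 1" and s: "2 * T \<le> s" and x: "x > 0" and y: "y > 0"
    and S: "(S has_real_derivative S') (at (x * y / s))"
    and C: "C \<ge> 0" and M: "M \<ge> 0"
    and bS: "\<bar>S (x * y / s)\<bar> \<le> C * (1 + x * y / s) powr (-a)" "\<bar>S'\<bar> \<le> C * (1 + x * y / s) powr (-a - 1)"
    and q: "(q has_derivative q') (at (x, y))"
    and bq: "\<bar>q (x, y)\<bar> \<le> M * (1 + mehler_exponent T x y)"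
      "\<And>v. \<bar>q' v\<bar> \<le> M * (1 + mehler_exponent T x y) / sqrt T * norm v"
  defines "f \<equiv> (\<lambda>p. exp (- mehler_exponent T (fst p) (snd p)) * q p * S (fst p * snd p / s))"
    and "B \<equiv> 112 * C * M * (1 + x * y / s) powr (-a) * exp (- mehler_exponent T x y / 2)"
  shows "\<bar>f (x, y)\<bar> \<le> B" "\<exists>D. (f has_derivative D) (at (x, y)) \<and> (\<forall>v. \<bar>D v\<bar> \<le> B / sqrt T * norm v)"
proof -
  define m where "m = mehler_exponent T x y"
  define z where "z = x * y / s"
  define P where "P = (1 + z) powr (-a)"
  have m: "m \<ge> 0" using T by (simp add: m_def mehler_exponent_nonneg)
  have s0: "s > 0" using T s by linarith
  have z: "z > 0" using x y s0 by (simp add: z_def)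
  have P: "P \<ge> 0" by (simp add: P_def)
  have sT: "sqrt T > 0" using T by simp
  have bS': "\<bar>S z\<bar> \<le> C * P" "\<bar>S'\<bar> \<le> C * P / (1 + z)"
    using bS z by (simp_all add: z_def[symmetric] P_def powr_diff)
  have B: "B = 7 * C * M * P * (16 * exp (-m/2))" by (simp add: B_def P_def m_def z_def)
  have ge: "7 * C * M * P * ((1 + m)\<^sup>2 * exp (-m)) \<le> B" 
    unfolding B using C M P square_le_exp_half[OF m] by (intro mult_left_mono) auto
  have "\<bar>f (x, y)\<bar> = exp (-m) * \<bar>q (x, y)\<bar> * \<bar>S z\<bar>" by (simp add: f_def abs_mult m_def z_def)
  also have "\<dots> \<le> exp (-m) * (M * (1 + m)) * (C * P)"
    using bq(1) bS'(1) M m by (intro mult_mono mult_left_mono) (auto simp: m_def)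
  also have "\<dots> = C * M * P * ((1 + m) * exp (-m))" by simp
  also have "\<dots> \<le> 7 * C * M * P * ((1 + m)\<^sup>2 * exp (-m))"
    using C M P m by (intro mult_mono mult_nonneg_nonneg) (auto simp: power2_eq_square)
  finally show "\<bar>f (x, y)\<bar> \<le> B" using ge by linarith
  define mu where "mu = (\<lambda>v::real\<times>real. (x - y) / (2 * T) * (fst v - snd v) + T * (x + y) / 2 * (fst v + snd v))"
  define zz where "zz = (\<lambda>v::real\<times>real. (fst v * y + x * snd v) / s)"
  define D where "D = (\<lambda>v. - mu v * exp (-m) * q (x, y) * S z + exp (-m) * q' v * S z + exp (-m) * q (x, y) * (S' * zz v))"
  have dm: "((\<lambda>p. mehler_exponent T (fst p) (snd p)) has_derivative mu) (at (x, y))"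
    unfolding mehler_exponent_def mu_def using T
    by (auto intro!: derivative_eq_intros simp: field_simps)
  have dz: "((\<lambda>p. fst p * snd p / s) has_derivative zz) (at (x, y))"
    unfolding zz_def using s0 by (auto intro!: derivative_eq_intros simp: field_simps)
  have dS: "((\<lambda>p. S (fst p * snd p / s)) has_derivative (\<lambda>v. S' * zz v)) (at (x, y))"
    using has_derivative_compose[OF dz, of S "\<lambda>h. S' * h"] S by (simp add: has_field_derivative_def)
  have dE: "((\<lambda>p. exp (- mehler_exponent T (fst p) (snd p))) has_derivative (\<lambda>v. - mu v * exp (-m))) (at (x, y))"
    by (auto intro!: derivative_eq_intros dm simp: m_def)
  have df: "(f has_derivative D) (at (x, y))"
  proof -
    have "(f has_derivative (\<lambda>v. exp (- mehler_exponent T (fst (x, y)) (snd (x, y))) * q (x, y) * (S' * zz v)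
       + (exp (- mehler_exponent T (fst (x, y)) (snd (x, y))) * q' v + - mu v * exp (-m) * q (x, y)) * S (fst (x, y) * snd (x, y) / s))) (at (x, y))"
      unfolding f_def by (rule has_derivative_mult[OF has_derivative_mult[OF dE q] dS])
    thus ?thesis by (rule has_derivative_eq_rhs) (auto simp: D_def m_def z_def algebra_simps)
  qed
  moreover have "\<bar>D v\<bar> \<le> B / sqrt T * norm v" for v
  proof -
    have fv: "\<bar>fst v\<bar> \<le> norm v" "\<bar>snd v\<bar> \<le> norm v"
      using norm_fst_le[of "fst v" "snd v"] norm_snd_le[of "snd v" "fst v"] by simp_all
    have "\<bar>mu v\<bar> \<le> \<bar>x - y\<bar> / (2 * T) * (2 * norm v) + T * (x + y) / 2 * (2 * norm v)"
    proof -
      have "\<bar>mu v\<bar> \<le> \<bar>(x - y) / (2 * T) * (fst v - snd v)\<bar> + \<bar>T * (x + y) / 2 * (fst v + snd v)\<bar>"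
        unfolding mu_def by (rule abs_triangle_ineq)
      also have "\<dots> = \<bar>x - y\<bar> / (2 * T) * \<bar>fst v - snd v\<bar> + T * (x + y) / 2 * \<bar>fst v + snd v\<bar>"
        using T x y by (simp add: abs_mult)
      also have "\<dots> \<le> \<bar>x - y\<bar> / (2 * T) * (2 * norm v) + T * (x + y) / 2 * (2 * norm v)"
        using fv T x y by (intro add_mono mult_left_mono) auto
      finally show ?thesis .
    qed
    also have "\<dots> = (\<bar>x - y\<bar> / (2 * T) + T * (x + y) / 2) * (2 * norm v)" by (simp add: algebra_simps)
    also have "\<dots> \<le> 2 * (1 + m) / sqrt T * (2 * norm v)"
      unfolding m_def using mehler_gradient_bound[OF T x y] by (intro mult_right_mono) auto
    also have "\<dots> = 4 * (1 + m) / sqrt T * norm v" by (simp add: field_simps)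
    finally have bmu: "\<bar>mu v\<bar> \<le> 4 * (1 + m) / sqrt T * norm v" .
    \<comment> \<open>S' decays by an extra 1/(1+z). As s (1+z) = s + xy, this turns the gradient of
      xy/s into the quotient treated by \<open>mehler_ratio_bound\<close>.\<close>
    have "\<bar>zz v\<bar> / (1 + z) \<le> (x + y) / (s + x * y) * norm v"
    proof -
      have "\<bar>fst v * y + x * snd v\<bar> \<le> (x + y) * norm v"
      proof -
        have "\<bar>fst v * y + x * snd v\<bar> \<le> \<bar>fst v\<bar> * y + x * \<bar>snd v\<bar>"
          using abs_triangle_ineq[of "fst v * y" "x * snd v"] x y by (simp add: abs_mult)
        also have "\<dots> \<le> norm v * y + x * norm v" using fv x y by (intro add_mono mult_left_mono mult_right_mono) auto
        finally show ?thesis by (simp add: algebra_simps)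
      qed
      hence "\<bar>fst v * y + x * snd v\<bar> / (s + x * y) \<le> (x + y) * norm v / (s + x * y)"
        using s0 x y by (intro divide_right_mono add_nonneg_nonneg) auto
      moreover have "\<bar>zz v\<bar> / (1 + z) = \<bar>fst v * y + x * snd v\<bar> / (s + x * y)"
        using s0 z by (simp add: zz_def z_def abs_divide divide_simps)
      ultimately show ?thesis by simp
    qed
    also have "\<dots> \<le> 2 * (1 + m) / sqrt T * norm v"
      unfolding m_def using mehler_ratio_bound[OF T(1) s x y] by (intro mult_right_mono) auto
    finally have bz: "\<bar>zz v\<bar> / (1 + z) \<le> 2 * (1 + m) / sqrt T * norm v" .
    \<comment> \<open>U is the common unit for the product rule: differentiating the exponential
      costs 4 U, the prefactor U and the symbol 2 U. Together with the 16 of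
      \<open>square_le_exp_half\<close> this gives 112 = 7 * 16.\<close>
    define U where "U = C * M * P * ((1 + m)\<^sup>2 * exp (-m)) / sqrt T * norm v"
    have "\<bar>- mu v * exp (-m) * q (x, y) * S z\<bar> = \<bar>mu v\<bar> * exp (-m) * \<bar>q (x, y)\<bar> * \<bar>S z\<bar>"
      by (simp add: abs_mult)
    also have "\<dots> \<le> (4 * (1 + m) / sqrt T * norm v) * exp (-m) * (M * (1 + m)) * (C * P)"
      using bmu bq(1) bS'(1) M m sT by (intro mult_mono) (auto simp: m_def)
    also have "\<dots> = 4 * U" by (simp add: U_def power2_eq_square)
    finally have 1: "\<bar>- mu v * exp (-m) * q (x, y) * S z\<bar> \<le> 4 * U" .
    have "\<bar>exp (-m) * q' v * S z\<bar> = exp (-m) * \<bar>q' v\<bar> * \<bar>S z\<bar>" by (simp add: abs_mult)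
    also have "\<dots> \<le> exp (-m) * (M * (1 + m) / sqrt T * norm v) * (C * P)"
      using bq(2)[of v] bS'(1) M m sT by (intro mult_mono mult_left_mono) (auto simp: m_def)
    also have "\<dots> = C * M * P * ((1 + m) * exp (-m)) / sqrt T * norm v" by simp
    also have "\<dots> \<le> U" unfolding U_def
      using C M P m sT by (intro mult_right_mono divide_right_mono mult_left_mono) (auto simp: power2_eq_square)
    finally have 2: "\<bar>exp (-m) * q' v * S z\<bar> \<le> U" .
    have "\<bar>exp (-m) * q (x, y) * (S' * zz v)\<bar> = exp (-m) * \<bar>q (x, y)\<bar> * (\<bar>S'\<bar> * \<bar>zz v\<bar>)" by (simp add: abs_mult)
    also have "\<dots> \<le> exp (-m) * (M * (1 + m)) * (C * P / (1 + z) * \<bar>zz v\<bar>)"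
      using bq(1) bS'(2) M m by (intro mult_mono mult_left_mono mult_right_mono) (auto simp: m_def)
    also have "\<dots> = exp (-m) * (M * (1 + m)) * (C * P) * (\<bar>zz v\<bar> / (1 + z))" by simp
    also have "\<dots> \<le> exp (-m) * (M * (1 + m)) * (C * P) * (2 * (1 + m) / sqrt T * norm v)"
      using bz M m C P by (intro mult_left_mono) auto
    also have "\<dots> = 2 * U" by (simp add: U_def power2_eq_square)
    finally have 3: "\<bar>exp (-m) * q (x, y) * (S' * zz v)\<bar> \<le> 2 * U" .
    have "\<bar>D v\<bar> \<le> 7 * U" unfolding D_def using 1 2 3 by linarith
    also have "\<dots> = 7 * C * M * P * ((1 + m)\<^sup>2 * exp (-m)) / sqrt T * norm v" by (simp add: U_def)
    also have "\<dots> \<le> B / sqrt T * norm v" using ge sT by (intro mult_right_mono divide_right_mono) auto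
    finally show ?thesis .
  qed
  ultimately show "\<exists>D. (f has_derivative D) (at (x, y)) \<and> (\<forall>v. \<bar>D v\<bar> \<le> B / sqrt T * norm v)" by blast
qed

section \<open>The one-dimensional heat factor and its derivatives\<close>

text \<open>One envelope for both parities and, up to powers of tanh t, for the derivatives as well.
  Half of the exponent is still present, to be spent on the volume comparison and on the Gaussian
  decay in the distance.\<close>

definition heat_majorant :: "real \<Rightarrow> real \<Rightarrow> real \<Rightarrow> real \<Rightarrow> real" where
  "heat_majorant \<alpha> t x y = sinh (2 * t) powr (-1 - \<alpha>) * (1 + x * y / sinh (2 * t)) powr (-(\<alpha> + 1/2))
     * exp (- mehler_exponent (tanh t) x y / 2)"

lemma tanh_bounds:
  fixes t :: real assumes "t > 0"
  shows "0 < tanh t" "tanh t < 1" "sinh (2 * t) > 0" "2 * tanh t \<le> sinh (2 * t)"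
    "cosh (2 * t) / sinh (2 * t) = (1 + (tanh t)\<^sup>2) / (2 * tanh t)"
    "1 / sinh (2 * t) = (1 - (tanh t)\<^sup>2) / (2 * tanh t)"
    "sinh (2 * t) = 2 * tanh t * (cosh t)\<^sup>2"
proof -
  have s: "sinh t > 0" using assms by simp
  have c: "cosh t \<ge> 1" by (rule cosh_real_ge_1)
  have cs: "(cosh t)\<^sup>2 = (sinh t)\<^sup>2 + 1" by (rule cosh_square_eq)
  show "0 < tanh t" using assms by simp
  show "tanh t < 1" by (rule tanh_real_lt_1)
  show "sinh (2 * t) > 0" using assms by simp
  show "sinh (2 * t) = 2 * tanh t * (cosh t)\<^sup>2" using c by (simp add: sinh_double tanh_def power2_eq_square)
  have "1 \<le> (cosh t)\<^sup>2" using c by (simp add: cs)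
  hence "2 * tanh t * 1 \<le> 2 * tanh t * (cosh t)\<^sup>2" using assms by (intro mult_left_mono) auto
  thus "2 * tanh t \<le> sinh (2 * t)" using \<open>sinh (2 * t) = 2 * tanh t * (cosh t)\<^sup>2\<close> by simp
  have c0: "cosh t > 0" using c by linarith
  show "cosh (2 * t) / sinh (2 * t) = (1 + (tanh t)\<^sup>2) / (2 * tanh t)"
    using s c0 by (simp add: sinh_double cosh_double tanh_def divide_simps) (simp add: power2_eq_square algebra_simps)
  have "1 - (tanh t)\<^sup>2 = 1 / (cosh t)\<^sup>2"
    using c0 by (simp add: tanh_def power_divide divide_simps) (simp add: cs)
  thus "1 / sinh (2 * t) = (1 - (tanh t)\<^sup>2) / (2 * tanh t)"
    using s c0 by (simp add: sinh_double tanh_def divide_simps) (simp add: power2_eq_square)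
qed

text \<open>Inserting coth 2t = (1+T^2)/(2T) and 1/sinh 2t = (1-T^2)/(2T) completes the squares. The
  term xy/sinh 2t is the exponential growth of the Bessel function, which is thereby absorbed into a
  negative exponent.\<close>

lemma mehler_identity:
  assumes "t > 0"
  shows "- (1/2) * (cosh (2 * t) / sinh (2 * t)) * (x\<^sup>2 + y\<^sup>2) + x * y / sinh (2 * t) = - mehler_exponent (tanh t) x y"
proof -
  have xy: "x * y / sinh (2 * t) = x * y * ((1 - (tanh t)\<^sup>2) / (2 * tanh t))"
    by (simp add: tanh_bounds(6)[OF assms, symmetric])
  show ?thesis unfolding xy tanh_bounds(5)[OF assms] mehler_exponent_def using tanh_bounds(1)[OF assms]
    by (simp add: field_simps power2_eq_square)
qed

text \<open>Here q is the time derivative of the exponent, with 1 - T^2 the derivative of tanh.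
  Ignoring signs, its terms are the summands of the exponent divided by T, and its gradient is at
  most 1/T times the quantity of \<open>mehler_gradient_bound\<close>. The 4 is the 2 from that
  bound times the 2 in |v_1 - v_2| \<le> 2 |v|.\<close>

lemma mehler_time_deriv:
  assumes T: "0 < T" "T < 1" and x: "x > 0" and y: "y > 0"
  defines "q \<equiv> (\<lambda>p::real\<times>real. (1 - T\<^sup>2) * ((fst p + snd p)\<^sup>2 / 4 - (fst p - snd p)\<^sup>2 / (4 * T\<^sup>2)))"
  shows "\<bar>q (x, y)\<bar> \<le> 4 / T * (1 + mehler_exponent T x y)"
    "\<exists>q'. (q has_derivative q') (at (x, y)) \<and>
       (\<forall>v. \<bar>q' v\<bar> \<le> 4 / T * (1 + mehler_exponent T x y) / sqrt T * norm v)"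
proof -
  define m where "m = mehler_exponent T x y"
  have m: "m \<ge> 0" using T by (simp add: m_def mehler_exponent_nonneg)
  have T2: "0 < T\<^sup>2" "T\<^sup>2 \<le> 1" using T by (auto intro: power_le_one)
  have "\<bar>q (x, y)\<bar> = (1 - T\<^sup>2) * \<bar>(x + y)\<^sup>2 / 4 - (x - y)\<^sup>2 / (4 * T\<^sup>2)\<bar>"
    using T2 by (simp add: q_def abs_mult)
  also have "\<dots> \<le> 1 * ((x + y)\<^sup>2 / 4 + (x - y)\<^sup>2 / (4 * T\<^sup>2))"
  proof (intro mult_mono)
    show "\<bar>(x + y)\<^sup>2 / 4 - (x - y)\<^sup>2 / (4 * T\<^sup>2)\<bar> \<le> (x + y)\<^sup>2 / 4 + (x - y)\<^sup>2 / (4 * T\<^sup>2)"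
      using T2 by (intro order_trans[OF abs_triangle_ineq4]) auto
  qed (use T2 in auto)
  also have "\<dots> = m / T" using T by (simp add: m_def mehler_exponent_def power2_eq_square field_simps)
  also have "\<dots> \<le> 4 * (1 + m) / T" using T m by (intro divide_right_mono) auto
  finally show "\<bar>q (x, y)\<bar> \<le> 4 / T * (1 + mehler_exponent T x y)" by (simp add: m_def)
  define q' where "q' = (\<lambda>v::real\<times>real. (1 - T\<^sup>2) * ((x + y) / 2 * (fst v + snd v) - (x - y) / (2 * T\<^sup>2) * (fst v - snd v)))"
  have "(q has_derivative q') (at (x, y))"
    unfolding q_def q'_def using T by (auto intro!: derivative_eq_intros simp: field_simps)
  moreover have "\<bar>q' v\<bar> \<le> 4 / T * (1 + m) / sqrt T * norm v" for v
  proof -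
    have fv: "\<bar>fst v\<bar> \<le> norm v" "\<bar>snd v\<bar> \<le> norm v"
      using norm_fst_le[of "fst v" "snd v"] norm_snd_le[of "snd v" "fst v"] by simp_all
    have "\<bar>q' v\<bar> = (1 - T\<^sup>2) * \<bar>(x + y) / 2 * (fst v + snd v) - (x - y) / (2 * T\<^sup>2) * (fst v - snd v)\<bar>"
      using T2 by (simp add: q'_def abs_mult)
    also have "\<dots> \<le> 1 * ((x + y) / 2 * (2 * norm v) + \<bar>x - y\<bar> / (2 * T\<^sup>2) * (2 * norm v))"
    proof (intro mult_mono)
      have "\<bar>(x + y) / 2 * (fst v + snd v) - (x - y) / (2 * T\<^sup>2) * (fst v - snd v)\<bar>
        \<le> \<bar>(x + y) / 2 * (fst v + snd v)\<bar> + \<bar>(x - y) / (2 * T\<^sup>2) * (fst v - snd v)\<bar>"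
        by (rule abs_triangle_ineq4)
      also have "\<dots> = (x + y) / 2 * \<bar>fst v + snd v\<bar> + \<bar>x - y\<bar> / (2 * T\<^sup>2) * \<bar>fst v - snd v\<bar>"
        using T2 x y by (simp add: abs_mult)
      also have "\<dots> \<le> (x + y) / 2 * (2 * norm v) + \<bar>x - y\<bar> / (2 * T\<^sup>2) * (2 * norm v)"
        using fv x y T2 by (intro add_mono mult_left_mono) auto
      finally show "\<bar>(x + y) / 2 * (fst v + snd v) - (x - y) / (2 * T\<^sup>2) * (fst v - snd v)\<bar>
        \<le> (x + y) / 2 * (2 * norm v) + \<bar>x - y\<bar> / (2 * T\<^sup>2) * (2 * norm v)" .
    qed (use T2 in auto)
    also have "\<dots> = (\<bar>x - y\<bar> / (2 * T) + T * (x + y) / 2) * (2 * norm v / T)"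
      using T by (simp add: field_simps power2_eq_square)
    also have "\<dots> \<le> 2 * (1 + m) / sqrt T * (2 * norm v / T)"
      unfolding m_def using mehler_gradient_bound[OF T x y] T by (intro mult_right_mono) auto
    also have "\<dots> = 4 / T * (1 + m) / sqrt T * norm v" by (simp add: field_simps)
    finally show ?thesis .
  qed
  ultimately show "\<exists>q'. (q has_derivative q') (at (x, y)) \<and>
       (\<forall>v. \<bar>q' v\<bar> \<le> 4 / T * (1 + mehler_exponent T x y) / sqrt T * norm v)" by (auto simp: m_def)
qed

text \<open>A predicate instead of explicit functions, so that witnesses for all coordinates, with
  their different orders and parities, can be chosen simultaneously. Carrying g' as a separate
  function allows its space gradient to be stated alongside its size.\<close>

definition heat_factor_pair ::
    "real \<Rightarrow> nat \<Rightarrow> real \<Rightarrow> (real \<Rightarrow> real \<Rightarrow> real \<Rightarrow> real) \<Rightarrow> (real \<Rightarrow> real \<Rightarrow> real \<Rightarrow> real) \<Rightarrow> bool" where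
  "heat_factor_pair \<alpha> e C g g' \<longleftrightarrow> C \<ge> 0 \<and> (\<forall>t>0. \<forall>x>0. \<forall>y>0.
    1 / (2 * sinh (2 * t)) * exp (- (1/2) * (cosh (2 * t) / sinh (2 * t)) * (x\<^sup>2 + y\<^sup>2))
      * ((x * y) ^ e * besselI (\<alpha> + real e) (x * y / sinh (2 * t)) / (x * y) powr (\<alpha> + real e)) = g t x y
    \<and> ((\<lambda>t. g t x y) has_real_derivative g' t x y) (at t)
    \<and> \<bar>g t x y\<bar> \<le> C * heat_majorant \<alpha> t x y
    \<and> \<bar>g' t x y\<bar> \<le> C * heat_majorant \<alpha> t x y / tanh t
    \<and> (\<exists>D. ((\<lambda>p. g t (fst p) (snd p)) has_derivative D) (at (x, y)) \<and>
         (\<forall>v. \<bar>D v\<bar> \<le> C * heat_majorant \<alpha> t x y / sqrt (tanh t) * norm v))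
    \<and> (\<exists>D. ((\<lambda>p. g' t (fst p) (snd p)) has_derivative D) (at (x, y)) \<and>
         (\<forall>v. \<bar>D v\<bar> \<le> C * heat_majorant \<alpha> t x y / tanh t / sqrt (tanh t) * norm v)))"

text \<open>With z = xy/s, both z and the power of s have logarithmic time derivatives proportional
  to be = 2 coth 2t. Differentiating the power and H(z) therefore yields -be times N = (1+\<alpha>)
  H + z H1, again a symbol of the order of H; the exponential contributes the remaining term f3. As
  be \<le> 2/T, both terms cost 1/T.\<close>

lemma heat_factor_pair_exists:
  fixes \<alpha> :: real and e :: nat
  assumes al: "\<alpha> \<ge> -1/2" and e: "e \<in> {0, 1}"
  shows "\<exists>C g g'. heat_factor_pair \<alpha> e C g g'"
proof -
  obtain C H H1 H2 where C: "C \<ge> 0"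
    and dH: "\<And>z. (H has_real_derivative H1 z) (at z)" and dH1: "\<And>z. (H1 has_real_derivative H2 z) (at z)"
    and HI: "\<And>z. z > 0 \<Longrightarrow> z ^ e * besselI (\<alpha> + real e) z = exp z * H z * z powr (\<alpha> + real e)"
    and b: "\<And>z. z \<ge> 0 \<Longrightarrow> \<bar>H z\<bar> \<le> C * (1 + z) powr (-(\<alpha> + 1/2))"
    "\<And>z. z \<ge> 0 \<Longrightarrow> \<bar>H1 z\<bar> \<le> C * (1 + z) powr (-(\<alpha> + 1/2) - 1)"
    "\<And>z. z \<ge> 0 \<Longrightarrow> \<bar>H2 z\<bar> \<le> C * (1 + z) powr (-(\<alpha> + 1/2) - 2)"
    by (rule bessel_symbol[OF al e]) (rule that)
  define a where "a = \<alpha> + 1/2"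
  define N where "N = (\<lambda>z. (1 + \<alpha>) * H z + z * H1 z)"
  define N1 where "N1 = (\<lambda>z. (2 + \<alpha>) * H1 z + z * H2 z)"
  have dN: "(N has_real_derivative N1 z) (at z)" for z
    unfolding N_def N1_def by (rule derivative_eq_intros dH dH1 refl | simp add: algebra_simps)+
  \<comment> \<open>The constant is set by N1: the coefficient 2 + \<alpha> of H1 plus 1 for z
    H2.\<close>
  define K where "K = (3 + \<alpha>) * C"
  have K: "K \<ge> 0" using al C by (simp add: K_def)
  have zp: "z * (C * (1 + z) powr (p - 1)) \<le> C * (1 + z) powr p" if "z \<ge> 0" for z p
  proof -
    have "z * (C * (1 + z) powr (p - 1)) \<le> (1 + z) * (C * (1 + z) powr (p - 1))"
      using C that by (intro mult_right_mono) auto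
    also have "\<dots> = C * (1 + z) powr p" using that by (simp add: powr_diff)
    finally show ?thesis .
  qed
  have bN: "\<bar>N z\<bar> \<le> K * (1 + z) powr (-a)" if z: "z \<ge> 0" for z
  proof -
    have "\<bar>N z\<bar> \<le> (1 + \<alpha>) * \<bar>H z\<bar> + z * \<bar>H1 z\<bar>"
      unfolding N_def using z al abs_triangle_ineq[of "(1 + \<alpha>) * H z" "z * H1 z"] by (simp add: abs_mult)
    also have "\<dots> \<le> (1 + \<alpha>) * (C * (1 + z) powr (-a)) + z * (C * (1 + z) powr (-a - 1))"
      using b[OF z] z al by (intro add_mono mult_left_mono) (auto simp: a_def)
    also have "\<dots> \<le> (1 + \<alpha>) * (C * (1 + z) powr (-a)) + 2 * (C * (1 + z) powr (-a))"
      using zp[OF z, of "-a"] mult_nonneg_nonneg[OF C powr_ge_zero, of "1 + z" "-a"] by linarith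
    finally show ?thesis by (simp add: K_def algebra_simps)
  qed
  have bN1: "\<bar>N1 z\<bar> \<le> K * (1 + z) powr (-a - 1)" if z: "z \<ge> 0" for z
  proof -
    have "\<bar>N1 z\<bar> \<le> (2 + \<alpha>) * \<bar>H1 z\<bar> + z * \<bar>H2 z\<bar>"
      unfolding N1_def using z al abs_triangle_ineq[of "(2 + \<alpha>) * H1 z" "z * H2 z"] by (simp add: abs_mult)
    also have "\<dots> \<le> (2 + \<alpha>) * (C * (1 + z) powr (-a - 1)) + z * (C * (1 + z) powr (-a - 1 - 1))"
      using b[OF z] z al by (intro add_mono mult_left_mono) (auto simp: a_def)
    also have "\<dots> \<le> (2 + \<alpha>) * (C * (1 + z) powr (-a - 1)) + C * (1 + z) powr (-a - 1)"
      using zp[OF z, of "-a - 1"] by simp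
    finally show ?thesis by (simp add: K_def algebra_simps)
  qed
  define A where "A = (\<lambda>t. 1/2 * sinh (2 * t) powr (-1 - \<alpha>))"
  define q where "q = (\<lambda>T (p::real\<times>real). (1 - T\<^sup>2) * ((fst p + snd p)\<^sup>2 / 4 - (fst p - snd p)\<^sup>2 / (4 * T\<^sup>2)))"
  define f1 where "f1 = (\<lambda>t p. exp (- mehler_exponent (tanh t) (fst p) (snd p)) * 1 * H (fst p * snd p / sinh (2 * t)))"
  define f2 where "f2 = (\<lambda>t p. exp (- mehler_exponent (tanh t) (fst p) (snd p)) * 1 * N (fst p * snd p / sinh (2 * t)))"
  define f3 where "f3 = (\<lambda>t p. exp (- mehler_exponent (tanh t) (fst p) (snd p)) * q (tanh t) p * H (fst p * snd p / sinh (2 * t)))"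
  define be where "be = (\<lambda>t::real. 2 * (cosh (2 * t) / sinh (2 * t)))"
  define g where "g = (\<lambda>t x y. A t * f1 t (x, y))"
  define g' where "g' = (\<lambda>t x y. - A t * be t * f2 t (x, y) - A t * f3 t (x, y))"
  \<comment> \<open>112 is halved because A carries the 1/2 of 1/(2 sinh 2t), which
    \<open>heat_majorant\<close> omits. The summands pay for f1, for be \<le> 2/T in front of f2,
    and for the 4/T of f3.\<close>
  define L where "L = 56 * (C + 2 * K + 4 * C)"
  have L: "L \<ge> 0" using C K by (simp add: L_def)
  show ?thesis unfolding heat_factor_pair_def
  proof (rule exI[of _ L], rule exI[of _ g], rule exI[of _ g'], intro conjI allI impI)
    fix t x y :: real assume t: "t > 0" and x: "x > 0" and y: "y > 0"
    note T = tanh_bounds(1-4)[OF t]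
    define T where "T = tanh t"
    define s where "s = sinh (2 * t)"
    define z where "z = x * y / s"
    have T01: "0 < T" "T < 1" and s: "s > 0" "2 * T \<le> s" using T by (auto simp: T_def s_def)
    have z: "z > 0" using x y s by (simp add: z_def)
    define R where "R = (1 + z) powr (-a) * exp (- mehler_exponent T x y / 2)"
    have R: "R \<ge> 0" by (simp add: R_def)
    have hm: "heat_majorant \<alpha> t x y = 2 * A t * R"
      by (simp add: heat_majorant_def A_def R_def z_def s_def T_def a_def)
    have A0: "A t \<ge> 0" by (simp add: A_def)
    have be: "0 \<le> be t" "be t \<le> 2 / T"
    proof -
      have e: "be t = (1 + T\<^sup>2) / T" unfolding be_def tanh_bounds(5)[OF t] T_def using t by (simp add: divide_simps)
      show "0 \<le> be t" unfolding e using T01 by simp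
      have "T\<^sup>2 \<le> 1" using T01 by (intro power_le_one) auto
      thus "be t \<le> 2 / T" unfolding e using T01 by (intro divide_right_mono) auto
    qed
    have xy: "x * y > 0" using x y by simp
    show "1 / (2 * sinh (2 * t)) * exp (- (1/2) * (cosh (2 * t) / sinh (2 * t)) * (x\<^sup>2 + y\<^sup>2))
      * ((x * y) ^ e * besselI (\<alpha> + real e) (x * y / sinh (2 * t)) / (x * y) powr (\<alpha> + real e)) = g t x y"
    proof -
      \<comment> \<open>In these variables the parity factor s^e cancels against s to the power
        \<alpha> + e, so either parity leaves s to the power -\<alpha>.\<close>
      have xyz: "x * y = z * s" using s by (simp add: z_def)
      have "(x * y) ^ e * besselI (\<alpha> + real e) z / (x * y) powr (\<alpha> + real e)
         = s ^ e * (z ^ e * besselI (\<alpha> + real e) z) / (z powr (\<alpha> + real e) * s powr (\<alpha> + real e))"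
        unfolding xyz using z s by (simp add: power_mult_distrib powr_mult)
      also have "\<dots> = s ^ e / s powr (\<alpha> + real e) * exp z * H z"
        unfolding HI[OF z] using z s by simp
      also have "s ^ e / s powr (\<alpha> + real e) = s powr (-\<alpha>)"
        using s by (simp add: powr_realpow[symmetric] powr_diff[symmetric])
      finally have I: "(x * y) ^ e * besselI (\<alpha> + real e) z / (x * y) powr (\<alpha> + real e) = s powr (-\<alpha>) * exp z * H z" .
      have E: "exp (- (1/2) * (cosh (2 * t) / sinh (2 * t)) * (x\<^sup>2 + y\<^sup>2)) * exp z = exp (- mehler_exponent T x y)"
        unfolding exp_add[symmetric] z_def s_def T_def mehler_identity[OF t] ..
      have P: "s powr (-1 - \<alpha>) = s powr (-\<alpha>) / s" using s by (simp add: powr_diff powr_minus field_simps)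
      have "1 / (2 * s) * exp (- (1/2) * (cosh (2 * t) / sinh (2 * t)) * (x\<^sup>2 + y\<^sup>2)) * (s powr (-\<alpha>) * exp z * H z)
         = 1/2 * (s powr (-\<alpha>) / s) * (exp (- (1/2) * (cosh (2 * t) / sinh (2 * t)) * (x\<^sup>2 + y\<^sup>2)) * exp z) * H z"
        by simp
      also have "\<dots> = g t x y" unfolding E P[symmetric] by (simp add: g_def A_def f1_def s_def z_def T_def)
      finally show ?thesis unfolding s_def[symmetric] z_def[symmetric] I .
    qed
    show "((\<lambda>t. g t x y) has_real_derivative g' t x y) (at t)"
    proof -
      have ds: "((\<lambda>t. sinh (2 * t)) has_real_derivative 2 * cosh (2 * t)) (at t)"
        by (rule derivative_eq_intros refl | simp)+
      have dA: "(A has_real_derivative - (1 + \<alpha>) * be t * A t) (at t)"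
      proof -
        have "(A has_real_derivative 1/2 * ((-1 - \<alpha>) * s powr (-1 - \<alpha> - 1) * (2 * cosh (2 * t)))) (at t)"
          unfolding A_def s_def by (rule derivative_eq_intros ds refl | use s in \<open>simp add: s_def\<close>)+
        moreover have "s powr (-1 - \<alpha> - 1) = s powr (-1 - \<alpha>) / s"
          using s powr_diff[of s "-1 - \<alpha>" 1] by simp
        ultimately show ?thesis by (simp only:) (simp add: A_def be_def s_def algebra_simps)
      qed
      have dm: "((\<lambda>t. mehler_exponent (tanh t) x y) has_real_derivative q T (x, y)) (at t)"
      proof -
        have "((\<lambda>u. mehler_exponent u x y) has_real_derivative (x + y)\<^sup>2 / 4 - (x - y)\<^sup>2 / (4 * T\<^sup>2)) (at T)"
          unfolding mehler_exponent_def
          by (rule derivative_eq_intros refl | use T01 in \<open>simp add: field_simps power2_eq_square\<close>)+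
        hence du: "((\<lambda>u. mehler_exponent u x y) has_real_derivative (x + y)\<^sup>2 / 4 - (x - y)\<^sup>2 / (4 * T\<^sup>2)) (at (tanh t))"
          by (simp add: T_def)
        have dt: "(tanh has_real_derivative 1 - T\<^sup>2) (at t)"
          unfolding T_def by (rule derivative_eq_intros refl | simp)+
        show ?thesis using DERIV_chain2[OF du dt] by (simp add: q_def mult.commute)
      qed
      have dz: "((\<lambda>t. x * y / sinh (2 * t)) has_real_derivative - be t * z) (at t)"
        unfolding be_def z_def s_def using s
        by (auto intro!: derivative_eq_intros simp: s_def power2_eq_square)
      have dHz: "((\<lambda>t. H (x * y / sinh (2 * t))) has_real_derivative H1 z * (- be t * z)) (at t)"
        using DERIV_chain2[OF dH dz] by (simp add: z_def s_def)
      show ?thesis unfolding g_def f1_def fst_conv snd_conv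
        by (rule derivative_eq_intros dA dm dHz refl)+
          (simp add: g'_def f2_def f3_def N_def z_def s_def T_def algebra_simps)
    qed
    have Hz: "\<bar>H (x * y / s)\<bar> \<le> C * (1 + x * y / s) powr (-a)" "\<bar>H1 (x * y / s)\<bar> \<le> C * (1 + x * y / s) powr (-a - 1)"
      "\<bar>N (x * y / s)\<bar> \<le> K * (1 + x * y / s) powr (-a)" "\<bar>N1 (x * y / s)\<bar> \<le> K * (1 + x * y / s) powr (-a - 1)"
      unfolding z_def[symmetric] using b[of z] bN[of z] bN1[of z] z by (auto simp: a_def)
    have one: "((\<lambda>p. 1) has_derivative (\<lambda>v. 0)) (at (x, y))" by (rule has_derivative_const)
    have m: "mehler_exponent T x y \<ge> 0" using T01 by (simp add: mehler_exponent_nonneg)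
    have one': "\<bar>1::real\<bar> \<le> 1 * (1 + mehler_exponent T x y)"
      "\<And>v::real\<times>real. \<bar>0::real\<bar> \<le> 1 * (1 + mehler_exponent T x y) / sqrt T * norm v" using m T01 by auto
    obtain q' where q: "(q T has_derivative q') (at (x, y))"
        "\<And>v. \<bar>q' v\<bar> \<le> 4 / T * (1 + mehler_exponent T x y) / sqrt T * norm v"
      using mehler_time_deriv(2)[OF T01 x y] unfolding q_def by blast
    have q0: "\<bar>q T (x, y)\<bar> \<le> 4 / T * (1 + mehler_exponent T x y)"
      using mehler_time_deriv(1)[OF T01 x y] unfolding q_def .
    have T4: "4 / T \<ge> 0" using T01 by simp
    have R': "(1 + x * y / sinh (2 * t)) powr (-a) * exp (- mehler_exponent (tanh t) x y / 2) = R"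
      by (simp add: R_def z_def s_def T_def)
    have cv1: "112 * C * 1 * (1 + x * y / sinh (2 * t)) powr (-a) * exp (- mehler_exponent (tanh t) x y / 2) = 112 * C * R"
      unfolding R'[symmetric] by simp
    have cv2: "112 * K * 1 * (1 + x * y / sinh (2 * t)) powr (-a) * exp (- mehler_exponent (tanh t) x y / 2) = 112 * K * R"
      unfolding R'[symmetric] by simp
    have cv3: "112 * C * (4 / tanh t) * (1 + x * y / sinh (2 * t)) powr (-a) * exp (- mehler_exponent (tanh t) x y / 2) = 112 * C * (4 / T) * R"
      unfolding R'[symmetric] T_def by simp
    have F1: "\<bar>f1 t (x, y)\<bar> \<le> 112 * C * R"
      "\<exists>D. (f1 t has_derivative D) (at (x, y)) \<and> (\<forall>v. \<bar>D v\<bar> \<le> 112 * C * R / sqrt T * norm v)"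
      using mehler_product_bound[OF T01 s(2) x y dH C zero_le_one Hz(1,2) one one']
      unfolding f1_def s_def T_def cv1 by simp_all
    have F2: "\<bar>f2 t (x, y)\<bar> \<le> 112 * K * R"
      "\<exists>D. (f2 t has_derivative D) (at (x, y)) \<and> (\<forall>v. \<bar>D v\<bar> \<le> 112 * K * R / sqrt T * norm v)"
      using mehler_product_bound[OF T01 s(2) x y dN K zero_le_one Hz(3,4) one one']
      unfolding f2_def s_def T_def cv2 by simp_all
    have F3: "\<bar>f3 t (x, y)\<bar> \<le> 112 * C * (4 / T) * R"
      "\<exists>D. (f3 t has_derivative D) (at (x, y)) \<and> (\<forall>v. \<bar>D v\<bar> \<le> 112 * C * (4 / T) * R / sqrt T * norm v)"
      using mehler_product_bound[OF T01 s(2) x y dH C T4 Hz(1,2) q(1) q0 q(2)]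
      unfolding f3_def s_def T_def cv3 by simp_all
    have LA: "A t * (112 * C * R) \<le> L * heat_majorant \<alpha> t x y"
    proof -
      have "A t * R * (112 * C) \<le> A t * R * (2 * L)" using A0 R K C by (intro mult_left_mono) (auto simp: L_def)
      thus ?thesis by (simp add: hm mult_ac)
    qed
    have LB: "A t * be t * (112 * K * R) + A t * (112 * C * (4 / T) * R) \<le> L * heat_majorant \<alpha> t x y / T"
    proof -
      have "A t * be t * (112 * K * R) = be t * (A t * (112 * K * R))" by simp
      also have "\<dots> \<le> 2 / T * (A t * (112 * K * R))" using be A0 K R by (intro mult_right_mono) auto
      finally have "A t * be t * (112 * K * R) + A t * (112 * C * (4 / T) * R)
        \<le> 2 / T * (A t * (112 * K * R)) + A t * (112 * C * (4 / T) * R)" by simp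
      also have "\<dots> = A t * R * (112 * (2 * K + 4 * C)) / T"
        using T01 by (simp add: field_simps)
      also have "\<dots> \<le> A t * R * (2 * L) / T"
        using A0 R K C T01 by (intro divide_right_mono mult_left_mono) (auto simp: L_def)
      finally show ?thesis by (simp add: hm mult_ac)
    qed
    have sT: "sqrt T > 0" using T01 by simp
    have "\<bar>g t x y\<bar> \<le> A t * (112 * C * R)"
      unfolding g_def using F1(1) A0 by (simp add: abs_mult mult_left_mono)
    thus "\<bar>g t x y\<bar> \<le> L * heat_majorant \<alpha> t x y" using LA by linarith
    have "\<bar>g' t x y\<bar> \<le> A t * be t * \<bar>f2 t (x, y)\<bar> + A t * \<bar>f3 t (x, y)\<bar>"
      unfolding g'_def using abs_triangle_ineq4[of "- A t * be t * f2 t (x, y)" "A t * f3 t (x, y)"] A0 be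
      by (simp add: abs_mult)
    also have "\<dots> \<le> A t * be t * (112 * K * R) + A t * (112 * C * (4 / T) * R)"
      using F2(1) F3(1) A0 be by (intro add_mono mult_left_mono) auto
    finally show "\<bar>g' t x y\<bar> \<le> L * heat_majorant \<alpha> t x y / tanh t" using LB by (simp add: T_def)
    obtain D1 where D1: "(f1 t has_derivative D1) (at (x, y))" "\<And>v. \<bar>D1 v\<bar> \<le> 112 * C * R / sqrt T * norm v"
      using F1(2) by blast
    obtain D2 where D2: "(f2 t has_derivative D2) (at (x, y))" "\<And>v. \<bar>D2 v\<bar> \<le> 112 * K * R / sqrt T * norm v"
      using F2(2) by blast
    obtain D3 where D3: "(f3 t has_derivative D3) (at (x, y))" "\<And>v. \<bar>D3 v\<bar> \<le> 112 * C * (4 / T) * R / sqrt T * norm v"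
      using F3(2) by blast
    show "\<exists>D. ((\<lambda>p. g t (fst p) (snd p)) has_derivative D) (at (x, y)) \<and>
         (\<forall>v. \<bar>D v\<bar> \<le> L * heat_majorant \<alpha> t x y / sqrt (tanh t) * norm v)"
    proof (intro exI[of _ "\<lambda>v. A t * D1 v"] conjI allI)
      show "((\<lambda>p. g t (fst p) (snd p)) has_derivative (\<lambda>v. A t * D1 v)) (at (x, y))"
        unfolding g_def by (simp add: D1(1) has_derivative_mult_right)
      fix v
      have "\<bar>A t * D1 v\<bar> \<le> A t * (112 * C * R / sqrt T * norm v)"
        using mult_left_mono[OF D1(2)[of v] A0] A0 by (simp add: abs_mult)
      also have "\<dots> = A t * (112 * C * R) / sqrt T * norm v" by simp
      also have "\<dots> \<le> L * heat_majorant \<alpha> t x y / sqrt T * norm v"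
        using LA sT by (intro mult_right_mono divide_right_mono) auto
      finally show "\<bar>A t * D1 v\<bar> \<le> L * heat_majorant \<alpha> t x y / sqrt (tanh t) * norm v" by (simp add: T_def)
    qed
    show "\<exists>D. ((\<lambda>p. g' t (fst p) (snd p)) has_derivative D) (at (x, y)) \<and>
         (\<forall>v. \<bar>D v\<bar> \<le> L * heat_majorant \<alpha> t x y / tanh t / sqrt (tanh t) * norm v)"
    proof (intro exI[of _ "\<lambda>v. - A t * be t * D2 v - A t * D3 v"] conjI allI)
      show "((\<lambda>p. g' t (fst p) (snd p)) has_derivative (\<lambda>v. - A t * be t * D2 v - A t * D3 v)) (at (x, y))"
        unfolding g'_def prod.collapse
        by (intro has_derivative_diff has_derivative_mult_right D2(1) D3(1))
      fix v
      have "\<bar>- A t * be t * D2 v - A t * D3 v\<bar> \<le> A t * be t * \<bar>D2 v\<bar> + A t * \<bar>D3 v\<bar>"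
        using abs_triangle_ineq4[of "- A t * be t * D2 v" "A t * D3 v"] A0 be by (simp add: abs_mult)
      also have "\<dots> \<le> A t * be t * (112 * K * R / sqrt T * norm v) + A t * (112 * C * (4 / T) * R / sqrt T * norm v)"
        using D2(2)[of v] D3(2)[of v] A0 be by (intro add_mono mult_left_mono) auto
      also have "\<dots> = (A t * be t * (112 * K * R) + A t * (112 * C * (4 / T) * R)) / sqrt T * norm v"
        by (simp add: add_divide_distrib distrib_right)
      also have "\<dots> \<le> L * heat_majorant \<alpha> t x y / T / sqrt T * norm v"
        using LB sT by (intro mult_right_mono divide_right_mono) auto
      finally show "\<bar>- A t * be t * D2 v - A t * D3 v\<bar> \<le> L * heat_majorant \<alpha> t x y / tanh t / sqrt (tanh t) * norm v"
        by (simp add: T_def)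
    qed
  qed (rule L)
qed

section \<open>From factors to the full kernel\<close>

lemma powr_exp_bounded:
  fixes p \<kappa> :: real
  assumes p: "p \<ge> 0" and k: "\<kappa> > 0"
  obtains K where "K > 0" "\<And>q. q \<ge> 0 \<Longrightarrow> (1 + q) powr p * exp (- \<kappa> * q) \<le> K"
proof (cases "p = 0")
  case True
  show ?thesis by (rule that[of 1]) (use True k in auto)
next
  case False
  hence p: "p > 0" using p by simp
  \<comment> \<open>Chosen so that 1 + q \<le> c (1 + \<kappa> q/p) \<le> c exp (\<kappa> q/p); the
    p-th power then produces exactly exp (\<kappa> q).\<close>
  define c where "c = max 1 (p / \<kappa>)"
  have c: "c \<ge> 1" "c \<ge> p / \<kappa>" by (auto simp: c_def)
  show ?thesis
  proof (rule that[of "c powr p"])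
    show "c powr p > 0" using c by simp
    fix q :: real assume q: "q \<ge> 0"
    have "1 + q \<le> c + c * (\<kappa> * q / p)"
    proof -
      have "p / \<kappa> * (\<kappa> * q / p) \<le> c * (\<kappa> * q / p)" using c q k p by (intro mult_right_mono) auto
      thus ?thesis using c p k by simp
    qed
    also have "\<dots> = c * (1 + \<kappa> * q / p)" by (simp add: algebra_simps)
    also have "\<dots> \<le> c * exp (\<kappa> * q / p)" using c exp_ge_add_one_self[of "\<kappa> * q / p"] by (intro mult_left_mono) auto
    finally have "(1 + q) powr p \<le> (c * exp (\<kappa> * q / p)) powr p" using q p by (intro powr_mono2) auto
    also have "\<dots> = c powr p * exp (\<kappa> * q)" using c p by (simp add: powr_mult exp_powr_real)
    finally have "(1 + q) powr p * exp (- \<kappa> * q) \<le> c powr p * exp (\<kappa> * q) * exp (- \<kappa> * q)"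
      by (intro mult_right_mono) auto
    also have "\<dots> = c powr p" by (simp add: exp_minus)
    finally show "(1 + q) powr p * exp (- \<kappa> * q) \<le> c powr p" .
  qed
qed

text \<open>Since sinh 2t = 2 tanh t cosh^2 t and cosh t \<ge> exp t / 2, one inequality serves both
  ends: it keeps the vanishing of tanh t at small times and the full growth exp (2t) at large
  times.\<close>

lemma sinh_double_ge:
  fixes t :: real
  assumes "t > 0"
  shows "tanh t * exp (2 * t) \<le> 2 * sinh (2 * t)"
proof -
  have "exp t / 2 \<le> cosh t" by (simp add: cosh_field_def)
  hence "(exp t / 2)\<^sup>2 \<le> (cosh t)\<^sup>2" by (intro power_mono) auto
  hence "exp (2 * t) \<le> 4 * (cosh t)\<^sup>2" by (simp add: power_divide exp_double)
  hence "tanh t * exp (2 * t) \<le> tanh t * (4 * (cosh t)\<^sup>2)" using assms by (intro mult_left_mono) auto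
  thus ?thesis unfolding tanh_bounds(7)[OF assms] by simp
qed

text \<open>After clearing denominators this is 1 + 2t \<le> exp (2t). It lets t replace tanh t in
  the time integral, at the price of a factor that exp (-t) absorbs.\<close>

lemma tanh_ge: 
  fixes t :: real assumes "t > 0" shows "t / tanh t \<le> 1 + t"
proof -
  have "1 + 2 * t \<le> exp (2 * t)" by (rule exp_ge_add_one_self)
  hence "(1 + 2 * t) * exp (-t) \<le> exp (2 * t) * exp (-t)" by (intro mult_right_mono) auto
  hence "(1 + 2 * t) * exp (-t) \<le> exp t" by (simp add: exp_add[symmetric])
  hence "t * cosh t \<le> (1 + t) * sinh t" by (simp add: cosh_field_def sinh_field_def field_simps)
  thus ?thesis using assms by (simp add: tanh_def field_simps)
qed

text \<open>This is where the ball enters: s + xy is bounded below by a multiple of exp (2t)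
  (x+r)^2, with a loss quadratic in 1 + Q. The parameters r and Q are free because they will be the
  distance in all coordinates and the sum of all exponents. The constant 144 is 36 for passing from
  x + r to T + xy, times 4 for releasing exp (2t).\<close>

lemma orthant_comparison:
  assumes t: "t > 0" and x: "x > 0" and y: "y > 0" and r: "\<bar>x - y\<bar> \<le> r"
    and Q: "mehler_exponent (tanh t) x y \<le> Q" and rQ: "r\<^sup>2 \<le> 4 * tanh t * Q"
  shows "exp (2 * t) * (x + r)\<^sup>2 \<le> 144 * (1 + Q)\<^sup>2 * (sinh (2 * t) + x * y)"
proof -
  define T where "T = tanh t"
  define s where "s = sinh (2 * t)"
  have T: "0 < T" "T < 1" "s > 0" "2 * T \<le> s" using tanh_bounds[OF t] by (auto simp: T_def s_def)
  have Q0: "Q \<ge> 0" using mehler_exponent_nonneg[OF T(1), of x y] Q by (simp add: T_def)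
  have xy: "x * y > 0" using x y by simp
  have r0: "r \<ge> 0" using r by simp
  have 1: "(x + r)\<^sup>2 \<le> 36 * (1 + Q) * (T + x * y)"
  \<comment> \<open>If r is comparable to x or larger, then (x+r)^2 is at most 9 r^2, which the
    exponent pays for. Otherwise |x-y| < x/2, so y \<ge> x/2 and xy itself has the size of
    x^2.\<close>
  proof (cases "x \<le> 2 * r")
    case True
    hence "(x + r)\<^sup>2 \<le> (3 * r)\<^sup>2" using x r0 by (intro power_mono) auto
    also have "\<dots> \<le> 36 * (Q * T)" using rQ by (simp add: T_def power_mult_distrib mult_ac)
    also have "\<dots> \<le> 36 * ((1 + Q) * (T + x * y))" using Q0 T xy by (intro mult_left_mono mult_mono) auto
    finally show ?thesis by (simp only: mult.assoc)
  next
    case False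
    hence "x / 2 \<le> y" using r by linarith
    hence "x * (x / 2) \<le> x * y" using x by (intro mult_left_mono) auto
    have "(x + r)\<^sup>2 \<le> (3/2 * x)\<^sup>2" using False r0 x by (intro power_mono) auto
    also have "\<dots> = 9/2 * (x * (x / 2))" by (simp add: power2_eq_square)
    also have "\<dots> \<le> 36 * (x * y)" using \<open>x * (x / 2) \<le> x * y\<close> xy by linarith
    also have "\<dots> \<le> 36 * ((1 + Q) * (T + x * y))"
      using mult_mono[of 1 "1 + Q" "x * y" "T + x * y"] Q0 T xy by simp
    finally show ?thesis by (simp only: mult.assoc)
  qed
  have 2: "exp (2 * t) * (T + x * y) \<le> 4 * (1 + Q) * (s + x * y)"
  proof -
    have "exp (2 * t) * T \<le> 2 * s" using sinh_double_ge[OF t] by (simp add: T_def s_def mult.commute)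
    moreover have "exp (2 * t) * (x * y) \<le> (1 + 2 * s) * (x * y)"
    proof (rule mult_right_mono)
      have "1 + 2 * s - exp (2 * t) = 1 - exp (- (2 * t))" unfolding s_def sinh_field_def by (simp add: field_simps)
      moreover have "\<dots> \<ge> 0" using t by simp
      ultimately show "exp (2 * t) \<le> 1 + 2 * s" by linarith
    qed (use xy in auto)
    moreover have "s * (x * y) \<le> 4/3 * (x * y) + 2 * Q * s"
    \<comment> \<open>For T \<le> 1/2 the identity 2T = s (1-T^2) bounds s by 4/3. For larger T the
      summand T (x+y)^2/4 of the exponent bounds xy by 2Q, so the growing factor s meets a quantity
      paid for by Q.\<close>
    proof (cases "T \<le> 1/2")
      case True
      have "T\<^sup>2 \<le> (1/2)\<^sup>2" using True T by (intro power_mono) auto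
      hence "3/4 \<le> 1 - T\<^sup>2" by (simp add: power2_eq_square)
      moreover have "1 / s = (1 - T\<^sup>2) / (2 * T)" unfolding s_def T_def by (rule tanh_bounds(6)[OF t])
      hence "2 * T = s * (1 - T\<^sup>2)" using T by (simp add: field_simps)
      ultimately have "s * (3/4) \<le> 1" using True T mult_left_mono[of "3/4" "1 - T\<^sup>2" s] by linarith
      hence "s * (x * y) \<le> 4/3 * (x * y)" using xy by (intro mult_right_mono) auto
      moreover have "0 \<le> Q * s" using Q0 T by simp
      ultimately show ?thesis by linarith
    next
      case False
      have "T * (x * y) \<le> T * ((x + y)\<^sup>2 / 4)" using T
        using zero_le_power2[of "x - y"] by (intro mult_left_mono) (simp_all add: power2_eq_square algebra_simps)
      also have "\<dots> \<le> Q" using Q T zero_le_power2[of "x - y"] unfolding mehler_exponent_def T_def[symmetric]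
        by (smt (verit) divide_nonneg_pos times_divide_eq_right)
      finally have "T * (x * y) \<le> Q" .
      moreover have "1/2 * (x * y) \<le> T * (x * y)" using False xy by (intro mult_right_mono) auto
      ultimately have "x * y \<le> 2 * Q" by linarith
      hence "s * (x * y) \<le> s * (2 * Q)" using T by (intro mult_left_mono) auto
      thus ?thesis using xy by (simp add: mult_ac)
    qed
    moreover have "0 \<le> Q * (x * y)" "0 \<le> Q * s" using Q0 xy T by auto
    ultimately have "exp (2 * t) * T + exp (2 * t) * (x * y) \<le> 4 * (s + x * y) + 4 * (Q * s) + 4 * (Q * (x * y))"
      using xy T by (simp add: algebra_simps)
    thus ?thesis by (simp add: algebra_simps)
  qed
  have "exp (2 * t) * (x + r)\<^sup>2 \<le> exp (2 * t) * (36 * (1 + Q) * (T + x * y))" using 1 by (intro mult_left_mono) auto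
  also have "\<dots> = 36 * (1 + Q) * (exp (2 * t) * (T + x * y))" by simp
  also have "\<dots> \<le> 36 * (1 + Q) * (4 * (1 + Q) * (s + x * y))" using 2 Q0 by (intro mult_left_mono) auto
  also have "\<dots> = 144 * (1 + Q)\<^sup>2 * (s + x * y)" by (simp add: power2_eq_square algebra_simps)
  finally show ?thesis by (simp add: s_def)
qed

text \<open>With a = \<alpha> + 1/2 the powers regroup into s^(-1/2) (s+xy)^(-a). The first factor
  yields T^(-1/2) exp (-t) and the second exp (-2at) with the weight (x+r)^(-2a); the decay rates
  add up to 2\<alpha> + 2, the share of this coordinate in \<open>lambda0\<close>.\<close>

lemma heat_majorant_le:
  assumes al: "\<alpha> \<ge> -1/2" and t: "t > 0" and x: "x > 0" and y: "y > 0" and r: "\<bar>x - y\<bar> \<le> r"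
    and Q: "mehler_exponent (tanh t) x y \<le> Q" and rQ: "r\<^sup>2 \<le> 4 * tanh t * Q"
  shows "heat_majorant \<alpha> t x y \<le> 2 * 144 powr (\<alpha> + 1/2) * tanh t powr (-1/2) * exp (- t * (2 * \<alpha> + 2))
    * (x + r) powr (-(2 * \<alpha> + 1)) * (1 + Q) powr (2 * \<alpha> + 1) * exp (- mehler_exponent (tanh t) x y / 2)"
proof -
  define a where "a = \<alpha> + 1/2"
  have a: "a \<ge> 0" using al by (simp add: a_def)
  define T where "T = tanh t"
  define s where "s = sinh (2 * t)"
  have T: "0 < T" "T < 1" "s > 0" "2 * T \<le> s" using tanh_bounds[OF t] by (auto simp: T_def s_def)
  have Q0: "Q \<ge> 0" using mehler_exponent_nonneg[OF T(1), of x y] Q by (simp add: T_def)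
  have xy: "x * y > 0" using x y by simp
  have xr: "x + r > 0" using x r by linarith
  have "s powr (-1 - \<alpha>) * (1 + x * y / s) powr (-a) = s powr (-1/2) * (s powr (-a) * (1 + x * y / s) powr (-a))"
    using T by (simp add: powr_add[symmetric] mult.assoc[symmetric] a_def)
  also have "s powr (-a) * (1 + x * y / s) powr (-a) = (s + x * y) powr (-a)"
  proof -
    have "s * (1 + x * y / s) = s + x * y" using T by (simp add: distrib_left)
    thus ?thesis using T xy by (simp add: powr_mult[symmetric])
  qed
  finally have e: "s powr (-1 - \<alpha>) * (1 + x * y / s) powr (-a) = s powr (-1/2) * (s + x * y) powr (-a)" .
  have "s powr (-1/2) \<le> (T * exp (2 * t) / 2) powr (-1/2)"
    using sinh_double_ge[OF t] T by (intro powr_mono2') (auto simp: T_def s_def)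
  also have "\<dots> = T powr (-1/2) * exp (-t) * 2 powr (1/2)"
    using T by (simp add: powr_mult powr_divide exp_powr_real powr_minus exp_minus field_simps)
  also have "\<dots> \<le> T powr (-1/2) * exp (-t) * 2"
    using powr_mono[of "1/2" 1 "2::real"] by (intro mult_left_mono) auto
  finally have 1: "s powr (-1/2) \<le> 2 * (T powr (-1/2) * exp (-t))" by simp
  have "(s + x * y) powr (-a) \<le> (exp (2 * t) * (x + r)\<^sup>2 / (144 * (1 + Q)\<^sup>2)) powr (-a)"
  proof (rule powr_mono2')
    show "exp (2 * t) * (x + r)\<^sup>2 / (144 * (1 + Q)\<^sup>2) \<le> s + x * y"
      using orthant_comparison[OF t x y r Q rQ] Q0 by (simp add: s_def field_simps)
  qed (use a xr Q0 in auto)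
  also have "\<dots> = 144 powr a * exp (- t * (2 * a)) * (x + r) powr (-(2 * a)) * (1 + Q) powr (2 * a)"
  proof -
    have "exp (2 * t) * (x + r)\<^sup>2 / (144 * (1 + Q)\<^sup>2) = exp (2 * t) * (x + r) powr 2 / (144 * (1 + Q) powr 2)"
      using xr Q0 by simp
    also have "\<dots> powr (-a) = exp (2 * t) powr (-a) * ((x + r) powr 2) powr (-a) / (144 powr (-a) * ((1 + Q) powr 2) powr (-a))"
      using xr Q0 by (simp add: powr_mult powr_divide del: powr_numeral)
    also have "\<dots> = 144 powr a * exp (- t * (2 * a)) * (x + r) powr (-(2 * a)) * (1 + Q) powr (2 * a)"
      using xr Q0 by (simp add: exp_powr_real powr_powr powr_minus exp_minus divide_simps mult_ac del: powr_numeral)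
    finally show ?thesis .
  qed
  finally have 2: "(s + x * y) powr (-a) \<le> 144 powr a * exp (- t * (2 * a)) * (x + r) powr (-(2 * a)) * (1 + Q) powr (2 * a)" .
  have "s powr (-1/2) * (s + x * y) powr (-a) \<le> 2 * (T powr (-1/2) * exp (-t)) *
    (144 powr a * exp (- t * (2 * a)) * (x + r) powr (-(2 * a)) * (1 + Q) powr (2 * a))"
    using 1 2 by (intro mult_mono) auto
  also have "\<dots> = 2 * 144 powr a * T powr (-1/2) * (exp (-t) * exp (- t * (2 * a))) * (x + r) powr (-(2 * a)) * (1 + Q) powr (2 * a)"
    by simp
  also have "exp (-t) * exp (- t * (2 * a)) = exp (- t * (2 * \<alpha> + 2))"
    by (simp add: exp_add[symmetric] a_def algebra_simps)
  finally have "s powr (-1 - \<alpha>) * (1 + x * y / s) powr (-a) * exp (- mehler_exponent T x y / 2)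
     \<le> 2 * 144 powr a * T powr (-1/2) * exp (- t * (2 * \<alpha> + 2)) * (x + r) powr (-(2 * a)) * (1 + Q) powr (2 * a)
       * exp (- mehler_exponent T x y / 2)" unfolding e by (intro mult_right_mono) auto
  moreover have "2 * a = 2 * \<alpha> + 1" by (simp add: a_def)
  ultimately show ?thesis unfolding heat_majorant_def s_def T_def a_def by simp
qed

lemma dist_le_mehler_sum:
  fixes x y :: "real ^ 'd"
  assumes "T > 0"
  shows "(dist x y)\<^sup>2 \<le> 4 * T * (\<Sum>i\<in>UNIV. mehler_exponent T (x $ i) (y $ i))"
proof -
  have "(dist x y)\<^sup>2 = (\<Sum>i\<in>UNIV. (x $ i - y $ i)\<^sup>2)"
    unfolding dist_norm norm_vec_def L2_set_def by (simp add: sum_nonneg)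
  also have "\<dots> \<le> (\<Sum>i\<in>UNIV. 4 * T * mehler_exponent T (x $ i) (y $ i))"
    using assms by (intro sum_mono) (simp add: mehler_exponent_def field_simps)
  finally show ?thesis by (simp add: sum_distrib_left)
qed

text \<open>Taking for Q the sum of all exponents meets both requirements of the one-dimensional
  bound in every coordinate: Q dominates each single exponent, and 4TQ dominates the squared full
  distance. The product of the factors exp (-m_i/2) returns exp (-Q/2).\<close>

lemma heat_majorant_prod_le:
  fixes \<alpha> :: "real ^ 'd"
  assumes al: "\<forall>i. \<alpha> $ i \<ge> -1/2"
  obtains K where "K > 0" "\<And>t x y. t > 0 \<Longrightarrow> x \<in> Rplus \<Longrightarrow> y \<in> Rplus \<Longrightarrow>
    (\<Prod>i\<in>UNIV. heat_majorant (\<alpha> $ i) t (x $ i) (y $ i)) \<le>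
      K * tanh t powr (- real CARD('d) / 2) * exp (- t * lambda0 \<alpha>) * exp (- (1/16) * ((dist x y)\<^sup>2 / tanh t))
       * (\<Prod>i\<in>UNIV. (x $ i + dist x y) powr (-(2 * \<alpha> $ i + 1)))"
proof -
  define P where "P = (\<Sum>i\<in>UNIV. 2 * \<alpha> $ i + 1)"
  have al': "2 * \<alpha> $ i + 1 \<ge> 0" for i using al[rule_format, of i] by linarith
  have P: "P \<ge> 0" unfolding P_def using al' by (intro sum_nonneg) auto
  obtain K0 where K0: "K0 > 0" "\<And>q. q \<ge> 0 \<Longrightarrow> (1 + q) powr P * exp (- (1/4) * q) \<le> K0"
    using powr_exp_bounded[OF P, of "1/4"] by auto
  define N where "N = (\<Prod>i\<in>UNIV. 2 * 144 powr (\<alpha> $ i + 1/2))"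
  have N: "N > 0" unfolding N_def by (intro prod_pos) auto
  show ?thesis
  proof (rule that[of "N * K0"])
    show "N * K0 > 0" using N K0 by simp
    fix t :: real and x y :: "real ^ 'd" assume t: "t > 0" and x: "x \<in> Rplus" and y: "y \<in> Rplus"
    define T where "T = tanh t"
    have T: "T > 0" using t by (simp add: T_def)
    define r where "r = dist x y"
    define m where "m = (\<lambda>i. mehler_exponent T (x $ i) (y $ i))"
    define Q where "Q = (\<Sum>i\<in>UNIV. m i)"
    have m0: "m i \<ge> 0" for i using T by (simp add: m_def mehler_exponent_nonneg)
    have mQ: "m i \<le> Q" for i unfolding Q_def using m0 by (intro member_le_sum) auto
    have Q0: "Q \<ge> 0" unfolding Q_def using m0 by (intro sum_nonneg) auto
    have rQ: "r\<^sup>2 \<le> 4 * T * Q" unfolding r_def Q_def m_def by (rule dist_le_mehler_sum[OF T])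
    have ri: "\<bar>x $ i - y $ i\<bar> \<le> r" for i
      using component_le_norm_cart[of "x - y" i] by (simp add: r_def dist_norm)
    have xi: "x $ i > 0" "y $ i > 0" for i using x y by (auto simp: Rplus_def)
    define X where "X = (\<Prod>i\<in>UNIV. (x $ i + r) powr (-(2 * \<alpha> $ i + 1)))"
    have X: "X \<ge> 0" unfolding X_def by (intro prod_nonneg) auto
    have "(\<Prod>i\<in>UNIV. heat_majorant (\<alpha> $ i) t (x $ i) (y $ i)) \<le>
       (\<Prod>i\<in>UNIV. (2 * 144 powr (\<alpha> $ i + 1/2)) * (T powr (-1/2)) * (exp (- t * (2 * \<alpha> $ i + 2)))
    * ((x $ i + r) powr (-(2 * \<alpha> $ i + 1))) * ((1 + Q) powr (2 * \<alpha> $ i + 1)) * (exp (- m i / 2)))"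
    proof (rule prod_mono, intro conjI)
      fix i
      show "0 \<le> heat_majorant (\<alpha> $ i) t (x $ i) (y $ i)" by (simp add: heat_majorant_def)
      show "heat_majorant (\<alpha> $ i) t (x $ i) (y $ i) \<le> (2 * 144 powr (\<alpha> $ i + 1/2)) * (T powr (-1/2)) * (exp (- t * (2 * \<alpha> $ i + 2)))
    * ((x $ i + r) powr (-(2 * \<alpha> $ i + 1))) * ((1 + Q) powr (2 * \<alpha> $ i + 1)) * (exp (- m i / 2))"
        using heat_majorant_le[of "\<alpha> $ i" t "x $ i" "y $ i" r Q] al t xi ri mQ[of i] rQ
        by (simp add: T_def m_def)
    qed
    also have "\<dots> = N * T powr (- real CARD('d) / 2) * exp (- t * lambda0 \<alpha>) * X * (1 + Q) powr P * exp (- Q / 2)"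
    proof -
      have 1: "(\<Prod>i\<in>(UNIV::'d set). T powr (-1/2)) = T powr (- real CARD('d) / 2)"
        using powr_sum[of T "\<lambda>i::'d. -1/2" UNIV] T by simp
      have 2: "(\<Prod>i\<in>UNIV. exp (- t * (2 * \<alpha> $ i + 2))) = exp (- t * lambda0 \<alpha>)"
      proof -
        have "(\<Sum>i\<in>UNIV. - t * (2 * \<alpha> $ i + 2)) = - t * (\<Sum>i\<in>UNIV. 2 * \<alpha> $ i + 2)"
          by (rule sum_distrib_left[symmetric])
        also have "(\<Sum>i\<in>UNIV. 2 * \<alpha> $ i + 2) = lambda0 \<alpha>"
          unfolding lambda0_def sum.distrib sum_distrib_left[symmetric] by simp
        finally show ?thesis by (simp only: exp_sum[OF finite, symmetric])
      qed
      have 3: "(\<Prod>i\<in>UNIV. (1 + Q) powr (2 * \<alpha> $ i + 1)) = (1 + Q) powr P"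
        unfolding P_def using Q0 by (subst powr_sum) auto
      have 4: "(\<Prod>i\<in>UNIV. exp (- m i / 2)) = exp (- Q / 2)"
        by (simp add: exp_sum[symmetric] Q_def sum_negf sum_divide_distrib)
      show ?thesis unfolding prod.distrib 1 2 3 4 X_def[symmetric] N_def[symmetric] by (simp add: N_def prod.distrib)
    qed
    \<comment> \<open>exp (-Q/2) is split in two. One quarter of Q absorbs (1+Q) to the power P; the
      other, as r^2 \<le> 4TQ, becomes the Gaussian with constant 1/16.\<close>
    also have "\<dots> = N * T powr (- real CARD('d) / 2) * exp (- t * lambda0 \<alpha>) * X * (((1 + Q) powr P * exp (- (1/4) * Q)) * exp (- Q / 4))"
      by (simp add: exp_add[symmetric] mult.assoc)
    also have "\<dots> \<le> N * T powr (- real CARD('d) / 2) * exp (- t * lambda0 \<alpha>) * X * (K0 * exp (- (1/16) * (r\<^sup>2 / T)))"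
    proof (intro mult_left_mono mult_mono)
      show "(1 + Q) powr P * exp (- (1/4) * Q) \<le> K0" by (rule K0(2)[OF Q0])
      show "exp (- Q / 4) \<le> exp (- (1/16) * (r\<^sup>2 / T))" using rQ T by (simp add: field_simps)
    qed (use N X K0 in auto)
    finally show "(\<Prod>i\<in>UNIV. heat_majorant (\<alpha> $ i) t (x $ i) (y $ i)) \<le>
      N * K0 * tanh t powr (- real CARD('d) / 2) * exp (- t * lambda0 \<alpha>) * exp (- (1/16) * ((dist x y)\<^sup>2 / tanh t))
       * (\<Prod>i\<in>UNIV. (x $ i + dist x y) powr (-(2 * \<alpha> $ i + 1)))"
      by (simp add: X_def r_def T_def mult_ac)
  qed
qed

text \<open>Up to the factor 2^d this is the volume of the cube of half-side r around x times the
  weight at its far corner, an explicit stand-in for the weighted measure of the ball.\<close>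

definition box_weight :: "real ^ 'd \<Rightarrow> real ^ 'd \<Rightarrow> real \<Rightarrow> real" where
  "box_weight \<alpha> x r = (\<Prod>i\<in>UNIV. r * (x $ i + r) powr (2 * \<alpha> $ i + 1))"

lemma box_weight_pos: "x \<in> Rplus \<Longrightarrow> r > 0 \<Longrightarrow> box_weight \<alpha> x r > 0"
  unfolding box_weight_def by (intro prod_pos) (simp add: Rplus_def add_pos_pos less_imp_neq[THEN not_sym])

text \<open>Each \<alpha>_i + 1 is at least 1/2. This supplies the factor exp (-t) that tames large
  times in case (a).\<close>

lemma lambda0_ge_1:
  fixes \<alpha> :: "real ^ 'd"
  assumes "\<forall>i. \<alpha> $ i \<ge> -1/2"
  shows "lambda0 \<alpha> \<ge> 1"
proof -
  have "(\<Sum>i\<in>UNIV. \<alpha> $ i) \<ge> (\<Sum>i\<in>(UNIV::'d set). -1/2)" using assms by (intro sum_mono) auto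
  hence "lambda0 \<alpha> \<ge> real CARD('d)" by (simp add: lambda0_def)
  moreover have "real CARD('d) \<ge> 1" by simp
  ultimately show ?thesis by linarith
qed

section \<open>Trading powers of 1/tanh t for powers of the distance\<close>

lemma powr_gauss_bound:
  assumes p: "p \<ge> 0"
  obtains K where "K > 0" "\<And>t r::real. t > 0 \<Longrightarrow> r > 0 \<Longrightarrow>
     tanh t powr (-p) * exp (- (1/16) * (r\<^sup>2 / tanh t)) \<le> K * r powr (-(2 * p))"
proof -
  obtain K where K: "K > 0" "\<And>q. q \<ge> 0 \<Longrightarrow> (1 + q) powr p * exp (- (1/16) * q) \<le> K"
    using powr_exp_bounded[OF p, of "1/16"] by auto
  show ?thesis
  proof (rule that[OF K(1)])
    fix t r :: real assume t: "t > 0" and r: "r > 0"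
    define T where "T = tanh t"
    have T: "T > 0" using t by (simp add: T_def)
    have "T powr (-p) = (r\<^sup>2 / T) powr p * r powr (-(2 * p))"
      using T r by (simp add: powr_divide powr_minus powr_powr powr_numeral[symmetric] divide_simps del: powr_numeral)
    also have "\<dots> \<le> (1 + r\<^sup>2 / T) powr p * r powr (-(2 * p))"
      using p T r by (intro mult_right_mono powr_mono2) auto
    finally have "T powr (-p) * exp (- (1/16) * (r\<^sup>2 / T)) \<le> (1 + r\<^sup>2 / T) powr p * r powr (-(2 * p)) * exp (- (1/16) * (r\<^sup>2 / T))"
      by (intro mult_right_mono) auto
    also have "\<dots> = ((1 + r\<^sup>2 / T) powr p * exp (- (1/16) * (r\<^sup>2 / T))) * r powr (-(2 * p))" by simp
    also have "\<dots> \<le> K * r powr (-(2 * p))" using K(2)[of "r\<^sup>2 / T"] T by (intro mult_right_mono) auto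
    finally show "tanh t powr (-p) * exp (- (1/16) * (r\<^sup>2 / tanh t)) \<le> K * r powr (-(2 * p))" by (simp add: T_def)
  qed
qed

text \<open>With u = r^2 + t one has u/T \<le> (1 + r^2/T)(1+t), so T^(-p) may be replaced by
  u^(-p): the Gaussian absorbs the power of 1 + r^2/T, and exp (-t) that of 1 + t. Then u^(-3/2) is
  kept and the rest bounded by a power of r. The exponent 3/2 exceeds 1, hence is integrable at
  infinity, and p \<ge> 3/2 still admits p = d/2 + 1 when d = 1.\<close>

lemma powr_gauss_time_bound:
  assumes p: "p \<ge> 3/2"
  obtains K where "K > 0" "\<And>t r::real. t > 0 \<Longrightarrow> r > 0 \<Longrightarrow>
     tanh t powr (-p) * exp (-t) * exp (- (1/16) * (r\<^sup>2 / tanh t)) \<le> K * (r\<^sup>2 + t) powr (-3/2) * r powr (3 - 2 * p)"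
proof -
  obtain K where K: "K > 0" "\<And>q. q \<ge> 0 \<Longrightarrow> (1 + q) powr p * exp (- (1/16) * q) \<le> K"
    using powr_exp_bounded[of p "1/16"] p by auto
  obtain L where L: "L > 0" "\<And>q. q \<ge> 0 \<Longrightarrow> (1 + q) powr p * exp (- 1 * q) \<le> L"
    using powr_exp_bounded[of p 1] p by auto
  show ?thesis
  proof (rule that[of "K * L"])
    show "K * L > 0" using K L by simp
    fix t r :: real assume t: "t > 0" and r: "r > 0"
    define T where "T = tanh t"
    have T: "T > 0" using t by (simp add: T_def)
    define u where "u = r\<^sup>2 + t"
    have u: "u > 0" "r\<^sup>2 \<le> u" using t r by (auto simp: u_def intro: add_nonneg_pos)
    have "u / T = r\<^sup>2 / T + t / T" by (simp add: u_def add_divide_distrib)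
    also have "\<dots> \<le> r\<^sup>2 / T + (1 + t)" using tanh_ge[OF t] by (simp add: T_def)
    also have "\<dots> \<le> (1 + r\<^sup>2 / T) * (1 + t)"
    proof -
      define w where "w = r\<^sup>2 / T"
      have "0 \<le> w * t" using t T by (simp add: w_def)
      thus ?thesis unfolding w_def[symmetric] by (simp add: algebra_simps)
    qed
    finally have ub: "u / T \<le> (1 + r\<^sup>2 / T) * (1 + t)" .
    have "T powr (-p) = (u / T) powr p * u powr (-p)"
      using T u by (simp add: powr_divide powr_minus inverse_eq_divide)
    also have "\<dots> \<le> ((1 + r\<^sup>2 / T) * (1 + t)) powr p * u powr (-p)"
      using p T u ub by (intro mult_right_mono powr_mono2) auto
    finally have "T powr (-p) * exp (-t) * exp (- (1/16) * (r\<^sup>2 / T))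
       \<le> ((1 + r\<^sup>2 / T) * (1 + t)) powr p * u powr (-p) * exp (-t) * exp (- (1/16) * (r\<^sup>2 / T))"
      by (intro mult_right_mono) auto
    also have "((1 + r\<^sup>2 / T) * (1 + t)) powr p = (1 + r\<^sup>2 / T) powr p * (1 + t) powr p"
      using T t by (intro powr_mult)
    also have "(1 + r\<^sup>2 / T) powr p * (1 + t) powr p * u powr (-p) * exp (-t) * exp (- (1/16) * (r\<^sup>2 / T))
      = ((1 + r\<^sup>2 / T) powr p * exp (- (1/16) * (r\<^sup>2 / T))) * ((1 + t) powr p * exp (- 1 * t)) * u powr (-p)" by simp
    also have "\<dots> \<le> K * L * u powr (-p)" 
      using K(2)[of "r\<^sup>2 / T"] L(2)[of t] T t K L by (intro mult_right_mono mult_mono) auto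
    also have "u powr (-p) = u powr (-3/2) * u powr (3/2 - p)" using u by (simp add: powr_add[symmetric])
    also have "u powr (3/2 - p) \<le> (r\<^sup>2) powr (3/2 - p)" using u r p by (intro powr_mono2') auto
    also have "(r\<^sup>2) powr (3/2 - p) = r powr (3 - 2 * p)"
    proof -
      have "(r\<^sup>2) powr (3/2 - p) = (r powr 2) powr (3/2 - p)" using r by simp
      also have "\<dots> = r powr (2 * (3/2 - p))" by (rule powr_powr)
      finally show ?thesis by (simp add: algebra_simps)
    qed
    finally show "tanh t powr (-p) * exp (-t) * exp (- (1/16) * (r\<^sup>2 / tanh t)) \<le> K * L * (r\<^sup>2 + t) powr (-3/2) * r powr (3 - 2 * p)"
      using K L by (simp add: T_def u_def mult_left_mono mult.assoc)
  qed
qed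


definition heat_product_majorant :: "real ^ 'd \<Rightarrow> real \<Rightarrow> real ^ 'd \<Rightarrow> real ^ 'd \<Rightarrow> real" where
  "heat_product_majorant \<alpha> t x y = (\<Prod>i\<in>UNIV. heat_majorant (\<alpha> $ i) t (x $ i) (y $ i))"

text \<open>The four bounds serve the kernel, its gradient, its time derivative and the gradient of
  that: they carry T^(-j) with j = 0, 1/2, 1, 3/2. The first two are maximized over t; the last two
  keep a profile in t for later integration.\<close>

lemma heat_decay:
  fixes \<alpha> :: "real ^ 'd"
  assumes al: "\<forall>i. \<alpha> $ i \<ge> -1/2"
  obtains K where "K > 0"
    "\<And>t x y. t > 0 \<Longrightarrow> x \<in> Rplus \<Longrightarrow> y \<in> Rplus \<Longrightarrow> x \<noteq> y \<Longrightarrow>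
      heat_product_majorant \<alpha> t x y \<le> K * exp (- t * lambda0 \<alpha>) / box_weight \<alpha> x (dist x y) \<and>
      heat_product_majorant \<alpha> t x y / sqrt (tanh t) \<le> K * exp (- t * lambda0 \<alpha>) / dist x y / box_weight \<alpha> x (dist x y) \<and>
      heat_product_majorant \<alpha> t x y / tanh t \<le> K * (dist x y * ((dist x y)\<^sup>2 + t) powr (-3/2)) / box_weight \<alpha> x (dist x y) \<and>
      heat_product_majorant \<alpha> t x y / tanh t / sqrt (tanh t) \<le> K * (((dist x y)\<^sup>2 + t) powr (-3/2)) / box_weight \<alpha> x (dist x y)"
proof -
  define n where "n = real CARD('d)"
  have n: "n \<ge> 1" by (simp add: n_def)
  obtain K0 where K0': "K0 > 0" "\<And>t x y. t > 0 \<Longrightarrow> x \<in> Rplus \<Longrightarrow> y \<in> Rplus \<Longrightarrow>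
      (\<Prod>i\<in>UNIV. heat_majorant (\<alpha> $ i) t (x $ i) (y $ i)) \<le>
      K0 * tanh t powr (- real CARD('d) / 2) * exp (- t * lambda0 \<alpha>) * exp (- (1/16) * ((dist x y)\<^sup>2 / tanh t))
       * (\<Prod>i\<in>UNIV. (x $ i + dist x y) powr (-(2 * \<alpha> $ i + 1)))"
    by (rule heat_majorant_prod_le[OF al]) (rule that)
  note K0 = K0'(1)
  have K0b: "heat_product_majorant \<alpha> t x y \<le>
      K0 * tanh t powr (- n / 2) * exp (- t * lambda0 \<alpha>) * exp (- (1/16) * ((dist x y)\<^sup>2 / tanh t))
       * (\<Prod>i\<in>UNIV. (x $ i + dist x y) powr (-(2 * \<alpha> $ i + 1)))"
    if "t > 0" "x \<in> Rplus" "y \<in> Rplus" for t x y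
    unfolding heat_product_majorant_def n_def using that by (intro K0'(2))
  obtain A0 where A0: "A0 > 0" "\<And>t r::real. t > 0 \<Longrightarrow> r > 0 \<Longrightarrow>
     tanh t powr (-(n/2)) * exp (- (1/16) * (r\<^sup>2 / tanh t)) \<le> A0 * r powr (-(2 * (n/2)))"
    using powr_gauss_bound[of "n/2"] n by auto
  obtain A1 where A1: "A1 > 0" "\<And>t r::real. t > 0 \<Longrightarrow> r > 0 \<Longrightarrow>
     tanh t powr (-(n/2+1/2)) * exp (- (1/16) * (r\<^sup>2 / tanh t)) \<le> A1 * r powr (-(2 * (n/2+1/2)))"
    using powr_gauss_bound[of "n/2+1/2"] n by auto
  obtain A2 where A2: "A2 > 0" "\<And>t r::real. t > 0 \<Longrightarrow> r > 0 \<Longrightarrow>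
     tanh t powr (-(n/2+1)) * exp (-t) * exp (- (1/16) * (r\<^sup>2 / tanh t)) \<le> A2 * (r\<^sup>2 + t) powr (-3/2) * r powr (3 - 2 * (n/2+1))"
    using powr_gauss_time_bound[of "n/2+1"] n by auto
  obtain A3 where A3: "A3 > 0" "\<And>t r::real. t > 0 \<Longrightarrow> r > 0 \<Longrightarrow>
     tanh t powr (-(n/2+3/2)) * exp (-t) * exp (- (1/16) * (r\<^sup>2 / tanh t)) \<le> A3 * (r\<^sup>2 + t) powr (-3/2) * r powr (3 - 2 * (n/2+3/2))"
    using powr_gauss_time_bound[of "n/2+3/2"] n by auto
  define K where "K = K0 * (A0 + A1 + A2 + A3)"
  show ?thesis
  proof (rule that[of K])
    show "K > 0" unfolding K_def using K0 A0(1) A1(1) A2(1) A3(1) by simp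
    have KA: "K0 * A0 \<le> K" "K0 * A1 \<le> K" "K0 * A2 \<le> K" "K0 * A3 \<le> K"
      unfolding K_def using K0 A0(1) A1(1) A2(1) A3(1) by (auto intro!: mult_left_mono)
    fix t :: real and x y :: "real ^ 'd" assume t: "t > 0" and x: "x \<in> Rplus" and y: "y \<in> Rplus" and xy: "x \<noteq> y"
    define T where "T = tanh t"
    define r where "r = dist x y"
    define W where "W = box_weight \<alpha> x r"
    define E where "E = exp (- t * lambda0 \<alpha>)"
    define U where "U = exp (- (1/16) * (r\<^sup>2 / T))"
    have T: "T > 0" using t by (simp add: T_def)
    have r: "r > 0" using xy by (simp add: r_def)
    have W: "W > 0" unfolding W_def by (rule box_weight_pos[OF x r])
    \<comment> \<open>\<open>box_weight\<close> contains r^d besides the weights; this r^d cancels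
      the r^(-d) that the factor T^(-d/2) leaves behind.\<close>
    have X: "(\<Prod>i\<in>UNIV. (x $ i + r) powr (-(2 * \<alpha> $ i + 1))) = r powr n / W"
    proof -
      have "(\<Prod>i\<in>UNIV. (x $ i + r) powr (-(2 * \<alpha> $ i + 1))) = inverse (\<Prod>i\<in>UNIV. (x $ i + r) powr (2 * \<alpha> $ i + 1))"
        unfolding prod_inversef[symmetric] by (simp only: powr_minus o_def)
      moreover have "W = r powr n * (\<Prod>i\<in>UNIV. (x $ i + r) powr (2 * \<alpha> $ i + 1))"
        unfolding W_def box_weight_def prod.distrib using r by (simp add: powr_realpow n_def)
      ultimately show ?thesis using W r by (simp add: field_simps)
    qed
    have E1: "E \<le> exp (-t)" using lambda0_ge_1[OF al] t by (simp add: E_def)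
    have P: "heat_product_majorant \<alpha> t x y * T powr (-j) \<le> K0 * (T powr (-(n/2 + j)) * U) * E * r powr n / W" for j
    proof -
      have "heat_product_majorant \<alpha> t x y * T powr (-j) \<le> (K0 * T powr (- n / 2) * E * U * (r powr n / W)) * T powr (-j)"
        using K0b[OF t x y] X by (intro mult_right_mono) (auto simp: r_def[symmetric] T_def[symmetric] E_def U_def)
      also have "\<dots> = K0 * ((T powr (- n / 2) * T powr (-j)) * U) * E * r powr n / W" by simp
      also have "T powr (- n / 2) * T powr (-j) = T powr (-(n/2 + j))" by (simp add: powr_add[symmetric])
      finally show ?thesis .
    qed
    have step: "K0 * B * F * r powr n / W \<le> K * (F * r powr (q + n)) / W"
      if "B \<le> A * r powr q" "K0 * A \<le> K" "F \<ge> 0" for A B F q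
    proof -
      have "K0 * B * F * r powr n / W \<le> K0 * (A * r powr q) * F * r powr n / W"
        using that K0 W by (intro divide_right_mono mult_right_mono mult_left_mono) auto
      also have "\<dots> = (K0 * A) * (F * r powr (q + n)) / W" by (simp add: powr_add)
      also have "\<dots> \<le> K * (F * r powr (q + n)) / W" using that W by (intro divide_right_mono mult_right_mono) auto
      finally show ?thesis .
    qed
    have E0: "E \<ge> 0" by (simp add: E_def)
    have b0: "heat_product_majorant \<alpha> t x y \<le> K * E / W"
    proof -
      have s0: "T powr (-(n/2)) * U \<le> A0 * r powr (-(2 * (n/2)))" using A0(2)[OF t r] by (simp only: T_def U_def)
      show ?thesis using order_trans[OF P[of 0, unfolded add_0_right] step[OF s0 KA(1) E0]] T r by simp
    qed
    have b1: "heat_product_majorant \<alpha> t x y / sqrt T \<le> K * E / r / W"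
    proof -
      have "heat_product_majorant \<alpha> t x y * T powr (-(1/2)) \<le> K * (E * r powr (-(2 * (n/2+1/2)) + n)) / W"
      proof -
        have s1: "T powr (-(n/2+1/2)) * U \<le> A1 * r powr (-(2 * (n/2+1/2)))" using A1(2)[OF t r] by (simp only: T_def U_def)
        show ?thesis by (rule order_trans[OF P[of "1/2"] step[OF s1 KA(2) E0]])
      qed
      moreover have "T powr (-(1/2)) = 1 / sqrt T" using T by (simp add: powr_minus powr_half_sqrt inverse_eq_divide)
      moreover have "r powr (-(2 * (n/2+1/2)) + n) = 1 / r" using r by (simp add: powr_minus inverse_eq_divide)
      ultimately show ?thesis by simp
    qed
    define v where "v = (r\<^sup>2 + t) powr (-3/2)"
    have time: "heat_product_majorant \<alpha> t x y * T powr (-j) \<le> K * (v * r powr (3 - 2 * (n/2+j) + n)) / W"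
      if A: "T powr (-(n/2+j)) * exp (-t) * U \<le> A * v * r powr (3 - 2 * (n/2+j))" "K0 * A \<le> K" "A > 0" for j A
    proof -
      have "heat_product_majorant \<alpha> t x y * T powr (-j) \<le> K0 * (T powr (-(n/2 + j)) * U) * exp (-t) * r powr n / W"
        by (rule order_trans[OF P]) (use E1 K0 W in \<open>auto simp: U_def intro!: divide_right_mono mult_right_mono mult_left_mono\<close>)
      also have "\<dots> = K0 * (T powr (-(n/2+j)) * exp (-t) * U) * 1 * r powr n / W" by simp
      also have "\<dots> \<le> K0 * (A * v * r powr (3 - 2 * (n/2+j))) * 1 * r powr n / W"
        using A K0 W by (intro divide_right_mono mult_right_mono mult_left_mono) auto
      also have "\<dots> = (K0 * A) * (v * r powr (3 - 2 * (n/2+j) + n)) / W" unfolding powr_add[of r "3 - 2 * (n/2+j)" n] by simp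
      also have "\<dots> \<le> K * (v * r powr (3 - 2 * (n/2+j) + n)) / W"
        using A W by (intro divide_right_mono mult_right_mono) (auto simp: v_def)
      finally show ?thesis .
    qed
    have b2: "heat_product_majorant \<alpha> t x y / T \<le> K * (r * v) / W"
    proof -
      have "heat_product_majorant \<alpha> t x y * T powr (-1) \<le> K * (v * r powr (3 - 2 * (n/2+1) + n)) / W"
        by (rule time[OF _ KA(3) A2(1)]) (use A2(2)[OF t r] in \<open>simp add: T_def U_def v_def\<close>)
      moreover have "r powr (3 - 2 * (n/2+1) + n) = r" using r by simp
      moreover have "T powr (-1) = 1 / T" using T by (simp add: powr_minus inverse_eq_divide)
      ultimately show ?thesis by (simp add: mult.commute)
    qed
    have b3: "heat_product_majorant \<alpha> t x y / T / sqrt T \<le> K * v / W"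
    proof -
      have "heat_product_majorant \<alpha> t x y * T powr (-(3/2)) \<le> K * (v * r powr (3 - 2 * (n/2+3/2) + n)) / W"
        by (rule time[OF _ KA(4) A3(1)]) (use A3(2)[OF t r] in \<open>simp add: T_def U_def v_def\<close>)
      moreover have "r powr (3 - 2 * (n/2+3/2) + n) = 1" using r by simp
      moreover have "T powr (-(3/2)) = 1 / T / sqrt T"
      proof -
        have "T powr (-(3/2)) = T powr (-1) * T powr (-(1/2))"
          using powr_add[of T "-1" "-(1/2)"] by simp
        also have "\<dots> = 1 / T / sqrt T" using T by (simp add: powr_minus powr_half_sqrt inverse_eq_divide)
        finally show ?thesis .
      qed
      ultimately show ?thesis by simp
    qed
    show "heat_product_majorant \<alpha> t x y \<le> K * exp (- t * lambda0 \<alpha>) / box_weight \<alpha> x (dist x y) \<and>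
      heat_product_majorant \<alpha> t x y / sqrt (tanh t) \<le> K * exp (- t * lambda0 \<alpha>) / dist x y / box_weight \<alpha> x (dist x y) \<and>
      heat_product_majorant \<alpha> t x y / tanh t \<le> K * (dist x y * ((dist x y)\<^sup>2 + t) powr (-3/2)) / box_weight \<alpha> x (dist x y) \<and>
      heat_product_majorant \<alpha> t x y / tanh t / sqrt (tanh t) \<le> K * (((dist x y)\<^sup>2 + t) powr (-3/2)) / box_weight \<alpha> x (dist x y)"
      using b0 b1 b2 b3 by (simp add: E_def T_def r_def W_def v_def)
  qed
qed

section \<open>Weighted measure of balls\<close>

lemma open_Rplus: "open (Rplus :: (real ^ 'd) set)"
proof -
  have "Rplus = (\<Inter>i\<in>UNIV. {x :: real ^ 'd. 0 < x $ i})" by (auto simp: Rplus_def)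
  moreover have "open (\<Inter>i\<in>UNIV. {x :: real ^ 'd. 0 < x $ i})"
    by (intro open_INT ballI open_Collect_less continuous_intros) auto
  ultimately show ?thesis by metis
qed

text \<open>Within the orthant the coordinates of points of the ball lie between 0 and x_i + r, and
  the exponents 2\<alpha>_i + 1 are non-negative, so the weight is at most its value at the far
  corner of the enclosing cube. The upper bound converts 1/\<open>box_weight\<close> into the
  claimed right-hand side. Positivity makes dividing by this measure meaningful, since division by 0
  yields 0.\<close>

lemma ballplus_measure_bounds:
  fixes \<alpha> x :: "real ^ 'd"
  assumes al: "\<forall>i. \<alpha> $ i \<ge> -1/2" and x: "x \<in> Rplus" and r: "r > 0"
  shows "measure (w_alpha \<alpha>) (ballplus x r) \<le> 2 ^ CARD('d) * box_weight \<alpha> x r"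
    "measure (w_alpha \<alpha>) (ballplus x r) > 0"
proof -
  define B where "B = ballplus x r"
  define w where "w = (\<lambda>x::real^'d. ennreal (\<Prod>j\<in>UNIV. \<bar>x $ j\<bar> powr (2 * \<alpha> $ j + 1)))"
  have B_eq: "B = Rplus \<inter> ball x r" by (auto simp: B_def ballplus_def dist_commute)
  have oB: "open B" unfolding B_eq by (intro open_Int open_Rplus open_ball)
  have xB: "x \<in> B" using x r by (simp add: B_eq)
  have mB: "B \<in> sets lborel" using oB by simp
  have mw: "w \<in> borel_measurable lborel" unfolding w_def by measurable
  have em: "emeasure (w_alpha \<alpha>) B = (\<integral>\<^sup>+y. w y * indicator B y \<partial>lborel)"
    unfolding w_alpha_def w_def[symmetric] by (rule emeasure_density[OF mw mB])
  define X where "X = (\<Prod>i\<in>UNIV. (x $ i + r) powr (2 * \<alpha> $ i + 1))"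
  have X: "X \<ge> 0" unfolding X_def by (intro prod_nonneg) auto
  define bx where "bx = cbox (\<chi> i. x $ i - r) (\<chi> i. x $ i + r)"
  have Bsub: "B \<subseteq> bx"
  proof
    fix y assume "y \<in> B"
    hence "dist x y < r" by (simp add: B_eq)
    hence "\<bar>x $ i - y $ i\<bar> \<le> r" for i
      using component_le_norm_cart[of "x - y" i] by (simp add: dist_norm)
    hence "x $ i - r \<le> y $ i \<and> y $ i \<le> x $ i + r" for i by (smt (verit, best))
    thus "y \<in> bx" by (simp add: bx_def mem_box_cart)
  qed
  have wle: "w y * indicator B y \<le> ennreal X * indicator bx y" for y
  proof (cases "y \<in> B")
    case True
    have "(\<Prod>j\<in>UNIV. \<bar>y $ j\<bar> powr (2 * \<alpha> $ j + 1)) \<le> X" unfolding X_def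
    proof (intro prod_mono conjI powr_mono2)
      fix i
      show "0 \<le> 2 * \<alpha> $ i + 1" using al[rule_format, of i] by linarith
      have "y $ i > 0" using True by (simp add: B_eq Rplus_def)
      thus "\<bar>y $ i\<bar> \<le> x $ i + r" using True Bsub by (auto simp: bx_def mem_box_cart)
    qed auto
    thus ?thesis using True Bsub by (auto simp: w_def ennreal_leI)
  qed auto
  have "emeasure (w_alpha \<alpha>) B \<le> (\<integral>\<^sup>+y. ennreal X * indicator bx y \<partial>lborel)"
    unfolding em by (intro nn_integral_mono wle)
  also have "\<dots> = ennreal X * emeasure lborel bx" by (simp add: nn_integral_cmult_indicator bx_def)
  also have "emeasure lborel bx = ennreal (measure lborel bx)"
    by (rule emeasure_eq_ennreal_measure) (simp add: bx_def emeasure_lborel_cbox_eq)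
  also have "measure lborel bx = (2 * r) ^ CARD('d)"
  proof -
    have "bx \<noteq> {}" using Bsub xB by auto
    thus ?thesis unfolding bx_def using content_cbox_cart[of "\<chi> i. x $ i - r" "\<chi> i. x $ i + r"] by simp
  qed
  also have "ennreal X * ennreal ((2 * r) ^ CARD('d)) = ennreal (2 ^ CARD('d) * box_weight \<alpha> x r)"
    using X r by (simp add: ennreal_mult[symmetric] box_weight_def prod.distrib X_def power_mult_distrib mult_ac)
  finally have le: "emeasure (w_alpha \<alpha>) B \<le> ennreal (2 ^ CARD('d) * box_weight \<alpha> x r)" .
  have bw: "box_weight \<alpha> x r \<ge> 0" unfolding box_weight_def using r by (intro prod_nonneg) auto
  show "measure (w_alpha \<alpha>) (ballplus x r) \<le> 2 ^ CARD('d) * box_weight \<alpha> x r"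
    unfolding measure_def B_def[symmetric] using le bw by (simp add: enn2real_leI)
  have "emeasure (w_alpha \<alpha>) B \<noteq> 0"
  proof
    assume "emeasure (w_alpha \<alpha>) B = 0"
    hence "AE y in lborel. w y * indicator B y = 0"
      unfolding em by (subst (asm) nn_integral_0_iff_AE) (use mw mB in auto)
    moreover have "w y * indicator B y \<noteq> 0" if "y \<in> B" for y
    proof -
      have "(\<Prod>j\<in>UNIV. \<bar>y $ j\<bar> powr (2 * \<alpha> $ j + 1)) > 0"
        using that by (intro prod_pos) (auto simp: B_eq Rplus_def less_imp_neq[THEN not_sym])
      hence "w y > 0" unfolding w_def by (rule ennreal_less_zero_iff[THEN iffD2])
      thus ?thesis using that by simp
    qed
    ultimately have "AE y in lborel. y \<notin> B" by (auto elim!: eventually_mono)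
    hence "emeasure lborel B = 0" using mB by (subst (asm) AE_iff_measurable[of B]) auto
    hence "negligible B" using mB by (simp add: negligible_iff_null_sets null_sets_def)
    thus False using oB xB open_not_negligible by auto
  qed
  moreover have "emeasure (w_alpha \<alpha>) B < \<infinity>" using le by (rule le_less_trans) simp
  ultimately show "measure (w_alpha \<alpha>) (ballplus x r) > 0"
    unfolding measure_def B_def[symmetric] by (simp add: enn2real_positive_iff zero_less_iff_neq_zero less_top)
qed

section \<open>Differentiation under the integral sign\<close>

text \<open>Dominated convergence for the remainder quotients. The mean value inequality on the
  convex ball bounds increments of f by g, and the linear part is bounded by g as well, so 2g
  dominates. Measurability of the derivative in t is derived, not assumed: in each direction it is a
  limit of difference quotients.\<close>

lemma has_derivative_integral:
  fixes f :: "'t \<Rightarrow> 'a::{real_normed_vector, perfect_space} \<Rightarrow> 'b::{banach, second_countable_topology}"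
  assumes U: "e > 0"
    and int: "\<And>p. p \<in> ball p0 e \<Longrightarrow> integrable M (\<lambda>t. f t p)"
    and der: "\<And>t p. t \<in> space M \<Longrightarrow> p \<in> ball p0 e \<Longrightarrow> (f t has_derivative f' t p) (at p)"
    and bd: "\<And>t p v. t \<in> space M \<Longrightarrow> p \<in> ball p0 e \<Longrightarrow> norm (f' t p v) \<le> g t * norm v"
    and g: "integrable M g"
  shows "((\<lambda>p. \<integral>t. f t p \<partial>M) has_derivative (\<lambda>v. \<integral>t. f' t p0 v \<partial>M)) (at p0)"
    and "\<And>v. integrable M (\<lambda>t. f' t p0 v)"
proof -
  have p0: "p0 \<in> ball p0 e" using U by simp
  have lin: "bounded_linear (f' t p0)" if "t \<in> space M" for t
    using der[OF that p0] by (rule has_derivative_bounded_linear)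
  have lip: "norm (f t p - f t p0) \<le> g t * norm (p - p0)" if "t \<in> space M" "p \<in> ball p0 e" for t p
  proof (rule differentiable_bound[where S = "ball p0 e" and f' = "f' t"])
    show "\<And>q. q \<in> ball p0 e \<Longrightarrow> (f t has_derivative f' t q) (at q within ball p0 e)"
      using der[OF that(1)] by (blast intro: has_derivative_at_withinI)
    show "onorm (f' t q) \<le> g t" if "q \<in> ball p0 e" for q
      using bd[OF \<open>t \<in> space M\<close> that] by (intro onorm_le) (simp add: mult.commute)
  qed (use that p0 in auto)
  have meas: "(\<lambda>t. f' t p0 v) \<in> borel_measurable M" for v
  proof (cases "v = 0")
    case True
    have "f' t p0 v = 0" if "t \<in> space M" for t using lin[OF that] True by (simp add: linear_simps)
    thus ?thesis by (simp cong: measurable_cong)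
  next
    case False
    \<comment> \<open>Step lengths tending to 0 that keep all increments in direction v at norm at
      most e/2, hence inside the ball where f is integrable.\<close>
    define c where "c = (\<lambda>n. e / 2 / norm v * inverse (real (Suc n)))"
    have c0: "c n > 0" for n using False U by (simp add: c_def)
    have c: "c \<longlonglongrightarrow> 0" unfolding c_def
      by (rule tendsto_mult_right_zero[OF LIMSEQ_inverse_real_of_nat])
    define h where "h = (\<lambda>n. c n *\<^sub>R v)"
    have h0: "h \<longlonglongrightarrow> 0" unfolding h_def using tendsto_scaleR[OF c tendsto_const[of v]] by simp
    have h1: "h n \<noteq> 0" for n unfolding h_def using c0[of n] False by simp
    have hn: "norm (h n) < e" for n
    proof -
      have "norm (h n) = e / 2 / real (Suc n)"
        using c0[of n] False U by (simp add: h_def c_def inverse_eq_divide)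
      also have "\<dots> \<le> e / 2" using U by (simp add: field_simps)
      finally show ?thesis using U by linarith
    qed
    show ?thesis
    proof (rule borel_measurable_LIMSEQ_metric)
      fix n
      have "p0 + h n \<in> ball p0 e" using hn by (simp add: dist_norm)
      thus "(\<lambda>t. (f t (p0 + h n) - f t p0) /\<^sub>R c n) \<in> borel_measurable M"
        using int[of "p0 + h n"] int[OF p0] by (auto dest!: borel_measurable_integrable)
    next
      fix t assume t: "t \<in> space M"
      have "(\<lambda>h. norm (f t (p0 + h) - f t p0 - f' t p0 h) / norm h) \<midarrow>0\<rightarrow> 0"
        using der[OF t p0] by (simp add: has_derivative_at)
      hence "(\<lambda>n. norm (f t (p0 + h n) - f t p0 - f' t p0 (h n)) / norm (h n)) \<longlonglongrightarrow> 0"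
        using h0 h1 by (auto simp flip: LIMSEQ_SEQ_conv)
      hence seq: "(\<lambda>n. norm (f t (p0 + h n) - f t p0 - f' t p0 (h n)) / norm (h n) * norm v) \<longlonglongrightarrow> 0"
        by (rule tendsto_mult_left_zero)
      have rw: "norm (f t (p0 + h n) - f t p0 - f' t p0 (h n)) / norm (h n) * norm v
         = norm ((f t (p0 + h n) - f t p0) /\<^sub>R c n - f' t p0 v)" for n
      proof -
        have eq: "(f t (p0 + h n) - f t p0) /\<^sub>R c n - f' t p0 v = (f t (p0 + h n) - f t p0 - f' t p0 (h n)) /\<^sub>R c n"
          using c0[of n] lin[OF t] by (simp add: h_def linear_simps algebra_simps)
        have "norm (h n) = c n * norm v" using c0[of n] by (simp add: h_def)
        thus ?thesis unfolding eq norm_scaleR using c0[of n] False by (simp add: field_simps)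
      qed
      show "(\<lambda>n. (f t (p0 + h n) - f t p0) /\<^sub>R c n) \<longlonglongrightarrow> f' t p0 v"
        using seq unfolding rw by (rule LIM_zero_cancel[OF tendsto_norm_zero_cancel])
    qed
  qed
  have intd: "integrable M (\<lambda>t. f' t p0 v)" for v
    by (rule Bochner_Integration.integrable_bound[of M "\<lambda>t. g t * norm v"])
       (use g meas bd[OF _ p0] in \<open>auto intro!: AE_I2 order_trans[OF _ abs_ge_self]\<close>)
  thus "\<And>v. integrable M (\<lambda>t. f' t p0 v)" .
  define L where "L = (\<lambda>v. \<integral>t. f' t p0 v \<partial>M)"
  have bl: "bounded_linear L"
  proof (rule bounded_linear_intro)
    fix v w r
    have "L (v + w) = (\<integral>t. f' t p0 v + f' t p0 w \<partial>M)" unfolding L_def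
      by (rule Bochner_Integration.integral_cong) (use lin in \<open>auto simp: linear_simps\<close>)
    thus "L (v + w) = L v + L w" using intd by (simp add: L_def)
    have "L (r *\<^sub>R v) = (\<integral>t. r *\<^sub>R f' t p0 v \<partial>M)" unfolding L_def
      by (rule Bochner_Integration.integral_cong) (use lin in \<open>auto simp: linear_simps\<close>)
    thus "L (r *\<^sub>R v) = r *\<^sub>R L v" by (simp add: L_def)
    have "norm (L v) \<le> (\<integral>t. g t * norm v \<partial>M)" unfolding L_def
      by (rule order_trans[OF integral_norm_bound Bochner_Integration.integral_mono]) (use intd g bd[OF _ p0] in auto)
    thus "norm (L v) \<le> norm v * (\<integral>t. g t \<partial>M)" by (simp add: mult.commute)
  qed
  have "((\<lambda>p. \<integral>t. f t p \<partial>M) has_derivative L) (at p0)"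
    unfolding has_derivative_at_within
  proof (intro conjI bl, unfold tendsto_at_iff_sequentially, intro allI impI)
    fix X assume X: "\<forall>i. X i \<in> UNIV - {p0}" "X \<longlonglongrightarrow> p0"
    have "\<forall>\<^sub>F n in sequentially. X n \<in> ball p0 e"
      using X(2) U by (intro topological_tendstoD) auto
    then obtain N where N: "\<And>n. n \<ge> N \<Longrightarrow> X n \<in> ball p0 e" by (auto simp: eventually_sequentially)
    \<comment> \<open>Dominated convergence concerns sequences, so the limit is tested along an
      arbitrary X; the shift by N places all of its terms in the ball.\<close>
    define q where "q = (\<lambda>n t. (f t (X (n + N)) - f t p0 - f' t p0 (X (n + N) - p0)) /\<^sub>R norm (X (n + N) - p0))"
    have ne: "X n \<noteq> p0" for n using X(1) by auto
    have iq: "integrable M (q n)" for n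
      unfolding q_def using int[OF p0] int[OF N[of "n + N"]] intd by auto
    have "(\<lambda>n. \<integral>t. q n t \<partial>M) \<longlonglongrightarrow> (\<integral>t. 0 \<partial>M)"
    proof (rule integral_dominated_convergence[where w = "\<lambda>t. 2 * g t"])
      show "integrable M (\<lambda>t. 2 * g t)" using g by simp
      show "q n \<in> borel_measurable M" for n using iq by (rule borel_measurable_integrable)
      show "AE t in M. (\<lambda>n. q n t) \<longlonglongrightarrow> 0"
      proof (rule AE_I2)
        fix t assume t: "t \<in> space M"
        have "((\<lambda>y. (f t y - f t p0 - f' t p0 (y - p0)) /\<^sub>R norm (y - p0)) \<longlongrightarrow> 0) (at p0)"
          using der[OF t p0] by (simp add: has_derivative_at_within)
        hence "(\<lambda>n. (f t (X n) - f t p0 - f' t p0 (X n - p0)) /\<^sub>R norm (X n - p0)) \<longlonglongrightarrow> 0"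
          unfolding tendsto_at_iff_sequentially using X by (auto simp: o_def)
        thus "(\<lambda>n. q n t) \<longlonglongrightarrow> 0" unfolding q_def by (rule LIMSEQ_ignore_initial_segment)
      qed
      show "AE t in M. norm (q n t) \<le> 2 * g t" for n
      proof (rule AE_I2)
        fix t assume t: "t \<in> space M"
        define u where "u = X (n + N) - p0"
        have u: "norm u > 0" using ne by (simp add: u_def)
        have "norm (f t (X (n + N)) - f t p0 - f' t p0 u) \<le> g t * norm u + g t * norm u"
          using lip[OF t N[of "n + N"]] bd[OF t p0, of u]
            norm_triangle_ineq4[of "f t (X (n + N)) - f t p0" "f' t p0 u"] by (simp add: u_def)
        thus "norm (q n t) \<le> 2 * g t" using u unfolding q_def u_def[symmetric] norm_scaleR
          by (simp add: field_simps)
      qed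
    qed auto
    moreover have "(\<integral>t. q n t \<partial>M) = ((\<integral>t. f t (X (n + N)) \<partial>M) - (\<integral>t. f t p0 \<partial>M) - L (X (n + N) - p0)) /\<^sub>R norm (X (n + N) - p0)" for n
      unfolding q_def L_def using int[OF p0] int[OF N[of "n + N"]] intd by simp
    ultimately have "(\<lambda>n. ((\<integral>t. f t (X (n + N)) \<partial>M) - (\<integral>t. f t p0 \<partial>M) - L (X (n + N) - p0)) /\<^sub>R norm (X (n + N) - p0)) \<longlonglongrightarrow> 0"
      by simp
    thus "((\<lambda>y. ((\<integral>t. f t y \<partial>M) - (\<integral>t. f t p0 \<partial>M) - L (y - p0)) /\<^sub>R norm (y - p0)) \<circ> X) \<longlonglongrightarrow> 0"
      unfolding o_def by (rule LIMSEQ_offset)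
  qed
  thus "((\<lambda>p. \<integral>t. f t p \<partial>M) has_derivative (\<lambda>v. \<integral>t. f' t p0 v \<partial>M)) (at p0)"
    by (simp add: L_def)
qed

section \<open>Kernels given by integrals over time\<close>

text \<open>Gives a lower bound for the weight that is uniform over all base points and all radii at
  least \<rho>, as a dominating function independent of the point requires. The base point 0 lies on
  the boundary of the orthant and acts as an infimum.\<close>

lemma box_weight_mono:
  assumes "\<forall>i. \<alpha> $ i \<ge> -1/2" "x \<in> Rplus" "0 < \<rho>" "\<rho> \<le> r"
  shows "box_weight \<alpha> 0 \<rho> \<le> box_weight \<alpha> x r"
  unfolding box_weight_def
proof (intro prod_mono conjI mult_mono powr_mono2)
  fix i
  have x: "x $ i > 0" using assms(2) by (simp add: Rplus_def)
  show "0 \<le> 2 * \<alpha> $ i + 1" using assms(1)[rule_format, of i] by linarith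
  show "0 $ i + \<rho> \<le> x $ i + r" using x assms by simp
qed (use assms in auto)

lemma box_weight_0_pos: "r > 0 \<Longrightarrow> box_weight \<alpha> 0 r > 0"
  unfolding box_weight_def by (intro prod_pos) auto

text \<open>Common to both cases: F is the heat kernel or its time derivative, and m is its time
  profile at distance r. The uniform bound A on the integral of m |h| makes the constant independent
  of x and y. Monotonicity of m/r lets the gradient at nearby points be dominated by its profile at
  a smaller fixed distance.\<close>

lemma CZ_estimates_integral:
  fixes \<alpha> :: "real ^ 'd" and F :: "real \<Rightarrow> (real ^ 'd) \<times> (real ^ 'd) \<Rightarrow> real"
    and h :: "real \<Rightarrow> complex" and m :: "real \<Rightarrow> real \<Rightarrow> real"
  assumes al: "\<forall>i. \<alpha> $ i \<ge> -1/2" and sM: "sets M = sets borel"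
    and Fm: "\<And>x y. x \<in> Rplus \<Longrightarrow> y \<in> Rplus \<Longrightarrow> set_borel_measurable borel {0<..} (\<lambda>t. F t (x, y))"
    and hm: "set_borel_measurable M {0<..} h"
    and C: "C \<ge> 0"
    and m0: "\<And>t r. t > 0 \<Longrightarrow> r > 0 \<Longrightarrow> m t r \<ge> 0"
    and mmono: "\<And>t r r'. t > 0 \<Longrightarrow> 0 < r \<Longrightarrow> r \<le> r' \<Longrightarrow> m t r' / r' \<le> m t r / r"
    and mint: "\<And>r. r > 0 \<Longrightarrow> set_integrable M {0<..} (\<lambda>t. m t r * norm (h t))"
    and mA: "\<And>r. r > 0 \<Longrightarrow> set_lebesgue_integral M {0<..} (\<lambda>t. m t r * norm (h t)) \<le> A"
    and Fb: "\<And>t x y. t > 0 \<Longrightarrow> x \<in> Rplus \<Longrightarrow> y \<in> Rplus \<Longrightarrow> x \<noteq> y \<Longrightarrow>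
      \<bar>F t (x, y)\<bar> \<le> C * m t (dist x y) / box_weight \<alpha> x (dist x y)"
    and Fd: "\<And>t x y. t > 0 \<Longrightarrow> x \<in> Rplus \<Longrightarrow> y \<in> Rplus \<Longrightarrow> x \<noteq> y \<Longrightarrow>
      \<exists>D. (F t has_derivative D) (at (x, y)) \<and>
        (\<forall>v. \<bar>D v\<bar> \<le> C * (m t (dist x y) / dist x y) / box_weight \<alpha> x (dist x y) * norm v)"
  shows "CZ_estimates \<alpha> (\<lambda>x y. set_lebesgue_integral M {0<..} (\<lambda>t. complex_of_real (F t (x, y)) * h t))"
proof -
  define \<Omega> where "\<Omega> = {p :: (real ^ 'd) \<times> (real ^ 'd). fst p \<in> Rplus \<and> snd p \<in> Rplus \<and> fst p \<noteq> snd p}"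
  define f where "f = (\<lambda>t p. indicator {0<..} t *\<^sub>R (complex_of_real (F t p) * h t))"
  define D where "D = (\<lambda>t p. frechet_derivative (F t) (at p))"
  define f' where "f' = (\<lambda>t p v. indicator {0<..} t *\<^sub>R (complex_of_real (D t p v) * h t))"
  define b where "b = (\<lambda>r t. indicator {0<..} t *\<^sub>R (m t r * norm (h t)))"
  have spM: "space M = UNIV" using sets_eq_imp_space_eq[OF sM] by simp
  have ib: "integrable M (b r)" if "r > 0" for r using mint[OF that] by (simp add: set_integrable_def b_def)
  have Ab: "(\<integral>t. b r t \<partial>M) \<le> A" if "r > 0" for r using mA[OF that] by (simp add: set_lebesgue_integral_def b_def)
  have b0: "b r t \<ge> 0" if "r > 0" for r t using m0[OF _ that] by (auto simp: b_def indicator_def)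
  have A0: "A \<ge> 0"
  proof -
    have "0 \<le> (\<integral>t. b 1 t \<partial>M)" using b0[of 1] by (intro Bochner_Integration.integral_nonneg) auto
    thus ?thesis using Ab[of 1] by simp
  qed
  have dF: "(F t has_derivative D t p) (at p)"
    "\<And>v. \<bar>D t p v\<bar> \<le> C * (m t (dist (fst p) (snd p)) / dist (fst p) (snd p)) / box_weight \<alpha> (fst p) (dist (fst p) (snd p)) * norm v"
    if tp: "t > 0" "p \<in> \<Omega>" for t p
  proof -
    obtain D' where D': "(F t has_derivative D') (at p)"
        "\<And>v. \<bar>D' v\<bar> \<le> C * (m t (dist (fst p) (snd p)) / dist (fst p) (snd p)) / box_weight \<alpha> (fst p) (dist (fst p) (snd p)) * norm v"
      using Fd[OF tp(1), of "fst p" "snd p"] tp(2) by (auto simp: \<Omega>_def)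
    have "D t p = D'" unfolding D_def using frechet_derivative_at[OF D'(1)] by simp
    thus "(F t has_derivative D t p) (at p)"
      "\<And>v. \<bar>D t p v\<bar> \<le> C * (m t (dist (fst p) (snd p)) / dist (fst p) (snd p)) / box_weight \<alpha> (fst p) (dist (fst p) (snd p)) * norm v"
      using D' by auto
  qed
  have fmeas: "(\<lambda>t. f t p) \<in> borel_measurable M" if "p \<in> \<Omega>" for p
  proof -
    have "(\<lambda>t. indicator {0<..} t *\<^sub>R F t p) \<in> borel_measurable M"
      using Fm[of "fst p" "snd p"] that unfolding set_borel_measurable_def \<Omega>_def
      by (simp add: measurable_cong_sets[OF sM refl])
    hence "(\<lambda>t. complex_of_real (indicator {0<..} t *\<^sub>R F t p) * (indicator {0<..} t *\<^sub>R h t)) \<in> borel_measurable M"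
      using hm unfolding set_borel_measurable_def by measurable
    moreover have "complex_of_real (indicator {0<..} t *\<^sub>R F t p) * (indicator {0<..} t *\<^sub>R h t) = f t p" for t
      by (auto simp: f_def indicator_def)
    ultimately show ?thesis by simp
  qed
  have fb: "norm (f t p) \<le> C / box_weight \<alpha> (fst p) (dist (fst p) (snd p)) * b (dist (fst p) (snd p)) t"
    if "p \<in> \<Omega>" for p t
  proof (cases "t > 0")
    case True
    have "norm (f t p) = \<bar>F t p\<bar> * norm (h t)" using True by (simp add: f_def norm_mult)
    also have "\<dots> \<le> C * m t (dist (fst p) (snd p)) / box_weight \<alpha> (fst p) (dist (fst p) (snd p)) * norm (h t)"
      using Fb[OF True, of "fst p" "snd p"] that by (intro mult_right_mono) (auto simp: \<Omega>_def)
    finally show ?thesis using True by (simp add: b_def)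
  qed (auto simp: f_def b_def)
  have rp: "dist (fst p) (snd p) > 0" if "p \<in> \<Omega>" for p using that by (simp add: \<Omega>_def)
  have Wp: "box_weight \<alpha> (fst p) (dist (fst p) (snd p)) > 0" if "p \<in> \<Omega>" for p
    using that rp[OF that] by (intro box_weight_pos) (auto simp: \<Omega>_def)
  have fint: "integrable M (\<lambda>t. f t p)" if "p \<in> \<Omega>" for p
  proof (rule Bochner_Integration.integrable_bound[OF _ fmeas[OF that]])
    show "integrable M (\<lambda>t. C / box_weight \<alpha> (fst p) (dist (fst p) (snd p)) * b (dist (fst p) (snd p)) t)"
      using ib[OF rp[OF that]] by simp
    show "AE t in M. norm (f t p) \<le> norm (C / box_weight \<alpha> (fst p) (dist (fst p) (snd p)) * b (dist (fst p) (snd p)) t)"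
      unfolding real_norm_def by (intro AE_I2 order_trans[OF fb[OF that] abs_ge_self])
  qed
  define K where "K = (\<lambda>x y. set_lebesgue_integral M {0<..} (\<lambda>t. complex_of_real (F t (x, y)) * h t))"
  have Kf: "K (fst p) (snd p) = (\<integral>t. f t p \<partial>M)" for p
    by (simp add: K_def f_def set_lebesgue_integral_def)
  \<comment> \<open>The power of 2 pays for replacing \<open>box_weight\<close> by the measure of
    the ball.\<close>
  define C' where "C' = C * A * 2 ^ CARD('d)"
  have "CZ_estimates \<alpha> K" unfolding CZ_estimates_def
  proof (rule exI[of _ C'], intro ballI impI)
    fix x y :: "real ^ 'd" assume x: "x \<in> Rplus" and y: "y \<in> Rplus" and xy: "x \<noteq> y"
    define r where "r = dist x y"
    have r: "r > 0" using xy by (simp add: r_def)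
    have p0: "(x, y) \<in> \<Omega>" using x y xy by (simp add: \<Omega>_def)
    define W where "W = box_weight \<alpha> x r"
    have W: "W > 0" using Wp[OF p0] by (simp add: W_def r_def)
    define w where "w = measure (w_alpha \<alpha>) (ballplus x r)"
    have w: "w > 0" "w \<le> 2 ^ CARD('d) * W"
      using ballplus_measure_bounds[OF al x r] by (auto simp: w_def W_def)
    have Ww: "C * A / W \<le> C' / w"
    proof -
      have "C * A * w \<le> C * A * (2 ^ CARD('d) * W)" using w C A0 by (intro mult_left_mono) auto
      thus ?thesis using w W by (simp add: C'_def field_simps)
    qed
    have "norm (K x y) \<le> C * A / W"
    proof -
      have "norm (\<integral>t. f t (x, y) \<partial>M) \<le> (\<integral>t. C / W * b r t \<partial>M)"
        by (rule order_trans[OF integral_norm_bound Bochner_Integration.integral_mono])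
           (use fint[OF p0] ib[OF r] fb[OF p0] in \<open>auto simp: W_def r_def\<close>)
      also have "\<dots> = C / W * (\<integral>t. b r t \<partial>M)" by simp
      also have "\<dots> \<le> C / W * A" using Ab[OF r] C W by (intro mult_left_mono) auto
      finally show ?thesis using Kf[of "(x, y)"] by simp
    qed
    hence 1: "norm (K x y) \<le> C' / w" using Ww by linarith
    \<comment> \<open>Near (x, y) the distance stays above r/2, so at every such point the gradient
      is dominated by the profile at distance \<rho> divided by \<open>box_weight\<close> at the
      origin, a bound that no longer depends on the point.\<close>
    define \<rho> where "\<rho> = r / 2"
    have \<rho>: "\<rho> > 0" using r by (simp add: \<rho>_def)
    define V where "V = {p :: (real ^ 'd) \<times> (real ^ 'd). fst p \<in> Rplus \<and> snd p \<in> Rplus \<and> \<rho> < dist (fst p) (snd p)}"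
    have "open V"
    proof -
      have "V = (Rplus \<times> Rplus) \<inter> {p. \<rho> < dist (fst p) (snd p)}" by (auto simp: V_def)
      thus ?thesis by (simp only:) (intro open_Int open_Times open_Rplus open_Collect_less continuous_intros)
    qed
    moreover have "(x, y) \<in> V" using x y r by (simp add: V_def \<rho>_def r_def)
    ultimately obtain e where e: "e > 0" "ball (x, y) e \<subseteq> V" by (auto simp: open_contains_ball)
    have V\<Omega>: "p \<in> \<Omega>" if "p \<in> V" for p using that \<rho> by (auto simp: V_def \<Omega>_def)
    define g where "g = (\<lambda>t. C / \<rho> / box_weight \<alpha> 0 \<rho> * b \<rho> t)"
    have bw: "box_weight \<alpha> 0 \<rho> > 0" by (rule box_weight_0_pos[OF \<rho>])
    have f'b: "norm (f' t p v) \<le> C / dist (fst p) (snd p) / box_weight \<alpha> (fst p) (dist (fst p) (snd p)) * b (dist (fst p) (snd p)) t * norm v"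
      if "p \<in> \<Omega>" for t p v
    proof (cases "t > 0")
      case True
      have "norm (f' t p v) = \<bar>D t p v\<bar> * norm (h t)" using True by (simp add: f'_def norm_mult)
      also have "\<dots> \<le> C * (m t (dist (fst p) (snd p)) / dist (fst p) (snd p)) / box_weight \<alpha> (fst p) (dist (fst p) (snd p)) * norm v * norm (h t)"
        using dF(2)[OF True that] by (intro mult_right_mono) auto
      finally show ?thesis using True by (simp add: b_def mult_ac)
    qed (auto simp: f'_def b_def)
    have f'g: "norm (f' t p v) \<le> g t * norm v" if "p \<in> V" for t p v
    proof -
      define s where "s = dist (fst p) (snd p)"
      have s: "s > 0" "\<rho> \<le> s" using that \<rho> by (auto simp: V_def s_def)
      have le: "box_weight \<alpha> 0 \<rho> \<le> box_weight \<alpha> (fst p) s"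
        using box_weight_mono[OF al _ \<rho> s(2)] that by (auto simp: V_def)
      have bs: "b s t / s \<le> b \<rho> t / \<rho>"
      proof (cases "t > 0")
        case True
        have "m t s / s * norm (h t) \<le> m t \<rho> / \<rho> * norm (h t)"
          using mmono[OF True \<rho> s(2)] by (intro mult_right_mono) auto
        thus ?thesis using True by (simp add: b_def)
      qed (auto simp: b_def)
      have "norm (f' t p v) \<le> C / s / box_weight \<alpha> (fst p) s * b s t * norm v"
        using f'b[OF V\<Omega>[OF that]] by (simp add: s_def)
      also have "\<dots> = C * (b s t / s) / box_weight \<alpha> (fst p) s * norm v" by simp
      also have "\<dots> \<le> C * (b \<rho> t / \<rho>) / box_weight \<alpha> 0 \<rho> * norm v"
        by (intro mult_right_mono frac_le mult_left_mono[OF bs C] le bw) (use C b0[OF \<rho>, of t] \<rho> in auto)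
      finally show ?thesis by (simp add: g_def)
    qed
    have der: "(f t has_derivative f' t p) (at p)" if "p \<in> V" for t p
    proof (cases "t > 0")
      case True
      have "((\<lambda>p. complex_of_real (F t p) * h t) has_derivative (\<lambda>v. complex_of_real (D t p v) * h t)) (at p)"
        by (intro has_derivative_mult_left has_derivative_of_real dF(1)[OF True V\<Omega>[OF that]])
      thus ?thesis using True by (simp add: f_def f'_def)
    qed (simp add: f_def f'_def)
    note hdi = has_derivative_integral[OF e(1), of "(x, y)" M f f' g]
    have hd: "((\<lambda>p. \<integral>t. f t p \<partial>M) has_derivative (\<lambda>v. \<integral>t. f' t (x, y) v \<partial>M)) (at (x, y))"
      and if': "\<And>v. integrable M (\<lambda>t. f' t (x, y) v)"
      using hdi fint V\<Omega> e(2) der f'g ib[OF \<rho>] by (auto simp: g_def subset_iff)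
    have "norm (\<integral>t. f' t (x, y) v \<partial>M) \<le> C' / (r * w) * norm v" for v
    proof -
      have "norm (\<integral>t. f' t (x, y) v \<partial>M) \<le> (\<integral>t. C / r / W * norm v * b r t \<partial>M)"
        by (rule order_trans[OF integral_norm_bound Bochner_Integration.integral_mono])
           (use if' ib[OF r] f'b[OF p0] in \<open>auto simp: W_def r_def mult_ac\<close>)
      also have "\<dots> = C / r / W * norm v * (\<integral>t. b r t \<partial>M)" by simp
      also have "\<dots> \<le> C / r / W * norm v * A" using Ab[OF r] C W r by (intro mult_left_mono) auto
      also have "\<dots> = (C * A / W) / r * norm v" by (simp add: mult_ac)
      also have "\<dots> \<le> (C' / w) / r * norm v" using Ww r by (intro mult_right_mono divide_right_mono) auto
      finally show ?thesis by (simp add: mult_ac)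
    qed
    moreover have "((\<lambda>p. K (fst p) (snd p)) has_derivative (\<lambda>v. \<integral>t. f' t (x, y) v \<partial>M)) (at (x, y))"
      unfolding Kf by (rule hd)
    ultimately show "norm (K x y) \<le> C' / measure (w_alpha \<alpha>) (ballplus x (dist y x)) \<and>
      (\<exists>D. ((\<lambda>p. K (fst p) (snd p)) has_derivative D) (at (x, y)) \<and>
        (\<forall>v. norm (D v) \<le> C' / (dist x y * measure (w_alpha \<alpha>) (ballplus x (dist y x))) * norm v))"
      using 1 unfolding w_def r_def dist_commute[of y x] by blast
  qed
  thus ?thesis by (simp add: K_def)
qed

section \<open>The heat kernel and its derivatives\<close>

text \<open>In each term of the Leibniz rule one factor is differentiated. Since the cost \<kappa>
  is the same for all of them, every term restores the full product of the b_i, and counting the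
  terms gives the dimension.\<close>

lemma prod_derivative_bound:
  fixes u :: "'d::finite \<Rightarrow> 'p::real_normed_vector \<Rightarrow> real"
  assumes d: "\<And>i. \<exists>D. (u i has_derivative D) (at p) \<and> (\<forall>v. \<bar>D v\<bar> \<le> b i * \<kappa> * norm v)"
    and b: "\<And>i. \<bar>u i p\<bar> \<le> b i"
  shows "\<exists>D. ((\<lambda>p. \<Prod>i\<in>UNIV. u i p) has_derivative D) (at p) \<and>
    (\<forall>v. \<bar>D v\<bar> \<le> real CARD('d) * (\<Prod>i\<in>UNIV. b i) * \<kappa> * norm v)"
proof -
  obtain D where D: "\<And>i. (u i has_derivative D i) (at p)" "\<And>i v. \<bar>D i v\<bar> \<le> b i * \<kappa> * norm v"
    using d by metis
  define E where "E = (\<lambda>v. \<Sum>i\<in>UNIV. D i v * (\<Prod>j\<in>UNIV - {i}. u j p))"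
  have "((\<lambda>p. \<Prod>i\<in>UNIV. u i p) has_derivative E) (at p)"
    unfolding E_def by (rule has_derivative_prod) (rule D)
  moreover have "\<bar>E v\<bar> \<le> real CARD('d) * (\<Prod>i\<in>UNIV. b i) * \<kappa> * norm v" for v
  proof -
    have b0: "b i \<ge> 0" for i using b[of i] by linarith
    have "\<bar>D i v * (\<Prod>j\<in>UNIV - {i}. u j p)\<bar> \<le> (\<Prod>i\<in>UNIV. b i) * \<kappa> * norm v" for i
    proof -
      have "\<bar>D i v * (\<Prod>j\<in>UNIV - {i}. u j p)\<bar> = \<bar>D i v\<bar> * (\<Prod>j\<in>UNIV - {i}. \<bar>u j p\<bar>)"
        by (simp add: abs_mult abs_prod)
      also have "\<dots> \<le> (b i * \<kappa> * norm v) * (\<Prod>j\<in>UNIV - {i}. b j)"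
        using D(2)[of i v] b b0 by (intro mult_mono prod_mono prod_nonneg) (auto intro: order_trans[OF abs_ge_zero])
      also have "\<dots> = (b i * (\<Prod>j\<in>UNIV - {i}. b j)) * \<kappa> * norm v" by simp
      also have "b i * (\<Prod>j\<in>UNIV - {i}. b j) = (\<Prod>i\<in>UNIV. b i)" by (rule prod.remove[symmetric]) auto
      finally show ?thesis .
    qed
    hence "\<bar>E v\<bar> \<le> (\<Sum>i\<in>(UNIV::'d set). (\<Prod>i\<in>UNIV. b i) * \<kappa> * norm v)"
      unfolding E_def by (intro order_trans[OF sum_abs] sum_mono)
    thus ?thesis by (simp add: mult_ac)
  qed
  ultimately show ?thesis by blast
qed

text \<open>The chain rule with the projection onto the i-th coordinates of x and y, which is linear
  and does not increase norms, so the constant survives unchanged.\<close>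

lemma has_derivative_coordinate_pair:
  fixes x y :: "real ^ 'd"
  assumes d: "\<exists>D. ((\<lambda>q. \<phi> (fst q) (snd q)) has_derivative D) (at (x $ i, y $ i)) \<and> (\<forall>v. \<bar>D v\<bar> \<le> c * norm v)"
  shows "\<exists>D. ((\<lambda>p. \<phi> (fst p $ i) (snd p $ i)) has_derivative D) (at (x, y)) \<and> (\<forall>v. \<bar>D v\<bar> \<le> c * norm v)"
proof -
  obtain D where D: "((\<lambda>q. \<phi> (fst q) (snd q)) has_derivative D) (at (x $ i, y $ i))" "\<And>v. \<bar>D v\<bar> \<le> c * norm v"
    using d by blast
  define \<pi> where "\<pi> = (\<lambda>p::(real^'d) \<times> (real^'d). (fst p $ i, snd p $ i))"
  have \<pi>: "(\<pi> has_derivative \<pi>) (at (x, y))"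
    unfolding \<pi>_def by (rule bounded_linear_imp_has_derivative)
      (intro bounded_linear_Pair bounded_linear_compose[OF bounded_linear_vec_nth] bounded_linear_fst bounded_linear_snd)
  have "((\<lambda>p. \<phi> (fst (\<pi> p)) (snd (\<pi> p))) has_derivative (\<lambda>v. D (\<pi> v))) (at (x, y))"
    by (rule has_derivative_compose[OF \<pi>]) (use D(1) in \<open>simp add: \<pi>_def\<close>)
  moreover have "\<bar>D (\<pi> v)\<bar> \<le> c * norm v" for v
  proof -
    \<comment> \<open>Testing the bound on one nonzero vector shows that c is non-negative.\<close>
    have "0 \<le> c * norm (1::real, 0::real)" by (rule order_trans[OF abs_ge_zero D(2)])
    hence c: "c \<ge> 0" by (simp add: norm_Pair)
    have "norm (\<pi> v) \<le> norm v" unfolding \<pi>_def norm_prod_def fst_conv snd_conv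
      by (intro real_sqrt_le_mono add_mono power_mono) (auto intro: component_le_norm_cart)
    hence "c * norm (\<pi> v) \<le> c * norm v" using c by (rule mult_left_mono)
    thus ?thesis using D(2)[of "\<pi> v"] by linarith
  qed
  ultimately show ?thesis unfolding \<pi>_def fst_conv snd_conv by blast
qed

text \<open>The derivative is a pointwise limit of difference quotients of a measurable function.
  The increments are positive, so the shifted argument stays in the half line. This supplies the
  measurability in t of the kernel and of its time derivative.\<close>

lemma set_borel_measurable_differentiable:
  fixes f :: "real \<Rightarrow> real"
  assumes d: "\<And>t. t > 0 \<Longrightarrow> (f has_real_derivative f' t) (at t)"
  shows "set_borel_measurable borel {0<..} f" "set_borel_measurable borel {0<..} f'"
proof -
  have "continuous_on {0<..} f"
    using d by (auto intro!: continuous_at_imp_continuous_on DERIV_isCont)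
  thus f: "set_borel_measurable borel {0<..} f"
    unfolding set_borel_measurable_def by (intro borel_measurable_continuous_on_indicator) auto
  define F where "F = (\<lambda>t. indicator {0<..} t *\<^sub>R f t)"
  have F: "F \<in> borel_measurable borel" using f by (simp add: set_borel_measurable_def F_def)
  define c where "c = (\<lambda>n. inverse (real (Suc n)))"
  have c: "c n > 0" for n by (simp add: c_def)
  have c0: "c \<longlonglongrightarrow> 0" unfolding c_def by (rule LIMSEQ_inverse_real_of_nat)
  show "set_borel_measurable borel {0<..} f'"
    unfolding set_borel_measurable_def
  proof (rule borel_measurable_LIMSEQ_real)
    show "(\<lambda>t. indicator {0<..} t *\<^sub>R ((F (t + c n) - F t) / c n)) \<in> borel_measurable borel" for n
      using F by measurable
    fix t :: real
    show "(\<lambda>n. indicator {0<..} t *\<^sub>R ((F (t + c n) - F t) / c n)) \<longlonglongrightarrow> indicator {0<..} t *\<^sub>R f' t"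
    proof (cases "t > 0")
      case True
      have "(\<lambda>h. (f (t + h) - f t) / h) \<midarrow>0\<rightarrow> f' t" using d[OF True] by (simp add: DERIV_def)
      hence "(\<lambda>n. (f (t + c n) - f t) / c n) \<longlonglongrightarrow> f' t"
        using c0 less_imp_neq[OF c, THEN not_sym] by (auto simp flip: LIMSEQ_SEQ_conv)
      moreover have "t + c n > 0" for n using c[of n] True by linarith
      ultimately show ?thesis using True by (simp add: F_def)
    qed auto
  qed
qed

lemma heatG_eq_prod:
  fixes \<alpha> :: "real ^ 'd"
  assumes "\<And>i. heat_factor_pair (\<alpha> $ i) (\<epsilon> i) (C i) (g i) (g' i)" "t > 0" "x \<in> Rplus" "y \<in> Rplus"
  shows "heatG \<alpha> \<epsilon> t x y = (\<Prod>i\<in>UNIV. g i t (x $ i) (y $ i))"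
proof -
  define s where "s = 2 * sinh (2 * t)"
  define k where "k = - (1/2) * (cosh (2 * t) / sinh (2 * t))"
  define \<psi> where "\<psi> = (\<lambda>i. (x $ i * y $ i) ^ (\<epsilon> i) * besselI (\<alpha> $ i + real (\<epsilon> i)) (x $ i * y $ i / sinh (2 * t))
          / (x $ i * y $ i) powr (\<alpha> $ i + real (\<epsilon> i)))"
  have s: "s > 0" using assms(2) by (simp add: s_def)
  have "(\<Prod>i\<in>(UNIV::'d set). 1 / s) = s powr (- real CARD('d))"
    using s by (simp add: powr_minus powr_realpow power_one_over inverse_eq_divide)
  moreover have "(\<Prod>i\<in>UNIV. exp (k * ((x $ i)\<^sup>2 + (y $ i)\<^sup>2))) = exp (k * ((norm x)\<^sup>2 + (norm y)\<^sup>2))"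
  proof -
    have n: "(norm z)\<^sup>2 = (\<Sum>i\<in>UNIV. (z $ i)\<^sup>2)" for z :: "real ^ 'd"
      unfolding norm_vec_def L2_set_def by (simp add: sum_nonneg)
    show ?thesis unfolding n exp_sum[OF finite, symmetric] sum.distrib[symmetric] sum_distrib_left[symmetric] ..
  qed
  moreover have "g i t (x $ i) (y $ i) = 1 / s * exp (k * ((x $ i)\<^sup>2 + (y $ i)\<^sup>2)) * \<psi> i" for i
    using assms(1)[of i] assms(2-4) unfolding heat_factor_pair_def s_def k_def \<psi>_def Rplus_def by simp
  ultimately show ?thesis unfolding heatG_def s_def[symmetric] k_def[symmetric] \<psi>_def[symmetric] by (simp only: prod.distrib)
qed

lemma heatG_bounds:
  fixes \<alpha> :: "real ^ 'd"
  assumes al: "\<forall>i. \<alpha> $ i \<ge> -1/2" and ep: "\<forall>i. \<epsilon> i \<in> {0, 1}"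
  obtains L where "L \<ge> 0" and "\<And>t x y. t > 0 \<Longrightarrow> x \<in> Rplus \<Longrightarrow> y \<in> Rplus \<Longrightarrow>
    ((\<lambda>t. heatG \<alpha> \<epsilon> t x y) has_real_derivative deriv (\<lambda>t. heatG \<alpha> \<epsilon> t x y) t) (at t) \<and>
    \<bar>heatG \<alpha> \<epsilon> t x y\<bar> \<le> L * heat_product_majorant \<alpha> t x y \<and>
    \<bar>deriv (\<lambda>t. heatG \<alpha> \<epsilon> t x y) t\<bar> \<le> L * (heat_product_majorant \<alpha> t x y / tanh t) \<and>
    (\<exists>D. ((\<lambda>p. heatG \<alpha> \<epsilon> t (fst p) (snd p)) has_derivative D) (at (x, y)) \<and>
      (\<forall>v. \<bar>D v\<bar> \<le> L * (heat_product_majorant \<alpha> t x y / sqrt (tanh t)) * norm v)) \<and>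
    (\<exists>D. ((\<lambda>p. deriv (\<lambda>t. heatG \<alpha> \<epsilon> t (fst p) (snd p)) t) has_derivative D) (at (x, y)) \<and>
      (\<forall>v. \<bar>D v\<bar> \<le> L * (heat_product_majorant \<alpha> t x y / tanh t / sqrt (tanh t)) * norm v))"
proof -
  have "\<forall>i. \<exists>C g g'. heat_factor_pair (\<alpha> $ i) (\<epsilon> i) C g g'"
    using heat_factor_pair_exists al ep by blast
  then obtain C g g' where fp: "\<And>i. heat_factor_pair (\<alpha> $ i) (\<epsilon> i) (C i) (g i) (g' i)" by metis
  define n where "n = real CARD('d)"
  have n: "n \<ge> 1" by (simp add: n_def)
  define c where "c = (\<Prod>i\<in>UNIV. C i)"
  have C0: "C i \<ge> 0" for i using fp[of i] by (simp add: heat_factor_pair_def)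
  have c: "c \<ge> 0" unfolding c_def using C0 by (intro prod_nonneg) auto
  \<comment> \<open>In the k-th term of the Leibniz rule in t only factor k is differentiated.
    Writing the term as a product over all indices lets \<open>prod_derivative_bound\<close> apply
    to it directly.\<close>
  define h where "h = (\<lambda>k i. if i = k then g' i else g i)"
  define dG where "dG = (\<lambda>t x y. \<Sum>k\<in>UNIV. \<Prod>i\<in>UNIV. h k i t (x $ i) (y $ i))"
  have PC: "(\<Prod>i\<in>UNIV. C i * heat_majorant (\<alpha> $ i) t (x $ i) (y $ i)) = c * heat_product_majorant \<alpha> t x y" for t x y
    by (simp add: prod.distrib c_def heat_product_majorant_def)
  have P0: "heat_product_majorant \<alpha> t x y \<ge> 0" for t x y unfolding heat_product_majorant_def by (intro prod_nonneg) (simp add: heat_majorant_def)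
  have G: "heatG \<alpha> \<epsilon> t x y = (\<Prod>i\<in>UNIV. g i t (x $ i) (y $ i))" if "t > 0" "x \<in> Rplus" "y \<in> Rplus" for t x y
    by (rule heatG_eq_prod[OF fp that])
  have dGt: "((\<lambda>t. heatG \<alpha> \<epsilon> t x y) has_real_derivative dG t x y) (at t)"
    if t: "t > 0" and x: "x \<in> Rplus" and y: "y \<in> Rplus" for t x y
  proof -
    have "((\<lambda>t. \<Prod>i\<in>UNIV. g i t (x $ i) (y $ i)) has_real_derivative
       (\<Sum>k\<in>UNIV. g' k t (x $ k) (y $ k) * (\<Prod>i\<in>UNIV-{k}. g i t (x $ i) (y $ i)))) (at t)"
      by (rule has_field_derivative_prod) (use fp t x y in \<open>auto simp: heat_factor_pair_def Rplus_def\<close>)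
    also have "(\<Sum>k\<in>UNIV. g' k t (x $ k) (y $ k) * (\<Prod>i\<in>UNIV-{k}. g i t (x $ i) (y $ i))) = dG t x y"
      unfolding dG_def
    proof (rule sum.cong[OF refl])
      fix k :: 'd
      have "(\<Prod>i\<in>UNIV. h k i t (x $ i) (y $ i)) = h k k t (x $ k) (y $ k) * (\<Prod>i\<in>UNIV-{k}. h k i t (x $ i) (y $ i))"
        by (rule prod.remove) auto
      also have "(\<Prod>i\<in>UNIV-{k}. h k i t (x $ i) (y $ i)) = (\<Prod>i\<in>UNIV-{k}. g i t (x $ i) (y $ i))"
        by (rule prod.cong) (auto simp: h_def)
      finally show "g' k t (x $ k) (y $ k) * (\<Prod>i\<in>UNIV-{k}. g i t (x $ i) (y $ i)) = (\<Prod>i\<in>UNIV. h k i t (x $ i) (y $ i))"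
        by (simp add: h_def)
    qed
    finally have *: "((\<lambda>t. \<Prod>i\<in>UNIV. g i t (x $ i) (y $ i)) has_real_derivative dG t x y) (at t)" .
    show ?thesis
      by (rule has_field_derivative_transform_within_open[OF *, of "{0<..}"]) (use t G x y in auto)
  qed
  have deriv_eq: "deriv (\<lambda>t. heatG \<alpha> \<epsilon> t x y) t = dG t x y" if "t > 0" "x \<in> Rplus" "y \<in> Rplus" for t x y
    by (rule DERIV_imp_deriv[OF dGt[OF that]])
  have nb: "\<forall>\<^sub>F p in nhds (x, y). fst p \<in> Rplus \<and> snd p \<in> Rplus" if "x \<in> Rplus" "y \<in> Rplus" for x y :: "real ^ 'd"
  proof -
    have "\<forall>\<^sub>F p in nhds (x, y). p \<in> Rplus \<times> Rplus"
      using that by (intro eventually_nhds_in_open open_Times open_Rplus) auto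
    thus ?thesis by eventually_elim auto
  qed
  \<comment> \<open>One factor n counts the terms of the time derivative, the other the terms of the
    gradient of each of them.\<close>
  define L where "L = n * n * c"
  show ?thesis
  proof (rule that[of L])
    show L: "L \<ge> 0" using c n by (simp add: L_def)
    fix t :: real and x y :: "real ^ 'd" assume t: "t > 0" and x: "x \<in> Rplus" and y: "y \<in> Rplus"
    define T where "T = tanh t"
    have T: "T > 0" using t by (simp add: T_def)
    have xi: "x $ i > 0" "y $ i > 0" for i using x y by (auto simp: Rplus_def)
    define b where "b = (\<lambda>i. C i * heat_majorant (\<alpha> $ i) t (x $ i) (y $ i))"
    have bp: "(\<Prod>i\<in>UNIV. b i) = c * heat_product_majorant \<alpha> t x y" unfolding b_def by (rule PC)
    have cP: "c * heat_product_majorant \<alpha> t x y \<ge> 0" using c P0 by simp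
    have F: "\<bar>g i t (x $ i) (y $ i)\<bar> \<le> b i" "\<bar>g' i t (x $ i) (y $ i)\<bar> \<le> b i * (1 / T)"
      "\<exists>D. ((\<lambda>p. g i t (fst p) (snd p)) has_derivative D) (at (x $ i, y $ i)) \<and> (\<forall>v. \<bar>D v\<bar> \<le> b i * (1 / sqrt T) * norm v)"
      "\<exists>D. ((\<lambda>p. g' i t (fst p) (snd p)) has_derivative D) (at (x $ i, y $ i)) \<and> (\<forall>v. \<bar>D v\<bar> \<le> b i * (1 / T) * (1 / sqrt T) * norm v)" for i
      using fp[of i, unfolded heat_factor_pair_def, THEN conjunct2, rule_format, OF t xi[of i]]
      by (simp_all add: b_def T_def)
    \<comment> \<open>The loss 1/T of the time derivative is attached to factor k alone, so that the
      product over i contains it exactly once.\<close>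
    define bk where "bk = (\<lambda>k i. b i * (if i = k then 1 / T else 1))"
    have bkp: "(\<Prod>i\<in>UNIV. bk k i) = c * heat_product_majorant \<alpha> t x y / T" for k
      unfolding bk_def prod.distrib bp by (simp add: prod.delta)
    have hb: "\<bar>h k i t (x $ i) (y $ i)\<bar> \<le> bk k i" for k i
      using F(1,2)[of i] by (cases "i = k") (simp_all add: h_def bk_def)
    have hd: "\<exists>D. ((\<lambda>p. h k i t (fst p $ i) (snd p $ i)) has_derivative D) (at (x, y)) \<and>
        (\<forall>v. \<bar>D v\<bar> \<le> bk k i * (1 / sqrt T) * norm v)" for k i
      by (rule has_derivative_coordinate_pair) (use F(3,4)[of i] in \<open>cases "i = k"; simp add: h_def bk_def\<close>)
    have n1: "n \<le> n * n" "1 \<le> n * n" using n mult_mono[of 1 n 1 n] mult_mono[of 1 n n n] by auto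
    have Lc: "c * heat_product_majorant \<alpha> t x y \<le> L * heat_product_majorant \<alpha> t x y" "n * (c * heat_product_majorant \<alpha> t x y) \<le> L * heat_product_majorant \<alpha> t x y"
      using mult_right_mono[OF n1(2) cP] mult_right_mono[OF n1(1) cP] by (simp_all add: L_def mult_ac)
    have 1: "\<bar>heatG \<alpha> \<epsilon> t x y\<bar> \<le> L * heat_product_majorant \<alpha> t x y"
    proof -
      have "\<bar>heatG \<alpha> \<epsilon> t x y\<bar> \<le> (\<Prod>i\<in>UNIV. b i)"
        unfolding G[OF t x y] abs_prod using F(1) by (intro prod_mono) auto
      thus ?thesis using Lc by (simp add: bp)
    qed
    have 2: "\<bar>deriv (\<lambda>t. heatG \<alpha> \<epsilon> t x y) t\<bar> \<le> L * (heat_product_majorant \<alpha> t x y / T)"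
    proof -
      have "\<bar>\<Prod>i\<in>UNIV. h k i t (x $ i) (y $ i)\<bar> \<le> c * heat_product_majorant \<alpha> t x y / T" for k
        unfolding bkp[of k, symmetric] abs_prod using hb by (intro prod_mono) auto
      hence "\<bar>dG t x y\<bar> \<le> (\<Sum>k\<in>(UNIV::'d set). c * heat_product_majorant \<alpha> t x y / T)"
        unfolding dG_def by (intro order_trans[OF sum_abs] sum_mono)
      also have "\<dots> = n * (c * heat_product_majorant \<alpha> t x y) / T" by (simp add: n_def)
      also have "\<dots> \<le> L * heat_product_majorant \<alpha> t x y / T" using Lc T by (intro divide_right_mono) auto
      finally show ?thesis unfolding deriv_eq[OF t x y] by simp
    qed
    have 3: "\<exists>D. ((\<lambda>p. heatG \<alpha> \<epsilon> t (fst p) (snd p)) has_derivative D) (at (x, y)) \<and>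
      (\<forall>v. \<bar>D v\<bar> \<le> L * (heat_product_majorant \<alpha> t x y / sqrt T) * norm v)"
    proof -
      obtain D where D: "((\<lambda>p. \<Prod>i\<in>UNIV. g i t (fst p $ i) (snd p $ i)) has_derivative D) (at (x, y))"
        "\<And>v. \<bar>D v\<bar> \<le> n * (c * heat_product_majorant \<alpha> t x y) * (1 / sqrt T) * norm v"
        using prod_derivative_bound[of "\<lambda>i p. g i t (fst p $ i) (snd p $ i)" "(x, y)" b "1 / sqrt T"]
          has_derivative_coordinate_pair[OF F(3)] F(1) unfolding bp n_def by auto
      have "((\<lambda>p. heatG \<alpha> \<epsilon> t (fst p) (snd p)) has_derivative D) (at (x, y))"
        by (rule has_derivative_transform_eventually[OF D(1)])
           (use eventually_nhds_x_imp_x[OF nb[OF x y]] nb[OF x y] G[OF t] x y in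
             \<open>auto simp: eventually_at_filter elim!: eventually_mono\<close>)
      moreover have "\<bar>D v\<bar> \<le> L * (heat_product_majorant \<alpha> t x y / sqrt T) * norm v" for v
      proof -
        have "n * (c * heat_product_majorant \<alpha> t x y) * (1 / sqrt T) * norm v \<le> L * heat_product_majorant \<alpha> t x y * (1 / sqrt T) * norm v"
          using Lc T by (intro mult_right_mono) auto
        thus ?thesis using D(2)[of v] by simp
      qed
      ultimately show ?thesis by blast
    qed
    have 4: "\<exists>D. ((\<lambda>p. deriv (\<lambda>t. heatG \<alpha> \<epsilon> t (fst p) (snd p)) t) has_derivative D) (at (x, y)) \<and>
      (\<forall>v. \<bar>D v\<bar> \<le> L * (heat_product_majorant \<alpha> t x y / T / sqrt T) * norm v)"
    proof -
      have "\<exists>D. ((\<lambda>p. \<Prod>i\<in>UNIV. h k i t (fst p $ i) (snd p $ i)) has_derivative D) (at (x, y)) \<and>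
        (\<forall>v. \<bar>D v\<bar> \<le> n * (c * heat_product_majorant \<alpha> t x y / T) * (1 / sqrt T) * norm v)" for k
        using prod_derivative_bound[of "\<lambda>i p. h k i t (fst p $ i) (snd p $ i)" "(x, y)" "bk k" "1 / sqrt T"]
          hd hb unfolding bkp n_def by auto
      hence "\<forall>k. \<exists>D. ((\<lambda>p. \<Prod>i\<in>UNIV. h k i t (fst p $ i) (snd p $ i)) has_derivative D) (at (x, y)) \<and>
        (\<forall>v. \<bar>D v\<bar> \<le> n * (c * heat_product_majorant \<alpha> t x y / T) * (1 / sqrt T) * norm v)" by (rule allI)
      then obtain D where D': "\<forall>k. ((\<lambda>p. \<Prod>i\<in>UNIV. h k i t (fst p $ i) (snd p $ i)) has_derivative D k) (at (x, y)) \<and>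
        (\<forall>v. \<bar>D k v\<bar> \<le> n * (c * heat_product_majorant \<alpha> t x y / T) * (1 / sqrt T) * norm v)" by (rule choice[THEN exE])
      note D = D'[rule_format, THEN conjunct1] D'[rule_format, THEN conjunct2, rule_format]
      define E where "E = (\<lambda>v. \<Sum>k\<in>UNIV. D k v)"
      have dE: "((\<lambda>p. dG t (fst p) (snd p)) has_derivative E) (at (x, y))"
        unfolding dG_def E_def by (intro has_derivative_sum D)
      have "((\<lambda>p. deriv (\<lambda>t. heatG \<alpha> \<epsilon> t (fst p) (snd p)) t) has_derivative E) (at (x, y))"
        by (rule has_derivative_transform_eventually[OF dE])
           (use nb[OF x y] deriv_eq[OF t] x y in
             \<open>auto simp: eventually_at_filter elim!: eventually_mono\<close>)
      moreover have "\<bar>E v\<bar> \<le> L * (heat_product_majorant \<alpha> t x y / T / sqrt T) * norm v" for v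
      proof -
        have "\<bar>E v\<bar> \<le> (\<Sum>k\<in>(UNIV::'d set). n * (c * heat_product_majorant \<alpha> t x y / T) * (1 / sqrt T) * norm v)"
          unfolding E_def using D(2) by (intro order_trans[OF sum_abs] sum_mono)
        also have "\<dots> = L * (heat_product_majorant \<alpha> t x y / T / sqrt T) * norm v" by (simp add: L_def n_def)
        finally show ?thesis .
      qed
      ultimately show ?thesis by blast
    qed
    show "((\<lambda>t. heatG \<alpha> \<epsilon> t x y) has_real_derivative deriv (\<lambda>t. heatG \<alpha> \<epsilon> t x y) t) (at t) \<and>
    \<bar>heatG \<alpha> \<epsilon> t x y\<bar> \<le> L * heat_product_majorant \<alpha> t x y \<and>
    \<bar>deriv (\<lambda>t. heatG \<alpha> \<epsilon> t x y) t\<bar> \<le> L * (heat_product_majorant \<alpha> t x y / tanh t) \<and>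
    (\<exists>D. ((\<lambda>p. heatG \<alpha> \<epsilon> t (fst p) (snd p)) has_derivative D) (at (x, y)) \<and>
      (\<forall>v. \<bar>D v\<bar> \<le> L * (heat_product_majorant \<alpha> t x y / sqrt (tanh t)) * norm v)) \<and>
    (\<exists>D. ((\<lambda>p. deriv (\<lambda>t. heatG \<alpha> \<epsilon> t (fst p) (snd p)) t) has_derivative D) (at (x, y)) \<and>
      (\<forall>v. \<bar>D v\<bar> \<le> L * (heat_product_majorant \<alpha> t x y / tanh t / sqrt (tanh t)) * norm v))"
      using dGt[OF t x y] 1 2 3 4 unfolding deriv_eq[OF t x y] T_def by blast
  qed
qed

section \<open>The time integral and the conclusion\<close>

text \<open>The antiderivative -2r (r^2+t)^(-1/2) rises from -2 at t = 0 to 0 at infinity, so the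
  integral is 2 for every r. This independence of r makes the constant of case (a) uniform in x and
  y.\<close>

lemma integral_dist_kernel:
  fixes r :: real
  assumes r: "r > 0"
  shows "integrable lborel (\<lambda>t. indicator {0<..} t *\<^sub>R (r * (r\<^sup>2 + t) powr (-3/2)))"
    and "(LINT t:{0<..}|lborel. r * (r\<^sup>2 + t) powr (-3/2)) \<le> 2"
proof -
  define f where "f = (\<lambda>t. indicator {0<..} t *\<^sub>R (r * (r\<^sup>2 + t) powr (-3/2)))"
  have f0: "f t \<ge> 0" for t using r by (simp add: f_def)
  have pos: "r\<^sup>2 + t > 0" if "t \<ge> 0" for t using r that by (simp add: add_pos_nonneg)
  have "(\<integral>\<^sup>+t. ennreal (r * (r\<^sup>2 + t) powr (-3/2)) * indicator {0..} t \<partial>lborel)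
     = ennreal (0 - (- 2 * r * (r\<^sup>2 + 0) powr (-1/2)))"
  proof (rule nn_integral_FTC_atLeast)
    show "(\<lambda>t. r * (r\<^sup>2 + t) powr (-3/2)) \<in> borel_measurable borel" by measurable
    show "((\<lambda>t. - 2 * r * (r\<^sup>2 + t) powr (-1/2)) has_real_derivative r * (r\<^sup>2 + t) powr (-3/2)) (at t)" if "0 \<le> t" for t
      by (rule derivative_eq_intros refl | use pos[OF that] in simp)+
    show "0 \<le> r * (r\<^sup>2 + t) powr (-3/2)" for t using r by simp
    have "filterlim (\<lambda>t. r\<^sup>2 + t) at_top at_top" by (rule filterlim_tendsto_add_at_top[OF tendsto_const filterlim_ident])
    hence "((\<lambda>t. (r\<^sup>2 + t) powr (-1/2)) \<longlongrightarrow> 0) at_top"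
      by (intro tendsto_neg_powr) auto
    thus "((\<lambda>t. - 2 * r * (r\<^sup>2 + t) powr (-1/2)) \<longlongrightarrow> 0) at_top" by (rule tendsto_mult_right_zero)
  qed
  also have "0 - (- 2 * r * (r\<^sup>2 + 0) powr (-1/2)) = 2"
    using r by (simp add: powr_minus powr_half_sqrt inverse_eq_divide)
  finally have I: "(\<integral>\<^sup>+t. ennreal (r * (r\<^sup>2 + t) powr (-3/2)) * indicator {0..} t \<partial>lborel) = 2" by simp
  have "(\<integral>\<^sup>+t. ennreal (f t) \<partial>lborel) \<le> (\<integral>\<^sup>+t. ennreal (r * (r\<^sup>2 + t) powr (-3/2)) * indicator {0..} t \<partial>lborel)"
    by (intro nn_integral_mono) (auto simp: f_def indicator_def)
  hence le: "(\<integral>\<^sup>+t. ennreal (f t) \<partial>lborel) \<le> 2" unfolding I .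
  have fm: "f \<in> borel_measurable lborel" unfolding f_def by measurable
  have i: "integrable lborel f"
    by (rule integrableI_nonneg) (use fm f0 le in \<open>auto simp: le_less_trans[OF le]\<close>)
  thus "integrable lborel (\<lambda>t. indicator {0<..} t *\<^sub>R (r * (r\<^sup>2 + t) powr (-3/2)))" by (simp add: f_def)
  have "ennreal (\<integral>t. f t \<partial>lborel) \<le> ennreal 2"
    using nn_integral_eq_integral[OF i] f0 le by simp
  thus "(LINT t:{0<..}|lborel. r * (r\<^sup>2 + t) powr (-3/2)) \<le> 2"
    unfolding set_lebesgue_integral_def f_def by (subst (asm) ennreal_le_iff) auto
qed

theorem mainTheorem4:
  fixes \<alpha> :: "real ^ 'd" and \<epsilon> :: "'d \<Rightarrow> nat"
  assumes "\<forall>i. \<alpha> $ i \<ge> -1/2" and "\<forall>i. \<epsilon> i \<in> {0, 1}"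
  shows "(\<forall>\<eta> :: real \<Rightarrow> complex.
            set_borel_measurable borel {0<..} \<eta> \<and> (\<exists>B. \<forall>t>0. norm (\<eta> t) \<le> B)
            \<longrightarrow> CZ_estimates \<alpha> (kernelA \<alpha> \<epsilon> \<eta>))
       \<and> (\<forall>(M :: real measure) (h :: real \<Rightarrow> complex).
            sets M = sets borel \<and> h \<in> borel_measurable M
            \<and> set_integrable M {0<..} (\<lambda>t. exp (- t * lambda0 \<alpha>) * norm (h t))
            \<longrightarrow> CZ_estimates \<alpha> (kernelB \<alpha> \<epsilon> M h))"
proof -
  obtain L where L: "L \<ge> 0" and G: "\<And>t x y. t > 0 \<Longrightarrow> x \<in> Rplus \<Longrightarrow> y \<in> Rplus \<Longrightarrow>
    ((\<lambda>t. heatG \<alpha> \<epsilon> t x y) has_real_derivative deriv (\<lambda>t. heatG \<alpha> \<epsilon> t x y) t) (at t) \<and>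
    \<bar>heatG \<alpha> \<epsilon> t x y\<bar> \<le> L * heat_product_majorant \<alpha> t x y \<and>
    \<bar>deriv (\<lambda>t. heatG \<alpha> \<epsilon> t x y) t\<bar> \<le> L * (heat_product_majorant \<alpha> t x y / tanh t) \<and>
    (\<exists>D. ((\<lambda>p. heatG \<alpha> \<epsilon> t (fst p) (snd p)) has_derivative D) (at (x, y)) \<and>
      (\<forall>v. \<bar>D v\<bar> \<le> L * (heat_product_majorant \<alpha> t x y / sqrt (tanh t)) * norm v)) \<and>
    (\<exists>D. ((\<lambda>p. deriv (\<lambda>t. heatG \<alpha> \<epsilon> t (fst p) (snd p)) t) has_derivative D) (at (x, y)) \<and>
      (\<forall>v. \<bar>D v\<bar> \<le> L * (heat_product_majorant \<alpha> t x y / tanh t / sqrt (tanh t)) * norm v))"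
    by (rule heatG_bounds[OF assms]) (rule that)
  obtain K where K: "K > 0" and PK: "\<And>t x y. t > 0 \<Longrightarrow> x \<in> Rplus \<Longrightarrow> y \<in> Rplus \<Longrightarrow> x \<noteq> y \<Longrightarrow>
      heat_product_majorant \<alpha> t x y \<le> K * exp (- t * lambda0 \<alpha>) / box_weight \<alpha> x (dist x y) \<and>
      heat_product_majorant \<alpha> t x y / sqrt (tanh t) \<le> K * exp (- t * lambda0 \<alpha>) / dist x y / box_weight \<alpha> x (dist x y) \<and>
      heat_product_majorant \<alpha> t x y / tanh t \<le> K * (dist x y * ((dist x y)\<^sup>2 + t) powr (-3/2)) / box_weight \<alpha> x (dist x y) \<and>
      heat_product_majorant \<alpha> t x y / tanh t / sqrt (tanh t) \<le> K * (((dist x y)\<^sup>2 + t) powr (-3/2)) / box_weight \<alpha> x (dist x y)"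
    by (rule heat_decay[OF assms(1)]) (rule that)
  have LK: "L * K \<ge> 0" using L K by simp
  have scale: "L * a \<le> L * K * b / W" if "a \<le> K * b / W" for a b W
    using mult_left_mono[OF that L] by (simp add: mult.assoc)
  have transfer: "\<exists>D. (f has_derivative D) (at q) \<and> (\<forall>v. \<bar>D v\<bar> \<le> b' * norm v)"
    if "\<exists>D. (f has_derivative D) (at q) \<and> (\<forall>v. \<bar>D v\<bar> \<le> b * norm v)" "b \<le> b'"
    for f :: "(real ^ 'd) \<times> (real ^ 'd) \<Rightarrow> real" and q b b'
    using that by (meson mult_right_mono norm_ge_zero order_trans)
  show ?thesis
  proof (intro conjI allI impI; elim conjE)
    fix \<eta> :: "real \<Rightarrow> complex"
    assume \<eta>: "set_borel_measurable borel {0<..} \<eta>" and "\<exists>B. \<forall>t>0. norm (\<eta> t) \<le> B"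
    then obtain B where B: "\<And>t. t > 0 \<Longrightarrow> norm (\<eta> t) \<le> B" by blast
    have B0: "B \<ge> 0" using B[of 1] norm_ge_zero[of "\<eta> 1"] by linarith
    \<comment> \<open>Its quotient by r is (r^2+t)^(-3/2), the profile of the gradient bound, and
      decreases in r.\<close>
    define m where "m = (\<lambda>t r. r * (r\<^sup>2 + t) powr (-3/2) :: real)"
    have mi: "set_integrable lborel {0<..} (\<lambda>t. m t r * norm (- \<eta> t))"
      "set_lebesgue_integral lborel {0<..} (\<lambda>t. m t r * norm (- \<eta> t)) \<le> 2 * B" if r: "r > 0" for r
    proof -
      define f where "f = (\<lambda>t. indicator {0<..} t *\<^sub>R (r * (r\<^sup>2 + t) powr (-3/2)))"
      have f: "integrable lborel f" "(\<integral>t. f t \<partial>lborel) \<le> 2"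
        unfolding f_def by (rule integral_dist_kernel[OF r, unfolded set_lebesgue_integral_def])+
      have f0: "f t \<ge> 0" for t using r by (simp add: f_def)
      have fm: "(\<lambda>t. f t * norm (indicator {0<..} t *\<^sub>R \<eta> t)) \<in> borel_measurable lborel"
        using f(1) \<eta> unfolding set_borel_measurable_def by measurable
      have e: "f t * norm (indicator {0<..} t *\<^sub>R \<eta> t) = indicator {0<..} t *\<^sub>R (m t r * norm (- \<eta> t))" for t
        by (auto simp: f_def m_def indicator_def)
      have mm: "(\<lambda>t. indicator {0<..} t *\<^sub>R (m t r * norm (- \<eta> t))) \<in> borel_measurable lborel"
        using fm unfolding e .
      have bd: "norm (indicator {0<..} t *\<^sub>R (m t r * norm (- \<eta> t))) \<le> B * f t" for t
        using B[of t] r by (auto simp: indicator_def f_def m_def abs_mult mult_ac intro!: mult_left_mono mult_right_mono)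
      show 1: "set_integrable lborel {0<..} (\<lambda>t. m t r * norm (- \<eta> t))"
        unfolding set_integrable_def
        by (rule Bochner_Integration.integrable_bound[of _ "\<lambda>t. B * f t"])
           (use f mm bd in \<open>auto intro!: AE_I2 order_trans[OF _ abs_ge_self]\<close>)
      have "set_lebesgue_integral lborel {0<..} (\<lambda>t. m t r * norm (- \<eta> t)) \<le> (\<integral>t. B * f t \<partial>lborel)"
        unfolding set_lebesgue_integral_def
        by (rule Bochner_Integration.integral_mono) (use 1 f bd in \<open>auto simp: set_integrable_def intro: order_trans[OF abs_ge_self]\<close>)
      also have "\<dots> \<le> B * 2" using f(2) B0 by (simp add: mult_left_mono)
      finally show "set_lebesgue_integral lborel {0<..} (\<lambda>t. m t r * norm (- \<eta> t)) \<le> 2 * B" by simp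
    qed
    define F where "F = (\<lambda>t p. deriv (\<lambda>s. heatG \<alpha> \<epsilon> s (fst p) (snd p)) t)"
    have "CZ_estimates \<alpha> (\<lambda>x y. set_lebesgue_integral lborel {0<..} (\<lambda>t. complex_of_real (F t (x, y)) * (- \<eta> t)))"
    \<comment> \<open>The minus sign in front of the integral is moved into the density, which is
      why -\<eta> plays the part of h.\<close>
    proof (rule CZ_estimates_integral[where m = m and C = "L * K" and A = "2 * B", OF assms(1) sets_lborel _ _ LK _ _ mi])
      show "set_borel_measurable borel {0<..} (\<lambda>t. F t (x, y))" if "x \<in> Rplus" "y \<in> Rplus" for x y
        unfolding F_def fst_conv snd_conv
        by (rule set_borel_measurable_differentiable(2)) (use G that in blast)
      show "set_borel_measurable lborel {0<..} (\<lambda>t. - \<eta> t)"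
        using \<eta> by (simp add: set_borel_measurable_def)
      show "0 \<le> m t r" if "r > 0" for t r using that by (simp add: m_def)
      show "m t r' / r' \<le> m t r / r" if "t > 0" "0 < r" "r \<le> r'" for t r r'
        using that by (simp add: m_def powr_mono2' add_pos_pos power_mono)
      fix t :: real and x y :: "real ^ 'd"
      assume a: "t > 0" "x \<in> Rplus" "y \<in> Rplus" "x \<noteq> y"
      have le: "L * (heat_product_majorant \<alpha> t x y / tanh t) \<le> L * K * m t (dist x y) / box_weight \<alpha> x (dist x y)"
        "L * (heat_product_majorant \<alpha> t x y / tanh t / sqrt (tanh t)) \<le> L * K * (m t (dist x y) / dist x y) / box_weight \<alpha> x (dist x y)"
        by (rule scale; use PK[OF a] a(4) in \<open>simp add: m_def\<close>)+
      show "\<bar>F t (x, y)\<bar> \<le> L * K * m t (dist x y) / box_weight \<alpha> x (dist x y)"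
        using G[OF a(1-3)] le(1) by (simp add: F_def)
      show "\<exists>D. (F t has_derivative D) (at (x, y)) \<and>
         (\<forall>v. \<bar>D v\<bar> \<le> L * K * (m t (dist x y) / dist x y) / box_weight \<alpha> x (dist x y) * norm v)"
        unfolding F_def by (rule transfer[OF _ le(2)]) (use G[OF a(1-3)] in blast)
    qed
    moreover have "kernelA \<alpha> \<epsilon> \<eta> = (\<lambda>x y. set_lebesgue_integral lborel {0<..} (\<lambda>t. complex_of_real (F t (x, y)) * (- \<eta> t)))"
      by (simp add: fun_eq_iff kernelA_def F_def set_lebesgue_integral_def)
    ultimately show "CZ_estimates \<alpha> (kernelA \<alpha> \<epsilon> \<eta>)" by simp
  next
    fix M :: "real measure" and h :: "real \<Rightarrow> complex"
    assume sM: "sets M = sets borel" and h: "h \<in> borel_measurable M"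
      and int: "set_integrable M {0<..} (\<lambda>t. exp (- t * lambda0 \<alpha>) * norm (h t))"
    \<comment> \<open>The profile does not depend on r, so the integrability assumed of the measure
      supplies both the domination and the uniform constant A.\<close>
    define m where "m = (\<lambda>t r::real. exp (- t * lambda0 \<alpha>))"
    define F where "F = (\<lambda>t p. heatG \<alpha> \<epsilon> t (fst p) (snd p))"
    have "CZ_estimates \<alpha> (\<lambda>x y. set_lebesgue_integral M {0<..} (\<lambda>t. complex_of_real (F t (x, y)) * h t))"
    proof (rule CZ_estimates_integral[where m = m and C = "L * K"
          and A = "set_lebesgue_integral M {0<..} (\<lambda>t. exp (- t * lambda0 \<alpha>) * norm (h t))", OF assms(1) sM _ _ LK])
      show "set_borel_measurable borel {0<..} (\<lambda>t. F t (x, y))" if "x \<in> Rplus" "y \<in> Rplus" for x y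
        unfolding F_def fst_conv snd_conv
        by (rule set_borel_measurable_differentiable(1)) (use G that in blast)
      have "{0<..} \<in> sets M" by (simp add: sM)
      thus "set_borel_measurable M {0<..} h"
        using h unfolding set_borel_measurable_def by measurable
      show "m t r' / r' \<le> m t r / r" if "t > 0" "0 < r" "r \<le> r'" for t r r'
        using that unfolding m_def by (intro divide_left_mono) auto
      fix t :: real and x y :: "real ^ 'd"
      assume a: "t > 0" "x \<in> Rplus" "y \<in> Rplus" "x \<noteq> y"
      have le: "L * heat_product_majorant \<alpha> t x y \<le> L * K * m t (dist x y) / box_weight \<alpha> x (dist x y)"
        "L * (heat_product_majorant \<alpha> t x y / sqrt (tanh t)) \<le> L * K * (m t (dist x y) / dist x y) / box_weight \<alpha> x (dist x y)"
        by (rule scale; use PK[OF a] a(4) in \<open>simp add: m_def\<close>)+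
      show "\<bar>F t (x, y)\<bar> \<le> L * K * m t (dist x y) / box_weight \<alpha> x (dist x y)"
        using G[OF a(1-3)] le(1) by (simp add: F_def)
      show "\<exists>D. (F t has_derivative D) (at (x, y)) \<and>
         (\<forall>v. \<bar>D v\<bar> \<le> L * K * (m t (dist x y) / dist x y) / box_weight \<alpha> x (dist x y) * norm v)"
        unfolding F_def by (rule transfer[OF _ le(2)]) (use G[OF a(1-3)] in blast)
    qed (use int in \<open>auto simp: m_def\<close>)
    thus "CZ_estimates \<alpha> (kernelB \<alpha> \<epsilon> M h)" by (simp add: F_def kernelB_def[abs_def])
  qed
qed

end
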